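(* Let $X=\mathbb{CP}^3$, let $Q\subset X$ be a smooth quadric, and let $X_Q$ be the non-Hausdorff space obtained from two copies $X_+,X_-$ of $X$ by identifying them along $X\setminus Q$. Let $[X_Q]_{\rm cyc}$ be any top-dimensional (degree six) fundamental cyclic cocycle obtained by integrating over either sheet $X_+$ or $X_-$, or over a linear combination of the two sheets. Then the strict tangent-module pairing vanishes: $$Z_{\mathrm{strict}}(X_Q):=\left\langle [X_Q]_{\rm cyc},[T_{\mathbb R}X\otimes\mathbb C]\right\rangle=0 .$$
   Context: Here $T_{\mathbb R}X$ is the real tangent bundle of the six-dimensional real manifold underlying $X=\mathbb{CP}^3$, and $[T_{\mathbb R}X\otimes\mathbb C]$ is the K-theory class given by the complex vector bundle $T_{\mathbb R}X\otimes\mathbb C$ on each of the two sheets $X_+$ and $X_-$. For coefficients $a,b\in\mathbb C$, the top-dimensional fundamental cyclic class $[X_Q]_{\rm cyc}=a[X_+]+b[X_-]$ is given by integration over the sheets, with the standard Chern--Connes normalization: its pairing with the class of a pair of complex vector bundles $E_+\to X_+$, $E_-\to X_-$ is $$a\int_{X_+}\mathrm{ch}_3(E_+)+b\int_{X_-}\mathrm{ch}_3(E_-),$$ where $\mathrm{ch}_3$ is the degree-six component of the Chern character, i.e. $\mathrm{ch}_k=\frac1{k!}\sum_j x_j^k$ in terms of Chern roots $x_j$. *)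

theory Defs
  imports "HOL-Analysis.Analysis"
begin

section \<open>Smooth maps\<close>

text \<open>Meant for open \<open>S\<close>: \<open>k\<close> times continuously differentiable, by iterated partial derivatives.\<close>

primrec C_k_on :: "nat \<Rightarrow> ('a::euclidean_space \<Rightarrow> 'b::real_normed_vector) \<Rightarrow> 'a set \<Rightarrow> bool" where
  "C_k_on 0 f S \<longleftrightarrow> continuous_on S f"
| "C_k_on (Suc k) f S \<longleftrightarrow>
     f differentiable_on S \<and>
     (\<forall>v\<in>Basis. C_k_on k (\<lambda>x. frechet_derivative f (at x) v) S)"

definition smooth_on :: "('a::euclidean_space \<Rightarrow> 'b::real_normed_vector) \<Rightarrow> 'a set \<Rightarrow> bool" where
  "smooth_on f S \<longleftrightarrow> (\<forall>k. C_k_on k f S)"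

definition pderiv_at :: "6 \<Rightarrow> (real^6 \<Rightarrow> 'b::real_normed_vector) \<Rightarrow> real^6 \<Rightarrow> 'b" where
  "pderiv_at k f x = frechet_derivative f (at x) (axis k 1)"


section \<open>Oriented six-manifolds covered by parametrizations by \<open>\<real>\<^sup>6\<close>\<close>

text \<open>A family \<open>\<phi> i\<close> of parametrizations of open pieces of a space.
  Everything local is written in the coordinates \<open>x\<close> of a chart: \<open>overlap \<phi> i j\<close> is the part
  of chart \<open>i\<close> that also lies in chart \<open>j\<close>, and \<open>transition \<phi> i j\<close> is the change from
  \<open>i\<close>-coordinates to \<open>j\<close>-coordinates there.\<close>

definition overlap :: "('i \<Rightarrow> real^6 \<Rightarrow> 'p) \<Rightarrow> 'i \<Rightarrow> 'i \<Rightarrow> (real^6) set" where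
  "overlap \<phi> i j = {x. \<phi> i x \<in> range (\<phi> j)}"

definition transition :: "('i \<Rightarrow> real^6 \<Rightarrow> 'p) \<Rightarrow> 'i \<Rightarrow> 'i \<Rightarrow> real^6 \<Rightarrow> real^6" where
  "transition \<phi> i j x = inv (\<phi> j) (\<phi> i x)"

definition oriented_atlas :: "'p topology \<Rightarrow> ('i \<Rightarrow> real^6 \<Rightarrow> 'p) \<Rightarrow> bool" where
  "oriented_atlas T \<phi> \<longleftrightarrow>
     (\<forall>i. embedding_map euclidean T (\<phi> i) \<and> openin T (range (\<phi> i))) \<and>
     topspace T = (\<Union>i. range (\<phi> i)) \<and>
     (\<forall>i j. smooth_on (transition \<phi> i j) (overlap \<phi> i j) \<and>
        (\<forall>x\<in>overlap \<phi> i j. det (jacobian (transition \<phi> i j) (at x)) > 0))"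


section \<open>Complex vector bundles and the Chern character form\<close>

text \<open>Charts are contractible, so a complex vector bundle of rank \<open>CARD('n)\<close> is trivial over each
  of them and is given by its transition matrices: \<open>g i j x\<close> takes the components of a section in
  the frame over chart \<open>i\<close> to those in the frame over chart \<open>j\<close>, at the point with
  \<open>i\<close>-coordinates \<open>x\<close>.\<close>

definition vector_bundle ::
    "'p topology \<Rightarrow> ('i \<Rightarrow> real^6 \<Rightarrow> 'p) \<Rightarrow> ('i \<Rightarrow> 'i \<Rightarrow> real^6 \<Rightarrow> complex^'n^'n) \<Rightarrow> bool" where
  "vector_bundle T \<phi> g \<longleftrightarrow>
     oriented_atlas T \<phi> \<and>
     (\<forall>i j. smooth_on (g i j) (overlap \<phi> i j) \<and> (\<forall>x\<in>overlap \<phi> i j. invertible (g i j x))) \<and>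
     (\<forall>i x. g i i x = mat 1) \<and>
     (\<forall>i j k. \<forall>x\<in>overlap \<phi> i j \<inter> overlap \<phi> i k.
        g i k x = g j k (transition \<phi> i j x) ** g i j x)"

text \<open>The complexification of the real tangent bundle: its transition matrices are the real
  Jacobian matrices of the coordinate changes, read as complex matrices.\<close>

definition complexified_tangent ::
    "('i \<Rightarrow> real^6 \<Rightarrow> 'p) \<Rightarrow> 'i \<Rightarrow> 'i \<Rightarrow> real^6 \<Rightarrow> complex^6^6" where
  "complexified_tangent \<phi> i j x =
     (\<chi> r c. complex_of_real (jacobian (transition \<phi> i j) (at x) $ r $ c))"

text \<open>A connection \<open>\<nabla> = d + A i\<close> over chart \<open>i\<close>, with \<open>A i = (\<Sum>k. A i k dx\<^sub>k)\<close>. The last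
  clause says that the local expressions agree on overlaps: with \<open>\<psi> = transition \<phi> i j\<close> and
  \<open>g = g i j\<close> it is \<open>(\<psi>\<^sup>* A j) g + dg = g (A i)\<close>.\<close>

definition connection ::
    "'p topology \<Rightarrow> ('i \<Rightarrow> real^6 \<Rightarrow> 'p) \<Rightarrow> ('i \<Rightarrow> 'i \<Rightarrow> real^6 \<Rightarrow> complex^'n^'n) \<Rightarrow>
     ('i \<Rightarrow> 6 \<Rightarrow> real^6 \<Rightarrow> complex^'n^'n) \<Rightarrow> bool" where
  "connection T \<phi> g A \<longleftrightarrow>
     vector_bundle T \<phi> g \<and>
     (\<forall>i k. smooth_on (A i k) UNIV) \<and>
     (\<forall>i j k. \<forall>x\<in>overlap \<phi> i j.
        (\<Sum>l\<in>UNIV. jacobian (transition \<phi> i j) (at x) $ l $ k *\<^sub>R A j l (transition \<phi> i j x)) ** g i j x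
          + pderiv_at k (g i j) x
        = g i j x ** A i k x)"

text \<open>The components of \<open>F = dA + A \<and> A = 1/2 (\<Sum>k l. F k l dx\<^sub>k \<and> dx\<^sub>l)\<close>.\<close>

definition curvature ::
    "(6 \<Rightarrow> real^6 \<Rightarrow> complex^'n^'n) \<Rightarrow> 6 \<Rightarrow> 6 \<Rightarrow> real^6 \<Rightarrow> complex^'n^'n" where
  "curvature A k l x =
     pderiv_at k (A l) x - pderiv_at l (A k) x + A k x ** A l x - A l x ** A k x"

text \<open>By Chern--Weil theory the Chern roots are represented by the eigenvalues of
  \<open>\<i>F/2\<pi>\<close>, so \<open>ch\<^sub>3 = (1/3!) \<Sum> x\<^sub>j\<^sup>3\<close> is represented by
  \<open>(1/3!) tr ((\<i>F/2\<pi>)\<^sup>3)\<close>. This is the coefficient of \<open>dx\<^sub>1 \<and> \<dots> \<and> dx\<^sub>6\<close> in that form; the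
  factor \<open>1/8\<close> is the cube of the \<open>1/2\<close> in \<open>F\<close>. In the index type the numeral \<open>6\<close> is \<open>0\<close>.\<close>

definition ch3_form :: "(6 \<Rightarrow> real^6 \<Rightarrow> complex^'n^'n) \<Rightarrow> real^6 \<Rightarrow> complex" where
  "ch3_form A x =
     1 / fact 3 * (\<i> / (2 * of_real pi)) ^ 3 *
     (1 / 8 * (\<Sum>p | p permutes (UNIV :: 6 set).
        of_int (sign p) *
        trace (curvature A (p 1) (p 2) x ** curvature A (p 3) (p 4) x ** curvature A (p 5) (p 6) x)))"

text \<open>The integral of a top-degree form with local coefficients \<open>\<omega> i\<close>, by cutting the manifold
  into the disjoint pieces consisting of the points of chart \<open>i\<close> in no earlier chart.\<close>

definition form_integral ::
    "('i::{finite,linorder} \<Rightarrow> real^6 \<Rightarrow> 'p) \<Rightarrow> ('i \<Rightarrow> real^6 \<Rightarrow> complex) \<Rightarrow> complex" where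
  "form_integral \<phi> \<omega> =
     (\<Sum>i\<in>UNIV. LINT x : {x. \<forall>j<i. \<phi> i x \<notin> range (\<phi> j)} | lborel. \<omega> i x)"

text \<open>On a compact manifold the integral below is the same for every connection on the bundle.\<close>

definition ch3_integral ::
    "'p topology \<Rightarrow> ('i::{finite,linorder} \<Rightarrow> real^6 \<Rightarrow> 'p) \<Rightarrow>
     ('i \<Rightarrow> 'i \<Rightarrow> real^6 \<Rightarrow> complex^'n^'n) \<Rightarrow> complex" where
  "ch3_integral T \<phi> g =
     (THE v. \<exists>A. connection T \<phi> g A \<and> v = form_integral \<phi> (\<lambda>i. ch3_form (A i)))"


section \<open>Complex projective three-space and smooth quadrics\<close>

definition quotient_topology :: "'a topology \<Rightarrow> ('a \<Rightarrow> 'b) \<Rightarrow> 'b topology" where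
  "quotient_topology T q =
     topology (\<lambda>U. U \<subseteq> q ` topspace T \<and> openin T {x \<in> topspace T. q x \<in> U})"

definition complex_line :: "complex^4 \<Rightarrow> (complex^4) set" where
  "complex_line z = range (\<lambda>c. c *s z)"

definition CP3 :: "(complex^4) set topology" where
  "CP3 = quotient_topology (top_of_set (- {0})) complex_line"

text \<open>The standard affine charts \<open>z\<^sub>i = 1\<close>, with orientation given by the complex structure.
  Indices in \<open>4\<close> are added modulo 4; the three affine coordinates fill the places
  \<open>i + 1, i + 2, i + 3\<close>.\<close>

definition affine_coords :: "4 \<Rightarrow> real^6 \<Rightarrow> complex^4" where
  "affine_coords i x =
     (\<chi> k. if k = i then 1
          else if k = i + 1 then Complex (x $ 1) (x $ 2)
          else if k = i + 2 then Complex (x $ 3) (x $ 4)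
          else Complex (x $ 5) (x $ 6))"

definition CP3_chart :: "4 \<Rightarrow> real^6 \<Rightarrow> (complex^4) set" where
  "CP3_chart i x = complex_line (affine_coords i x)"

definition quadratic_form :: "complex^4^4 \<Rightarrow> complex^4 \<Rightarrow> complex" where
  "quadratic_form S z = (\<Sum>i\<in>UNIV. \<Sum>j\<in>UNIV. S $ i $ j * z $ i * z $ j)"

text \<open>Smoothness is the Jacobian criterion: the gradient \<open>2 S z\<close> of the defining form vanishes at
  no point of the quadric.\<close>

definition smooth_quadric :: "(complex^4) set set \<Rightarrow> bool" where
  "smooth_quadric Q \<longleftrightarrow>
     (\<exists>S. transpose S = S \<and>
          Q = {complex_line z | z. z \<noteq> 0 \<and> quadratic_form S z = 0} \<and>
          (\<forall>z. z \<noteq> 0 \<and> quadratic_form S z = 0 \<longrightarrow> S *v z \<noteq> 0))"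


section \<open>Two copies of projective space glued away from \<open>Q\<close>\<close>

datatype sheet = Plus | Minus

text \<open>\<open>glue Q\<close> sends a point of the disjoint union to its class under the relation identifying
  \<open>(Plus, p)\<close> with \<open>(Minus, p)\<close> for \<open>p \<notin> Q\<close>.\<close>

definition glue :: "'a set \<Rightarrow> sheet \<times> 'a \<Rightarrow> (sheet \<times> 'a) set" where
  "glue Q = (\<lambda>(s, p). if p \<in> Q then {(s, p)} else {(Plus, p), (Minus, p)})"

definition X_Q :: "(complex^4) set set \<Rightarrow> (sheet \<times> (complex^4) set) set topology" where
  "X_Q Q = quotient_topology (sum_topology (\<lambda>_. CP3) UNIV) (glue Q)"

definition sheet_space ::
    "(complex^4) set set \<Rightarrow> sheet \<Rightarrow> (sheet \<times> (complex^4) set) set topology" where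
  "sheet_space Q s = subtopology (X_Q Q) ((\<lambda>p. glue Q (s, p)) ` topspace CP3)"

definition sheet_chart ::
    "(complex^4) set set \<Rightarrow> sheet \<Rightarrow> 4 \<Rightarrow> real^6 \<Rightarrow> (sheet \<times> (complex^4) set) set" where
  "sheet_chart Q s i x = glue Q (s, CP3_chart i x)"


section \<open>Fundamental cyclic classes and the strict pairing\<close>

text \<open>A pair of complex vector bundles over the two sheets is given by its transition matrices in the
  sheet charts. The functional is \<open>a [X\<^sub>+] + b [X\<^sub>-]\<close> on the K-theory class of the pair.\<close>

definition fundamental_cyclic_class ::
    "(complex^4) set set \<Rightarrow> complex \<Rightarrow> complex \<Rightarrow>
     (4 \<Rightarrow> 4 \<Rightarrow> real^6 \<Rightarrow> complex^'n^'n) \<times> (4 \<Rightarrow> 4 \<Rightarrow> real^6 \<Rightarrow> complex^'m^'m) \<Rightarrow> complex" where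
  "fundamental_cyclic_class Q a b = (\<lambda>(E, E').
     a * ch3_integral (sheet_space Q Plus) (sheet_chart Q Plus) E +
     b * ch3_integral (sheet_space Q Minus) (sheet_chart Q Minus) E')"

text \<open>The charts of each sheet are the charts of \<open>CP3\<close>, so the transition matrices of a bundle over
  \<open>CP3\<close> also describe its copy over either sheet.\<close>

definition tangent_class ::
    "(4 \<Rightarrow> 4 \<Rightarrow> real^6 \<Rightarrow> complex^6^6) \<times> (4 \<Rightarrow> 4 \<Rightarrow> real^6 \<Rightarrow> complex^6^6)" where
  "tangent_class = (complexified_tangent CP3_chart, complexified_tangent CP3_chart)"

definition Z_strict :: "(complex^4) set set \<Rightarrow> complex \<Rightarrow> complex \<Rightarrow> complex" where
  "Z_strict Q a b = fundamental_cyclic_class Q a b tangent_class"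

end

theory Submission
  imports Defs
begin

text \<open>The Chern--Weil integral of \<open>T\<^bsub>\<real>\<^esub>\<complex>P\<^sup>3 \<otimes> \<complex>\<close> is independent of the connection: \<open>ch\<^sub>3\<close> of two
  connections differs by the exterior derivative of a global transgression form. In one affine chart,
  whose complement is a null set, this form decays so fast that multiplying by cut-off functions and
  integrating by parts leaves nothing in the limit. The Levi-Civita connection of the Fubini--Study
  metric has skew-symmetric curvature \<open>F\<close>, so \<open>tr F\<^sup>3 = tr (F\<^sup>3)\<^sup>T = - tr F\<^sup>3\<close> vanishes pointwise,
  and both sheets contribute \<open>0\<close>. Gluing does not change the individual sheets, which are copies of \<open>\<complex>P\<^sup>3\<close>.\<close>

section \<open>Smooth maps and the symmetry of second derivatives\<close>

text \<open>\<open>ch3_integral\<close> is a definite description, so one needs both a connection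
  and the equality of all the integrals. Working in a single chart, the only source of decay is that
  all data extend smoothly over the points at infinity. A plain count of orders is not enough there.
  In the chart of the largest homogeneous coordinate, of modulus \<rho> (at least R/2 where norm x
  \<ge> R), the transgression form is bounded, and its pull-back carries five Jacobian entries of
  order 1/\<rho>; with 1/R from the derivative of the cut-off and the volume R^6 of the region this
  gives only O(1). Antisymmetrisation supplies the missing factor: five distinct rows of the
  Jacobian include a derivative of 1/Z_j, which is of order 1/\<rho>^2, and the total becomes
  O(1/R). Integrability of the Chern form itself is never established: the Bochner integral of a
  non-integrable function is 0, which is the value wanted. The path between the two connections is
  sampled at five values of t only, so no estimate uniform in t is required.\<close>

lemma C_k_on_cong:
  assumes "open S" "\<And>x. x \<in> S \<Longrightarrow> f x = g x" "C_k_on k f S"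
  shows "C_k_on k g S"
  using assms(2,3)
proof (induction k arbitrary: f g)
  case 0
  then show ?case by (simp cong: continuous_on_cong)
next
  case (Suc k)
  have d: "f differentiable at x" if "x \<in> S" for x
    using Suc.prems(2) that assms(1) by (simp add: differentiable_on_eq_differentiable_at)
  have g: "(g has_derivative frechet_derivative f (at x)) (at x)" if "x \<in> S" for x
    using has_derivative_transform_within_open[OF _ assms(1) that] d[OF that] Suc.prems(1)
      frechet_derivative_works by blast
  have eq: "frechet_derivative g (at x) = frechet_derivative f (at x)" if "x \<in> S" for x
    using g[OF that] frechet_derivative_at by metis
  have "g differentiable_on S"
    unfolding differentiable_on_eq_differentiable_at[OF assms(1)]
    using g differentiable_def by blast
  moreover have "C_k_on k (\<lambda>x. frechet_derivative g (at x) v) S" if "v \<in> Basis" for v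
    by (rule Suc.IH[of "\<lambda>x. frechet_derivative f (at x) v"]) (use that Suc.prems eq in auto)
  ultimately show ?case by simp
qed

text \<open>On an open set derivatives are unique, so any explicit derivative may stand for
  \<open>frechet_derivative\<close>. The closure lemmas below all go through this rule and never
  handle the choice operator.\<close>

lemma C_k_on_SucI:
  assumes "open S" "\<And>x. x \<in> S \<Longrightarrow> (f has_derivative f' x) (at x)"
    "\<And>v. v \<in> Basis \<Longrightarrow> C_k_on k (\<lambda>x. f' x v) S"
  shows "C_k_on (Suc k) f S"
proof -
  have eq: "f' x = frechet_derivative f (at x)" if "x \<in> S" for x
    using assms(2)[OF that] frechet_derivative_at by metis
  have "f differentiable_on S"
    unfolding differentiable_on_eq_differentiable_at[OF assms(1)]
    using assms(2) differentiable_def by blast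
  moreover have "C_k_on k (\<lambda>x. frechet_derivative f (at x) v) S" if "v \<in> Basis" for v
    by (rule C_k_on_cong[OF assms(1) _ assms(3)[OF that]]) (use eq in auto)
  ultimately show ?thesis by simp
qed

lemma C_k_on_Suc_has_derivative:
  assumes "open S" "C_k_on (Suc k) f S" "x \<in> S"
  shows "(f has_derivative frechet_derivative f (at x)) (at x)"
  using assms by (simp add: differentiable_on_eq_differentiable_at frechet_derivative_works)

lemma C_k_on_SucD: "C_k_on (Suc k) f S \<Longrightarrow> C_k_on k f S"
proof (induction k arbitrary: f)
  case 0
  then show ?case by (simp add: differentiable_imp_continuous_on)
next
  case (Suc k)
  then show ?case by (metis C_k_on.simps(2))
qed

lemma C_k_on_subset: "C_k_on k f S \<Longrightarrow> T \<subseteq> S \<Longrightarrow> C_k_on k f T"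
proof (induction k arbitrary: f)
  case 0
  then show ?case by (auto intro: continuous_on_subset)
next
  case (Suc k)
  then show ?case by (auto intro: differentiable_on_subset)
qed

lemma C_k_on_const: "open S \<Longrightarrow> C_k_on k (\<lambda>x. c) S"
proof (induction k arbitrary: c)
  case (Suc k)
  show ?case
    by (rule C_k_on_SucI[where f'="\<lambda>x v. 0"]) (use Suc in auto)
qed simp

lemma C_k_on_add:
  assumes "open S" "C_k_on k f S" "C_k_on k g S"
  shows "C_k_on k (\<lambda>x. f x + g x) S"
  using assms(2,3)
proof (induction k arbitrary: f g)
  case 0
  then show ?case by (auto intro: continuous_intros)
next
  case (Suc k)
  show ?case
  proof (rule C_k_on_SucI[OF assms(1)])
    show "((\<lambda>x. f x + g x) has_derivative
        (\<lambda>v. frechet_derivative f (at x) v + frechet_derivative g (at x) v)) (at x)" if "x \<in> S" for x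
      by (rule has_derivative_add[OF C_k_on_Suc_has_derivative[OF assms(1) Suc.prems(1) that]
          C_k_on_Suc_has_derivative[OF assms(1) Suc.prems(2) that]])
    show "C_k_on k (\<lambda>x. frechet_derivative f (at x) v + frechet_derivative g (at x) v) S"
      if "v \<in> Basis" for v
      by (rule Suc.IH) (use Suc.prems that in auto)
  qed
qed

lemma C_k_on_bounded_linear:
  assumes "open S" "bounded_linear h" "C_k_on k f S"
  shows "C_k_on k (\<lambda>x. h (f x)) S"
  using assms(3)
proof (induction k arbitrary: f)
  case 0
  then show ?case
    using assms(2) by (auto intro: bounded_linear.continuous_on)
next
  case (Suc k)
  show ?case
  proof (rule C_k_on_SucI[OF assms(1)])
    show "((\<lambda>x. h (f x)) has_derivative (\<lambda>v. h (frechet_derivative f (at x) v))) (at x)"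
      if "x \<in> S" for x
      by (rule bounded_linear.has_derivative[OF assms(2)
          C_k_on_Suc_has_derivative[OF assms(1) Suc.prems(1) that]])
    show "C_k_on k (\<lambda>x. h (frechet_derivative f (at x) v)) S" if "v \<in> Basis" for v
      by (rule Suc.IH) (use Suc.prems that in auto)
  qed
qed

text \<open>The product rule returns undifferentiated factors, which are needed at one order less;
  \<open>C_k_on_SucD\<close> provides that.\<close>

lemma C_k_on_bounded_bilinear:
  assumes "open S" "bounded_bilinear h" "C_k_on k f S" "C_k_on k g S"
  shows "C_k_on k (\<lambda>x. h (f x) (g x)) S"
  using assms(3,4)
proof (induction k arbitrary: f g)
  case 0
  then show ?case
    using assms(2) by (auto intro: bounded_bilinear.continuous_on)
next
  case (Suc k)
  show ?case
  proof (rule C_k_on_SucI[OF assms(1)])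
    show "((\<lambda>x. h (f x) (g x)) has_derivative (\<lambda>v. h (f x) (frechet_derivative g (at x) v) +
        h (frechet_derivative f (at x) v) (g x))) (at x)" if "x \<in> S" for x
      by (rule bounded_bilinear.FDERIV[OF assms(2)
          C_k_on_Suc_has_derivative[OF assms(1) Suc.prems(1) that]
          C_k_on_Suc_has_derivative[OF assms(1) Suc.prems(2) that]])
    show "C_k_on k (\<lambda>x. h (f x) (frechet_derivative g (at x) v) +
        h (frechet_derivative f (at x) v) (g x)) S" if "v \<in> Basis" for v
    proof (rule C_k_on_add[OF assms(1) Suc.IH Suc.IH])
      show "C_k_on k f S" "C_k_on k g S"
        using Suc.prems C_k_on_SucD by blast+
      show "C_k_on k (\<lambda>x. frechet_derivative f (at x) v) S" "C_k_on k (\<lambda>x. frechet_derivative g (at x) v) S"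
        using Suc.prems that by auto
    qed
  qed
qed

text \<open>The derivative of 1/f is a polynomial in 1/f and the derivative of \<open>f\<close>, so
  the induction can keep \<open>f\<close> fixed.\<close>

lemma C_k_on_inverse:
  fixes f :: "'a::euclidean_space \<Rightarrow> 'b::real_normed_field"
  assumes "open S" "C_k_on k f S" "\<And>x. x \<in> S \<Longrightarrow> f x \<noteq> 0"
  shows "C_k_on k (\<lambda>x. inverse (f x)) S"
  using assms(2)
proof (induction k)
  case 0
  then show ?case using assms(3) by (auto intro: continuous_intros)
next
  case (Suc k)
  have inv: "C_k_on k (\<lambda>x. inverse (f x)) S"
    using Suc C_k_on_SucD by blast
  show ?case
  proof (rule C_k_on_SucI[OF assms(1)])
    show "((\<lambda>x. inverse (f x)) has_derivative
        (\<lambda>v. - (inverse (f x) * frechet_derivative f (at x) v * inverse (f x)))) (at x)"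
      if "x \<in> S" for x
      by (rule Deriv.has_derivative_inverse[OF assms(3)[OF that]
          C_k_on_Suc_has_derivative[OF assms(1) Suc.prems(1) that]])
    show "C_k_on k (\<lambda>x. - (inverse (f x) * frechet_derivative f (at x) v * inverse (f x))) S"
      if "v \<in> Basis" for v
      by (intro C_k_on_bounded_linear[OF assms(1) bounded_linear_minus[OF bounded_linear_ident]]
          C_k_on_bounded_bilinear[OF assms(1) bounded_bilinear_mult] inv)
        (use Suc.prems that in auto)
  qed
qed

section \<open>Closure properties of smooth maps\<close>

lemma smooth_on_cong:
  "smooth_on f S \<Longrightarrow> open S \<Longrightarrow> (\<And>x. x \<in> S \<Longrightarrow> f x = g x) \<Longrightarrow> smooth_on g S"
  unfolding smooth_on_def using C_k_on_cong by blast

lemma smooth_on_subset: "smooth_on f S \<Longrightarrow> T \<subseteq> S \<Longrightarrow> smooth_on f T"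
  unfolding smooth_on_def using C_k_on_subset by blast

lemma smooth_on_const: "open S \<Longrightarrow> smooth_on (\<lambda>x. c) S"
  unfolding smooth_on_def using C_k_on_const by blast

lemma smooth_on_add:
  "open S \<Longrightarrow> smooth_on f S \<Longrightarrow> smooth_on g S \<Longrightarrow> smooth_on (\<lambda>x. f x + g x) S"
  unfolding smooth_on_def using C_k_on_add by blast

lemma smooth_on_bounded_linear:
  "open S \<Longrightarrow> bounded_linear h \<Longrightarrow> smooth_on f S \<Longrightarrow> smooth_on (\<lambda>x. h (f x)) S"
  unfolding smooth_on_def using C_k_on_bounded_linear by blast

lemma smooth_on_bounded_bilinear:
  "open S \<Longrightarrow> bounded_bilinear h \<Longrightarrow> smooth_on f S \<Longrightarrow> smooth_on g S \<Longrightarrow>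
    smooth_on (\<lambda>x. h (f x) (g x)) S"
  unfolding smooth_on_def using C_k_on_bounded_bilinear by blast

lemma smooth_on_inverse:
  fixes f :: "'a::euclidean_space \<Rightarrow> 'b::real_normed_field"
  shows "open S \<Longrightarrow> smooth_on f S \<Longrightarrow> (\<And>x. x \<in> S \<Longrightarrow> f x \<noteq> 0) \<Longrightarrow> smooth_on (\<lambda>x. inverse (f x)) S"
  unfolding smooth_on_def using C_k_on_inverse by blast

lemma smooth_on_frechet_derivative:
  "smooth_on f S \<Longrightarrow> v \<in> Basis \<Longrightarrow> smooth_on (\<lambda>x. frechet_derivative f (at x) v) S"
  unfolding smooth_on_def by (metis C_k_on.simps(2))

lemma smooth_on_has_derivative:
  "smooth_on f S \<Longrightarrow> open S \<Longrightarrow> x \<in> S \<Longrightarrow> (f has_derivative frechet_derivative f (at x)) (at x)"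
  unfolding smooth_on_def using C_k_on_Suc_has_derivative by blast

lemma smooth_on_continuous_on: "smooth_on f S \<Longrightarrow> continuous_on S f"
  unfolding smooth_on_def by (metis C_k_on.simps(1))

lemma smooth_on_linear:
  fixes f :: "'a::euclidean_space \<Rightarrow> 'b::real_normed_vector"
  assumes "open S" "bounded_linear f"
  shows "smooth_on f S"
  unfolding smooth_on_def
proof
  fix k
  have "C_k_on (Suc k) f S"
    by (rule C_k_on_SucI[OF assms(1) bounded_linear_imp_has_derivative[OF assms(2)]])
      (use assms C_k_on_const in auto)
  then show "C_k_on k f S" by (rule C_k_on_SucD)
qed

lemma smooth_on_minus:
  "open S \<Longrightarrow> smooth_on f S \<Longrightarrow> smooth_on (\<lambda>x. - f x) S"
  by (rule smooth_on_bounded_linear[OF _ bounded_linear_minus[OF bounded_linear_ident]])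

lemma smooth_on_diff:
  assumes "open S" "smooth_on f S" "smooth_on g S"
  shows "smooth_on (\<lambda>x. f x - g x) S"
  using smooth_on_add[OF assms(1,2) smooth_on_minus[OF assms(1,3)]] by simp

lemma smooth_on_mult:
  fixes f :: "'a::euclidean_space \<Rightarrow> 'b::real_normed_algebra"
  shows "open S \<Longrightarrow> smooth_on f S \<Longrightarrow> smooth_on g S \<Longrightarrow> smooth_on (\<lambda>x. f x * g x) S"
  by (rule smooth_on_bounded_bilinear[OF _ bounded_bilinear_mult])

lemma C_k_on_sum:
  assumes "open S" "\<And>i. i \<in> I \<Longrightarrow> C_k_on k (f i) S"
  shows "C_k_on k (\<lambda>x. \<Sum>i\<in>I. f i x) S"
  using assms(2)
proof (induction I rule: infinite_finite_induct)
  case (insert i I)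
  then show ?case by (simp add: C_k_on_add[OF assms(1)])
qed (simp_all add: C_k_on_const assms(1))

lemma smooth_on_sum:
  "open S \<Longrightarrow> (\<And>i. i \<in> I \<Longrightarrow> smooth_on (f i) S) \<Longrightarrow> smooth_on (\<lambda>x. \<Sum>i\<in>I. f i x) S"
  unfolding smooth_on_def by (intro allI C_k_on_sum) auto

lemma norm_axis:
  fixes c :: "'a::real_normed_vector"
  shows "norm (axis i c :: 'a^'n) = norm c"
proof -
  have "(\<Sum>j\<in>UNIV. (norm (axis i c $ j))\<^sup>2) = (\<Sum>j\<in>UNIV. if j = i then (norm c)\<^sup>2 else 0)"
    by (rule sum.cong) (auto simp: axis_def)
  then show ?thesis
    by (simp add: norm_vec_def L2_set_def)
qed

text \<open>A vector is the sum of its entries placed on the axes. The entries may themselves be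
  vectors, so two applications treat matrices.\<close>

lemma smooth_on_vec_lambda:
  fixes f :: "'n::finite \<Rightarrow> 'a::euclidean_space \<Rightarrow> 'b::real_normed_vector"
  assumes "open S" "\<And>i. smooth_on (f i) S"
  shows "smooth_on (\<lambda>x. \<chi> i. f i x) S"
proof -
  have bl: "bounded_linear (\<lambda>c::'b. axis i c :: 'b^'n)" for i
    by (rule bounded_linear_intro[where K=1]) (simp_all add: norm_axis, simp_all add: axis_def vec_eq_iff)
  have "smooth_on (\<lambda>x. \<Sum>i\<in>UNIV. axis i (f i x) :: 'b^'n) S"
    by (intro smooth_on_sum assms smooth_on_bounded_linear[OF assms(1) bl])
  also have "(\<lambda>x. \<Sum>i\<in>UNIV. axis i (f i x) :: 'b^'n) = (\<lambda>x. \<chi> i. f i x)"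
    by (auto simp: vec_eq_iff axis_def)
  finally show ?thesis .
qed

lemma smooth_on_vec_nth: "open S \<Longrightarrow> smooth_on f S \<Longrightarrow> smooth_on (\<lambda>x. f x $ i) S"
  by (rule smooth_on_bounded_linear[OF _ bounded_linear_vec_nth])

section \<open>Symmetry of second derivatives through second differences\<close>

text \<open>Two uses of the mean value theorem: along \<open>u\<close> for the increment of
  \<open>f\<close> in direction \<open>v\<close>, then along \<open>v\<close> for the derivative in
  direction \<open>u\<close>.\<close>

lemma second_difference_mvt:
  fixes f :: "'a::euclidean_space \<Rightarrow> real"
  assumes S: "open S" "C_k_on 2 f S" and uv: "u \<in> Basis" "v \<in> Basis" and h: "0 < h"
    and in_S: "\<And>s t. 0 \<le> s \<Longrightarrow> s \<le> h \<Longrightarrow> 0 \<le> t \<Longrightarrow> t \<le> h \<Longrightarrow> x + s *\<^sub>R u + t *\<^sub>R v \<in> S"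
  shows "\<exists>s t. 0 \<le> s \<and> s \<le> h \<and> 0 \<le> t \<and> t \<le> h \<and>
    f (x + h *\<^sub>R u + h *\<^sub>R v) - f (x + h *\<^sub>R u) - f (x + h *\<^sub>R v) + f x =
    h * h * frechet_derivative (\<lambda>y. frechet_derivative f (at y) u) (at (x + s *\<^sub>R u + t *\<^sub>R v)) v"
proof -
  let ?fu = "\<lambda>y. frechet_derivative f (at y) u"
  have C: "C_k_on (Suc (Suc 0)) f S" using S(2) by (simp add: numeral_2_eq_2)
  have Cu: "C_k_on (Suc 0) ?fu S" using C uv(1) by (metis C_k_on.simps(2))
  have d1: "((\<lambda>s. f (x + s *\<^sub>R u + t *\<^sub>R v)) has_real_derivative ?fu (x + s *\<^sub>R u + t *\<^sub>R v)) (at s)"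
    if "x + s *\<^sub>R u + t *\<^sub>R v \<in> S" for s t
  proof -
    have "((\<lambda>s. f (x + s *\<^sub>R u + t *\<^sub>R v)) has_derivative
        (\<lambda>r. frechet_derivative f (at (x + s *\<^sub>R u + t *\<^sub>R v)) (r *\<^sub>R u))) (at s)"
      by (rule has_derivative_compose[of "\<lambda>s. x + s *\<^sub>R u + t *\<^sub>R v", OF _ C_k_on_Suc_has_derivative[OF S(1) C that]])
        (auto intro!: derivative_eq_intros)
    then show ?thesis
      unfolding has_field_derivative_def
      using linear_simps(5)[OF has_derivative_bounded_linear[OF C_k_on_Suc_has_derivative[OF S(1) C that]]]
      by (simp add: mult_commute_abs)
  qed
  have d2: "((\<lambda>t. ?fu (x + s *\<^sub>R u + t *\<^sub>R v)) has_real_derivative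
      frechet_derivative ?fu (at (x + s *\<^sub>R u + t *\<^sub>R v)) v) (at t)"
    if "x + s *\<^sub>R u + t *\<^sub>R v \<in> S" for s t
  proof -
    have "((\<lambda>t. ?fu (x + s *\<^sub>R u + t *\<^sub>R v)) has_derivative
        (\<lambda>r. frechet_derivative ?fu (at (x + s *\<^sub>R u + t *\<^sub>R v)) (r *\<^sub>R v))) (at t)"
      by (rule has_derivative_compose[of "\<lambda>t. x + s *\<^sub>R u + t *\<^sub>R v", OF _ C_k_on_Suc_has_derivative[OF S(1) Cu that]])
        (auto intro!: derivative_eq_intros)
    then show ?thesis
      unfolding has_field_derivative_def
      using linear_simps(5)[OF has_derivative_bounded_linear[OF C_k_on_Suc_has_derivative[OF S(1) Cu that]]]
      by (simp add: mult_commute_abs)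
  qed
  have "\<exists>s>0. s < h \<and> (f (x + h *\<^sub>R u + h *\<^sub>R v) - f (x + h *\<^sub>R u + 0 *\<^sub>R v)) -
      (f (x + 0 *\<^sub>R u + h *\<^sub>R v) - f (x + 0 *\<^sub>R u + 0 *\<^sub>R v)) =
      (h - 0) * (?fu (x + s *\<^sub>R u + h *\<^sub>R v) - ?fu (x + s *\<^sub>R u + 0 *\<^sub>R v))"
    by (rule MVT2[OF h]) (intro DERIV_diff d1 in_S; use h in simp)+
  then obtain s where s: "0 < s" "s < h" and es: "(f (x + h *\<^sub>R u + h *\<^sub>R v) - f (x + h *\<^sub>R u + 0 *\<^sub>R v)) -
      (f (x + 0 *\<^sub>R u + h *\<^sub>R v) - f (x + 0 *\<^sub>R u + 0 *\<^sub>R v)) =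
      h * (?fu (x + s *\<^sub>R u + h *\<^sub>R v) - ?fu (x + s *\<^sub>R u + 0 *\<^sub>R v))" by auto
  have "\<exists>t>0. t < h \<and> ?fu (x + s *\<^sub>R u + h *\<^sub>R v) - ?fu (x + s *\<^sub>R u + 0 *\<^sub>R v) =
      (h - 0) * frechet_derivative ?fu (at (x + s *\<^sub>R u + t *\<^sub>R v)) v"
    by (rule MVT2[OF h]) (intro d2 in_S; use s in simp)
  then obtain t where t: "0 < t" "t < h" and et: "?fu (x + s *\<^sub>R u + h *\<^sub>R v) - ?fu (x + s *\<^sub>R u + 0 *\<^sub>R v) =
      h * frechet_derivative ?fu (at (x + s *\<^sub>R u + t *\<^sub>R v)) v" by auto
  show ?thesis
    by (rule exI[of _ s], rule exI[of _ t]) (use s t es et in \<open>simp add: algebra_simps\<close>)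
qed

lemma second_difference_limit:
  fixes f :: "'a::euclidean_space \<Rightarrow> real"
  assumes S: "open S" "C_k_on 2 f S" and uv: "u \<in> Basis" "v \<in> Basis" and x: "x \<in> S"
  shows "((\<lambda>h. (f (x + h *\<^sub>R u + h *\<^sub>R v) - f (x + h *\<^sub>R u) - f (x + h *\<^sub>R v) + f x) / (h * h))
    \<longlongrightarrow> frechet_derivative (\<lambda>y. frechet_derivative f (at y) u) (at x) v) (at_right 0)"
proof (rule tendstoI)
  fix e :: real assume e: "e > 0"
  let ?D = "\<lambda>y. frechet_derivative (\<lambda>y. frechet_derivative f (at y) u) (at y) v"
  have "continuous_on S ?D"
    using S(2) uv by (simp add: numeral_2_eq_2)
  then obtain d where d: "d > 0" "\<And>y. y \<in> S \<Longrightarrow> dist y x < d \<Longrightarrow> dist (?D y) (?D x) < e"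
    using x e unfolding continuous_on_iff by metis
  obtain d' where d': "d' > 0" "ball x d' \<subseteq> S" using S(1) x openE by blast
  \<comment> \<open>Both parameters may reach \<open>h\<close>, so the displacement has length up to
    2 \<open>h\<close>; hence the half.\<close>
  define m where "m = min d d' / 2"
  have m: "m > 0" using d(1) d'(1) by (simp add: m_def)
  have near: "dist (x + s *\<^sub>R u + t *\<^sub>R v) x < min d d'"
    if "0 \<le> s" "s \<le> h" "0 \<le> t" "t \<le> h" "h < m" for s t h
  proof -
    have "dist (x + s *\<^sub>R u + t *\<^sub>R v) x \<le> norm (s *\<^sub>R u) + norm (t *\<^sub>R v)"
      unfolding dist_norm by (metis add.assoc add_diff_cancel_left' norm_triangle_ineq)
    also have "\<dots> = s + t" using uv that by simp
    also have "\<dots> < min d d'" using that unfolding m_def by linarith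
    finally show ?thesis .
  qed
  show "\<forall>\<^sub>F h in at_right 0. dist ((f (x + h *\<^sub>R u + h *\<^sub>R v) - f (x + h *\<^sub>R u) - f (x + h *\<^sub>R v) + f x) / (h * h)) (?D x) < e"
    unfolding eventually_at_right_field
  proof (intro exI[of _ m] conjI allI impI m)
    fix h :: real assume h: "0 < h" "h < m"
    have inS: "x + s *\<^sub>R u + t *\<^sub>R v \<in> S" if "0 \<le> s" "s \<le> h" "0 \<le> t" "t \<le> h" for s t
      using near[OF that h(2)] d'(2) by (auto simp: dist_commute)
    obtain s t where st: "0 \<le> s" "s \<le> h" "0 \<le> t" "t \<le> h" and
      eq: "f (x + h *\<^sub>R u + h *\<^sub>R v) - f (x + h *\<^sub>R u) - f (x + h *\<^sub>R v) + f x =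
        h * h * ?D (x + s *\<^sub>R u + t *\<^sub>R v)"
      using second_difference_mvt[OF S uv h(1) inS] by blast
    show "dist ((f (x + h *\<^sub>R u + h *\<^sub>R v) - f (x + h *\<^sub>R u) - f (x + h *\<^sub>R v) + f x) / (h * h)) (?D x) < e"
      unfolding eq using h(1) d(2)[OF inS[OF st]] near[OF st h(2)] by simp
  qed
qed

text \<open>The second difference is symmetric in \<open>u\<close> and \<open>v\<close>, so both
  iterated derivatives are limits of one and the same quotient.\<close>

lemma frechet_derivative_commute_real:
  fixes f :: "'a::euclidean_space \<Rightarrow> real"
  assumes S: "open S" "C_k_on 2 f S" and uv: "u \<in> Basis" "v \<in> Basis" and x: "x \<in> S"
  shows "frechet_derivative (\<lambda>y. frechet_derivative f (at y) u) (at x) v =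
    frechet_derivative (\<lambda>y. frechet_derivative f (at y) v) (at x) u"
proof -
  have "((\<lambda>h. (f (x + h *\<^sub>R u + h *\<^sub>R v) - f (x + h *\<^sub>R u) - f (x + h *\<^sub>R v) + f x) / (h * h))
      \<longlongrightarrow> frechet_derivative (\<lambda>y. frechet_derivative f (at y) v) (at x) u) (at_right 0)"
    using second_difference_limit[OF S uv(2,1) x] by (simp add: algebra_simps)
  then show ?thesis
    using tendsto_unique[OF _ second_difference_limit[OF S uv x]] by simp
qed

text \<open>Reduction to the real case by pairing with the basis vectors of the codomain. The inner
  derivative commutes with the pairing on all of \<open>S\<close>, which allows the outer one to be
  taken.\<close>

lemma frechet_derivative_commute:
  fixes f :: "'a::euclidean_space \<Rightarrow> 'b::euclidean_space"
  assumes S: "open S" "smooth_on f S" and uv: "u \<in> Basis" "v \<in> Basis" and x: "x \<in> S"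
  shows "frechet_derivative (\<lambda>y. frechet_derivative f (at y) u) (at x) v =
    frechet_derivative (\<lambda>y. frechet_derivative f (at y) v) (at x) u"
proof (rule euclidean_eqI)
  fix b :: 'b assume "b \<in> Basis"
  have sm: "smooth_on (\<lambda>y. f y \<bullet> b) S"
    by (rule smooth_on_bounded_linear[OF S(1) bounded_linear_inner_left S(2)])
  have inner: "frechet_derivative (\<lambda>y. g y \<bullet> b) (at y) w = frechet_derivative g (at y) w \<bullet> b"
    if "smooth_on g S" "y \<in> S" for g :: "'a \<Rightarrow> 'b" and y w
    using frechet_derivative_at[OF bounded_linear.has_derivative[OF bounded_linear_inner_left
        smooth_on_has_derivative[OF that(1) S(1) that(2)]]] by metis
  have second: "frechet_derivative (\<lambda>y. frechet_derivative f (at y) w) (at x) w' \<bullet> b =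
      frechet_derivative (\<lambda>y. frechet_derivative (\<lambda>y. f y \<bullet> b) (at y) w) (at x) w'"
    if w: "w \<in> Basis" for w w'
  proof -
    have "frechet_derivative (\<lambda>y. frechet_derivative f (at y) w) (at x) w' \<bullet> b =
       frechet_derivative (\<lambda>y. frechet_derivative f (at y) w \<bullet> b) (at x) w'"
      by (rule inner[symmetric, OF smooth_on_frechet_derivative[OF S(2) w] x])
    also have "frechet_derivative (\<lambda>y. frechet_derivative f (at y) w \<bullet> b) (at x) =
        frechet_derivative (\<lambda>y. frechet_derivative (\<lambda>y. f y \<bullet> b) (at y) w) (at x)"
      by (rule frechet_derivative_transform_within_open[OF _ S(1) x])
        (use inner[OF S(2)] smooth_on_has_derivative[OF smooth_on_bounded_linear[OF S(1) bounded_linear_inner_left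
          smooth_on_frechet_derivative[OF S(2) w]] S(1) x] in \<open>auto simp: differentiable_def\<close>)
    finally show ?thesis .
  qed
  have "C_k_on 2 (\<lambda>y. f y \<bullet> b) S" using sm by (auto simp: smooth_on_def)
  from frechet_derivative_commute_real[OF S(1) this uv x]
  show "frechet_derivative (\<lambda>y. frechet_derivative f (at y) u) (at x) v \<bullet> b =
      frechet_derivative (\<lambda>y. frechet_derivative f (at y) v) (at x) u \<bullet> b"
    by (simp add: second uv)
qed

section \<open>Gauge transformations and the Bianchi identity\<close>

lemma bounded_bilinear_matrix_matrix_mult:
  "bounded_bilinear ((**) :: complex^'n^'m \<Rightarrow> complex^'k^'n \<Rightarrow> complex^'k^'m)"
proof -
  have "bilinear ((**) :: complex^'n^'m \<Rightarrow> complex^'k^'n \<Rightarrow> complex^'k^'m)"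
    unfolding bilinear_def linear_iff
    by (auto simp: matrix_matrix_mult_def vec_eq_iff sum.distrib algebra_simps scaleR_sum_right)
  then show ?thesis by (simp add: bilinear_conv_bounded_bilinear)
qed

lemma bounded_linear_trace: "bounded_linear (trace :: complex^'n^'n \<Rightarrow> complex)"
  unfolding linear_conv_bounded_linear[symmetric] linear_iff
  by (auto simp: trace_def sum.distrib scaleR_sum_right)

lemmas matrix_bilinear_simps =
  bounded_bilinear.add_left[OF bounded_bilinear_matrix_matrix_mult]
  bounded_bilinear.add_right[OF bounded_bilinear_matrix_matrix_mult]
  bounded_bilinear.diff_left[OF bounded_bilinear_matrix_matrix_mult]
  bounded_bilinear.diff_right[OF bounded_bilinear_matrix_matrix_mult]
  bounded_bilinear.minus_left[OF bounded_bilinear_matrix_matrix_mult]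
  bounded_bilinear.minus_right[OF bounded_bilinear_matrix_matrix_mult]
  bounded_bilinear.scaleR_left[OF bounded_bilinear_matrix_matrix_mult]
  bounded_bilinear.scaleR_right[OF bounded_bilinear_matrix_matrix_mult]
  bounded_bilinear.sum_left[OF bounded_bilinear_matrix_matrix_mult]
  bounded_bilinear.sum_right[OF bounded_bilinear_matrix_matrix_mult]

lemma smooth_on_matrix_mult:
  fixes f :: "'a::euclidean_space \<Rightarrow> complex^'n^'m" and g :: "'a \<Rightarrow> complex^'k^'n"
  shows "open S \<Longrightarrow> smooth_on f S \<Longrightarrow> smooth_on g S \<Longrightarrow> smooth_on (\<lambda>x. f x ** g x) S"
  by (rule smooth_on_bounded_bilinear[OF _ bounded_bilinear_matrix_matrix_mult])

section \<open>Calculus of coordinate derivatives\<close>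

lemma pderiv_at_eq: "(f has_derivative f') (at x) \<Longrightarrow> pderiv_at k f x = f' (axis k 1)"
  unfolding pderiv_at_def using frechet_derivative_at by metis

lemma smooth_on_pderiv_at: "smooth_on f S \<Longrightarrow> smooth_on (pderiv_at k f) S"
  unfolding pderiv_at_def by (rule smooth_on_frechet_derivative) auto

lemma pderiv_at_cong:
  assumes "smooth_on f S" "open S" "x \<in> S" "\<And>y. y \<in> S \<Longrightarrow> f y = g y"
  shows "pderiv_at k f x = pderiv_at k g x"
proof -
  have "f differentiable at x"
    using smooth_on_has_derivative[OF assms(1-3)] differentiable_def by blast
  then show ?thesis
    unfolding pderiv_at_def
    using frechet_derivative_transform_within_open[OF _ assms(2-4)] by simp
qed

lemma pderiv_at_commute:
  fixes f :: "real^6 \<Rightarrow> 'b::euclidean_space"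
  assumes "smooth_on f S" "open S" "x \<in> S"
  shows "pderiv_at k (pderiv_at l f) x = pderiv_at l (pderiv_at k f) x"
  unfolding pderiv_at_def
  by (rule frechet_derivative_commute[OF assms(2,1) _ _ assms(3)]) auto

context
  fixes S :: "(real^6) set" and x
  assumes S: "open S" and x: "x \<in> S"
begin

lemma pderiv_at_add:
  assumes "smooth_on f S" "smooth_on g S"
  shows "pderiv_at k (\<lambda>x. f x + g x) x = pderiv_at k f x + pderiv_at k g x"
  using pderiv_at_eq[OF has_derivative_add[OF smooth_on_has_derivative[OF assms(1) S x]
    smooth_on_has_derivative[OF assms(2) S x]]] by (simp add: pderiv_at_def)

lemma pderiv_at_diff:
  assumes "smooth_on f S" "smooth_on g S"
  shows "pderiv_at k (\<lambda>x. f x - g x) x = pderiv_at k f x - pderiv_at k g x"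
  using pderiv_at_eq[OF has_derivative_diff[OF smooth_on_has_derivative[OF assms(1) S x]
    smooth_on_has_derivative[OF assms(2) S x]]] by (simp add: pderiv_at_def)

lemma pderiv_at_bounded_linear:
  assumes "bounded_linear h" "smooth_on f S"
  shows "pderiv_at k (\<lambda>x. h (f x)) x = h (pderiv_at k f x)"
  using pderiv_at_eq[OF bounded_linear.has_derivative[OF assms(1)
    smooth_on_has_derivative[OF assms(2) S x]]] by (simp add: pderiv_at_def)

lemma pderiv_at_bounded_bilinear:
  assumes "bounded_bilinear h" "smooth_on f S" "smooth_on g S"
  shows "pderiv_at k (\<lambda>x. h (f x) (g x)) x = h (f x) (pderiv_at k g x) + h (pderiv_at k f x) (g x)"
  using pderiv_at_eq[OF bounded_bilinear.FDERIV[OF assms(1)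
    smooth_on_has_derivative[OF assms(2) S x] smooth_on_has_derivative[OF assms(3) S x]]]
  by (simp add: pderiv_at_def)

lemma pderiv_at_sum:
  assumes "\<And>i. i \<in> I \<Longrightarrow> smooth_on (f i) S"
  shows "pderiv_at k (\<lambda>x. \<Sum>i\<in>I. f i x) x = (\<Sum>i\<in>I. pderiv_at k (f i) x)"
  using pderiv_at_eq[OF has_derivative_sum[of I f, OF smooth_on_has_derivative[OF assms S x]]]
  by (simp add: pderiv_at_def)

lemma pderiv_at_matrix_mult:
  fixes f :: "real^6 \<Rightarrow> complex^'n^'m" and g :: "real^6 \<Rightarrow> complex^'k^'n"
  assumes "smooth_on f S" "smooth_on g S"
  shows "pderiv_at k (\<lambda>x. f x ** g x) x = f x ** pderiv_at k g x + pderiv_at k f x ** g x"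
  by (rule pderiv_at_bounded_bilinear[OF bounded_bilinear_matrix_matrix_mult assms])

lemma jacobian_eq_pderiv_at:
  fixes \<psi> :: "real^6 \<Rightarrow> real^6"
  assumes "smooth_on \<psi> S"
  shows "jacobian \<psi> (at x) $ l $ k = pderiv_at k \<psi> x $ l"
  by (simp add: jacobian_def matrix_def pderiv_at_def)

lemma pderiv_at_compose:
  fixes \<psi> :: "real^6 \<Rightarrow> real^6"
  assumes "smooth_on \<psi> S" "smooth_on f UNIV"
  shows "pderiv_at k (\<lambda>x. f (\<psi> x)) x = (\<Sum>l\<in>UNIV. pderiv_at k \<psi> x $ l *\<^sub>R pderiv_at l f (\<psi> x))"
proof -
  note df = smooth_on_has_derivative[OF assms(2) open_UNIV UNIV_I, of "\<psi> x"]
  have "pderiv_at k (\<lambda>x. f (\<psi> x)) x = frechet_derivative f (at (\<psi> x)) (pderiv_at k \<psi> x)"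
    using pderiv_at_eq[OF has_derivative_compose[OF smooth_on_has_derivative[OF assms(1) S x] df]]
    by (simp add: pderiv_at_def)
  also have "\<dots> = frechet_derivative f (at (\<psi> x)) (\<Sum>l\<in>UNIV. pderiv_at k \<psi> x $ l *\<^sub>R axis l 1)"
    by (simp add: basis_expansion scalar_mult_eq_scaleR[symmetric])
  also have "\<dots> = (\<Sum>l\<in>UNIV. pderiv_at k \<psi> x $ l *\<^sub>R pderiv_at l f (\<psi> x))"
    using has_derivative_bounded_linear[OF df]
    by (simp add: pderiv_at_def linear_sum linear_simps(5) bounded_linear.linear)
  finally show ?thesis .
qed

end

text \<open>Chart domains are all of Euclidean space, so the outer map may be taken smooth
  everywhere. The chain rule is expanded in the basis so that the outer map enters through its
  partial derivatives, to which the induction hypothesis applies.\<close>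

lemma C_k_on_compose_UNIV:
  fixes \<psi> :: "'a::euclidean_space \<Rightarrow> 'b::euclidean_space"
  assumes "open S" "smooth_on \<psi> S" "smooth_on f UNIV"
  shows "C_k_on k (\<lambda>x. f (\<psi> x)) S"
  using assms(3)
proof (induction k arbitrary: f)
  case 0
  then show ?case
    using continuous_on_compose2[OF smooth_on_continuous_on[OF 0]
        smooth_on_continuous_on[OF assms(2)]] by simp
next
  case (Suc k)
  let ?Df = "\<lambda>y. frechet_derivative f (at y)" and ?D\<psi> = "\<lambda>x. frechet_derivative \<psi> (at x)"
  have lin: "linear (?Df y)" for y
    using has_derivative_linear[OF smooth_on_has_derivative[OF Suc.prems open_UNIV UNIV_I]] .
  show ?case
  proof (rule C_k_on_SucI[OF assms(1)])
    show "((\<lambda>x. f (\<psi> x)) has_derivative (\<lambda>v. \<Sum>b\<in>Basis. (?D\<psi> x v \<bullet> b) *\<^sub>R ?Df (\<psi> x) b)) (at x)"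
      if "x \<in> S" for x
    proof -
      have "?Df (\<psi> x) (?D\<psi> x v) = (\<Sum>b\<in>Basis. (?D\<psi> x v \<bullet> b) *\<^sub>R ?Df (\<psi> x) b)" for v
        using lin by (subst euclidean_representation[of "?D\<psi> x v", symmetric])
          (simp add: linear_sum linear_scale del: euclidean_representation)
      then show ?thesis
        using has_derivative_compose[OF smooth_on_has_derivative[OF assms(2,1) that]
            smooth_on_has_derivative[OF Suc.prems open_UNIV UNIV_I]] by simp
    qed
    show "C_k_on k (\<lambda>x. \<Sum>b\<in>Basis. (?D\<psi> x v \<bullet> b) *\<^sub>R ?Df (\<psi> x) b) S" if v: "v \<in> Basis" for v
    proof -
      have "C_k_on k (\<lambda>x. (?D\<psi> x v \<bullet> b) *\<^sub>R ?Df (\<psi> x) b) S" if "b \<in> Basis" for b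
      proof (rule C_k_on_bounded_bilinear[OF assms(1) bounded_bilinear_scaleR])
        show "C_k_on k (\<lambda>x. ?D\<psi> x v \<bullet> b) S"
          using smooth_on_bounded_linear[OF assms(1) bounded_linear_inner_left
            smooth_on_frechet_derivative[OF assms(2) v]] by (auto simp: smooth_on_def)
        show "C_k_on k (\<lambda>x. ?Df (\<psi> x) b) S"
          by (rule Suc.IH[OF smooth_on_frechet_derivative[OF Suc.prems that]])
      qed
      then show ?thesis by (rule C_k_on_sum[OF assms(1)])
    qed
  qed
qed

lemma smooth_on_compose_UNIV:
  fixes \<psi> :: "'a::euclidean_space \<Rightarrow> 'b::euclidean_space"
  assumes "open S" "smooth_on \<psi> S" "smooth_on f UNIV"
  shows "smooth_on (\<lambda>x. f (\<psi> x)) S"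
  unfolding smooth_on_def using C_k_on_compose_UNIV[OF assms] by blast

section \<open>Transformation law of the curvature\<close>

lemma smooth_on_curvature:
  fixes A :: "6 \<Rightarrow> real^6 \<Rightarrow> complex^'n^'n"
  assumes "\<And>k. smooth_on (A k) UNIV"
  shows "smooth_on (curvature A k l) UNIV"
proof -
  have "smooth_on (\<lambda>x. pderiv_at k (A l) x - pderiv_at l (A k) x + A k x ** A l x - A l x ** A k x) UNIV"
    by (intro smooth_on_diff smooth_on_add smooth_on_matrix_mult smooth_on_pderiv_at open_UNIV assms)
  then show ?thesis
    by (simp add: curvature_def[abs_def])
qed

text \<open>The pointwise algebra behind gauge covariance, with no inverse of \<open>g\<close>.
  \<open>Akm\<close> and \<open>Bkm\<close> stand for the derivatives in direction \<open>m\<close>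
  of the \<open>k\<close>-th components, and \<open>h\<close> for the mixed second derivative of
  \<open>g\<close>. The last two hypotheses are the first two after differentiation;
  \<open>h\<close> occurs in both and cancels.\<close>

lemma gauge_algebra:
  fixes g :: "complex^'n^'n"
  assumes "B\<^sub>k ** g + g\<^sub>k = g ** A\<^sub>k" "B\<^sub>m ** g + g\<^sub>m = g ** A\<^sub>m"
    "B\<^sub>k ** g\<^sub>m + Bkm ** g + h = g ** Akm + g\<^sub>m ** A\<^sub>k"
    "B\<^sub>m ** g\<^sub>k + Bmk ** g + h = g ** Amk + g\<^sub>k ** A\<^sub>m"
  shows "g ** (Amk - Akm + A\<^sub>k ** A\<^sub>m - A\<^sub>m ** A\<^sub>k) = (Bmk - Bkm + B\<^sub>k ** B\<^sub>m - B\<^sub>m ** B\<^sub>k) ** g"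
proof -
  have 1: "g ** A\<^sub>k ** A\<^sub>m = B\<^sub>k ** B\<^sub>m ** g + B\<^sub>k ** g\<^sub>m + g\<^sub>k ** A\<^sub>m"
    unfolding assms(1)[symmetric]
    by (simp add: matrix_bilinear_simps matrix_mul_assoc[symmetric] assms(2)[symmetric])
  have 2: "g ** A\<^sub>m ** A\<^sub>k = B\<^sub>m ** B\<^sub>k ** g + B\<^sub>m ** g\<^sub>k + g\<^sub>m ** A\<^sub>k"
    unfolding assms(2)[symmetric]
    by (simp add: matrix_bilinear_simps matrix_mul_assoc[symmetric] assms(1)[symmetric])
  have 3: "g ** Akm = B\<^sub>k ** g\<^sub>m + Bkm ** g + h - g\<^sub>m ** A\<^sub>k"
    and 4: "g ** Amk = B\<^sub>m ** g\<^sub>k + Bmk ** g + h - g\<^sub>k ** A\<^sub>m"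
    unfolding assms(3,4) by simp_all
  have "g ** (Amk - Akm + A\<^sub>k ** A\<^sub>m - A\<^sub>m ** A\<^sub>k) = g ** Amk - g ** Akm + g ** A\<^sub>k ** A\<^sub>m - g ** A\<^sub>m ** A\<^sub>k"
    by (simp add: matrix_bilinear_simps matrix_mul_assoc)
  also have "\<dots> = (Bmk - Bkm + B\<^sub>k ** B\<^sub>m - B\<^sub>m ** B\<^sub>k) ** g"
    unfolding 1 2 3 4 by (simp add: matrix_bilinear_simps)
  finally show ?thesis .
qed

text \<open>Coordinate change and frame change are separated: \<open>B\<close> is the pull-back of
  \<open>A'\<close> along \<open>\<psi>\<close>, its curvature is the pull-back of the curvature of
  \<open>A'\<close>, and \<open>g\<close> then relates \<open>B\<close> to \<open>A\<close> by a
  pure gauge transformation.\<close>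

lemma curvature_gauge_transform:
  fixes A A' :: "6 \<Rightarrow> real^6 \<Rightarrow> complex^'n^'n" and \<psi> :: "real^6 \<Rightarrow> real^6"
  assumes S: "open S" and \<psi>: "smooth_on \<psi> S" and g: "smooth_on g S"
    and A: "\<And>k. smooth_on (A k) UNIV" and A': "\<And>k. smooth_on (A' k) UNIV"
    and eq: "\<And>k x. x \<in> S \<Longrightarrow>
      (\<Sum>l\<in>UNIV. jacobian \<psi> (at x) $ l $ k *\<^sub>R A' l (\<psi> x)) ** g x + pderiv_at k g x = g x ** A k x"
    and x: "x \<in> S"
  shows "g x ** curvature A k m x =
    (\<Sum>l\<in>UNIV. \<Sum>p\<in>UNIV. (jacobian \<psi> (at x) $ l $ k * jacobian \<psi> (at x) $ p $ m) *\<^sub>R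
      curvature A' l p (\<psi> x)) ** g x"
proof -
  define J where "J l k x = pderiv_at k \<psi> x $ l" for l k x
  have J: "smooth_on (J l k) S" for l k
    unfolding J_def by (intro smooth_on_vec_nth smooth_on_pderiv_at S \<psi>)
  \<comment> \<open>This symmetry removes the second derivatives of \<open>\<psi>\<close> from the
    curvature of the pulled-back connection.\<close>
  have Jcomm: "pderiv_at m (J l k) x = pderiv_at k (J l m) x" for l k m
    unfolding J_def
    by (simp add: pderiv_at_bounded_linear[OF S x bounded_linear_vec_nth] smooth_on_pderiv_at[OF \<psi>]
        pderiv_at_commute[OF \<psi> S x, of k])
  have J_jac: "jacobian \<psi> (at y) $ l $ k = J l k y" if "y \<in> S" for l k y
    unfolding J_def by (rule jacobian_eq_pderiv_at[OF S that \<psi>])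
  define B where "B k x = (\<Sum>l\<in>UNIV. J l k x *\<^sub>R A' l (\<psi> x))" for k x
  have A'\<psi>: "smooth_on (\<lambda>x. A' l (\<psi> x)) S" for l
    by (rule smooth_on_compose_UNIV[OF S \<psi> A'])
  have trm: "smooth_on (\<lambda>x. J l k x *\<^sub>R A' l (\<psi> x)) S" for l k
    by (rule smooth_on_bounded_bilinear[OF S bounded_bilinear_scaleR J A'\<psi>])
  have B: "smooth_on (B k) S" for k
    unfolding B_def by (rule smooth_on_sum[OF S trm])
  have eqB: "B k y ** g y + pderiv_at k g y = g y ** A k y" if "y \<in> S" for k y
    using eq[OF that] by (simp add: B_def J_jac[OF that])
  have AS: "smooth_on (A k) S" for k
    using A smooth_on_subset by blast
  have d: "B k x ** pderiv_at m g x + pderiv_at m (B k) x ** g x + pderiv_at m (pderiv_at k g) x =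
      g x ** pderiv_at m (A k) x + pderiv_at m g x ** A k x" for k m
  proof -
    have Bg: "smooth_on (\<lambda>y. B k y ** g y) S"
      by (rule smooth_on_matrix_mult[OF S B g])
    have "pderiv_at m (\<lambda>y. B k y ** g y + pderiv_at k g y) x = pderiv_at m (\<lambda>y. g y ** A k y) x"
      by (rule pderiv_at_cong[OF smooth_on_add[OF S Bg smooth_on_pderiv_at[OF g]] S x eqB])
    then show ?thesis
      by (simp add: pderiv_at_add[OF S x Bg smooth_on_pderiv_at[OF g]]
          pderiv_at_matrix_mult[OF S x B g] pderiv_at_matrix_mult[OF S x g AS])
  qed
  have dB: "pderiv_at m (B k) x = (\<Sum>l\<in>UNIV. J l k x *\<^sub>R (\<Sum>p\<in>UNIV. J p m x *\<^sub>R pderiv_at p (A' l) (\<psi> x)) +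
      pderiv_at m (J l k) x *\<^sub>R A' l (\<psi> x))" for k m
    unfolding B_def pderiv_at_sum[OF S x trm]
    by (simp add: pderiv_at_bounded_bilinear[OF S x bounded_bilinear_scaleR J A'\<psi>]
        pderiv_at_compose[OF S x \<psi> A'] J_def[symmetric])
  have BB: "B k x ** B m x = (\<Sum>l\<in>UNIV. \<Sum>p\<in>UNIV. (J l k x * J p m x) *\<^sub>R (A' l (\<psi> x) ** A' p (\<psi> x)))" for k m
    by (rule trans[OF _ sum.swap]) (simp add: B_def matrix_bilinear_simps scaleR_sum_right mult.commute)
  have pull: "pderiv_at k (B m) x - pderiv_at m (B k) x + B k x ** B m x - B m x ** B k x =
      (\<Sum>l\<in>UNIV. \<Sum>p\<in>UNIV. (J l k x * J p m x) *\<^sub>R curvature A' l p (\<psi> x))"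
  proof -
    have 1: "pderiv_at k (B m) x - pderiv_at m (B k) x =
        (\<Sum>l\<in>UNIV. \<Sum>p\<in>UNIV. (J l m x * J p k x) *\<^sub>R pderiv_at p (A' l) (\<psi> x)) -
        (\<Sum>l\<in>UNIV. \<Sum>p\<in>UNIV. (J l k x * J p m x) *\<^sub>R pderiv_at p (A' l) (\<psi> x))"
      unfolding dB Jcomm[of m _ k] by (simp add: sum.distrib scaleR_sum_right)
    have 2: "(\<Sum>l\<in>UNIV. \<Sum>p\<in>UNIV. (J l m x * J p k x) *\<^sub>R pderiv_at p (A' l) (\<psi> x)) =
        (\<Sum>l\<in>UNIV. \<Sum>p\<in>UNIV. (J l k x * J p m x) *\<^sub>R pderiv_at l (A' p) (\<psi> x))"
      by (subst sum.swap) (simp add: mult.commute)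
    have 3: "B m x ** B k x = (\<Sum>l\<in>UNIV. \<Sum>p\<in>UNIV. (J l k x * J p m x) *\<^sub>R (A' p (\<psi> x) ** A' l (\<psi> x)))"
      unfolding BB by (rule trans[OF sum.swap]) (simp add: mult.commute)
    show ?thesis
      unfolding 1 2 3 BB[of k m] curvature_def
      by (simp add: sum.distrib sum_subtractf scaleR_add_right scaleR_diff_right)
  qed
  have "g x ** curvature A k m x =
      (pderiv_at k (B m) x - pderiv_at m (B k) x + B k x ** B m x - B m x ** B k x) ** g x"
    unfolding curvature_def
    by (rule gauge_algebra[OF eqB[OF x] eqB[OF x] d])
      \<comment> \<open>The fourth hypothesis of \<open>gauge_algebra\<close> has to contain the
        same mixed derivative of \<open>g\<close> as the third.\<close>
      (subst pderiv_at_commute[OF g S x], rule d)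
  then show ?thesis
    unfolding pull by (simp add: J_jac[OF x])
qed

text \<open>\<open>D\<close> is the covariant derivative of the curvature. In the cyclic sum the
  second derivatives of \<open>A\<close> cancel by symmetry, the terms with one derivative and the
  cubic terms by associativity.\<close>

lemma bianchi:
  fixes A :: "6 \<Rightarrow> real^6 \<Rightarrow> complex^'n^'n" and x :: "real^6"
  assumes A: "\<And>k. smooth_on (A k) UNIV"
  defines "D \<equiv> \<lambda>k l m. pderiv_at k (curvature A l m) x + A k x ** curvature A l m x - curvature A l m x ** A k x"
  shows "D k l m + D l m k + D m k l = 0"
proof -
  have AA: "smooth_on (\<lambda>x. A l x ** A m x) UNIV" for l m
    by (rule smooth_on_matrix_mult[OF open_UNIV A A])
  have dA: "smooth_on (\<lambda>x. pderiv_at l (A m) x - pderiv_at m (A l) x) UNIV" for l m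
    by (rule smooth_on_diff[OF open_UNIV smooth_on_pderiv_at[OF A] smooth_on_pderiv_at[OF A]])
  have d: "pderiv_at k (curvature A l m) x = pderiv_at k (pderiv_at l (A m)) x - pderiv_at k (pderiv_at m (A l)) x
      + (A l x ** pderiv_at k (A m) x + pderiv_at k (A l) x ** A m x)
      - (A m x ** pderiv_at k (A l) x + pderiv_at k (A m) x ** A l x)" for k l m
    unfolding curvature_def[abs_def]
      pderiv_at_diff[OF open_UNIV UNIV_I smooth_on_add[OF open_UNIV dA AA] AA]
      pderiv_at_add[OF open_UNIV UNIV_I dA AA]
      pderiv_at_diff[OF open_UNIV UNIV_I smooth_on_pderiv_at[OF A] smooth_on_pderiv_at[OF A]]
      pderiv_at_matrix_mult[OF open_UNIV UNIV_I A A] ..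
  have c: "pderiv_at a (pderiv_at b (A i)) x = pderiv_at b (pderiv_at a (A i)) x" for a b i
    by (rule pderiv_at_commute[OF A open_UNIV UNIV_I])
  show ?thesis
    unfolding D_def d curvature_def c[of l k m] c[of m k l] c[of m l k]
    by (simp add: matrix_bilinear_simps matrix_mul_assoc)
qed

section \<open>Transgression\<close>

text \<open>The coefficient of the volume form dx_1 ... dx_6 in the 6-form whose unsymmetrised
  components are \<open>f\<close>. Index manipulations of forms become permutations of the
  arguments.\<close>

definition altsum :: "(6 \<Rightarrow> 6 \<Rightarrow> 6 \<Rightarrow> 6 \<Rightarrow> 6 \<Rightarrow> 6 \<Rightarrow> 'a::comm_ring_1) \<Rightarrow> 'a" where
  "altsum f = (\<Sum>p | p permutes (UNIV :: 6 set). of_int (sign p) * f (p 1) (p 2) (p 3) (p 4) (p 5) (p 6))"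

lemma altsum_add: "altsum (\<lambda>a b c d e g. f a b c d e g + h a b c d e g) =
    altsum f + altsum h"
  by (simp add: altsum_def algebra_simps sum.distrib)

lemma altsum_diff: "altsum (\<lambda>a b c d e g. f a b c d e g - h a b c d e g) =
    altsum f - altsum h"
  by (simp add: altsum_def algebra_simps sum_subtractf)

lemma altsum_cmult: "altsum (\<lambda>a b c d e g. z * f a b c d e g) = z * altsum f"
  by (simp add: altsum_def sum_distrib_left algebra_simps)

lemma altsum_minus: "altsum (\<lambda>a b c d e g. - f a b c d e g) = - altsum f"
  by (simp add: altsum_def sum_negf)

text \<open>Reindexing the sum over \<open>p\<close> by composition with \<open>q\<close> on the
  right, which multiplies every sign by \<open>sign q\<close>.\<close>

lemma altsum_compose:
  assumes "q permutes (UNIV :: 6 set)"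
  shows "altsum (\<lambda>a b c d e g. f a b c d e g) =
    of_int (sign q) * (\<Sum>p | p permutes (UNIV :: 6 set). of_int (sign p) *
      f (p (q 1)) (p (q 2)) (p (q 3)) (p (q 4)) (p (q 5)) (p (q 6)))"
proof -
  have s: "sign (p \<circ> q) = sign p * sign q" if "p permutes UNIV" for p
    by (rule sign_compose[OF permutes_imp_permutation[OF finite that]
        permutes_imp_permutation[OF finite assms]])
  have "altsum f = (\<Sum>p | p permutes (UNIV :: 6 set). of_int (sign (p \<circ> q)) *
      f ((p \<circ> q) 1) ((p \<circ> q) 2) ((p \<circ> q) 3) ((p \<circ> q) 4) ((p \<circ> q) 5) ((p \<circ> q) 6))"
    unfolding altsum_def by (rule sum_permutations_compose_right[OF assms])
  also have "\<dots> = (\<Sum>p | p permutes (UNIV :: 6 set). of_int (sign q) * (of_int (sign p) *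
      f (p (q 1)) (p (q 2)) (p (q 3)) (p (q 4)) (p (q 5)) (p (q 6))))"
    by (rule sum.cong) (auto simp: s mult_ac)
  finally show ?thesis by (simp add: sum_distrib_left)
qed

lemma altsum_transpose:
  assumes "i \<noteq> (j :: 6)"
  shows "altsum f = - (\<Sum>p | p permutes (UNIV :: 6 set). of_int (sign p) *
      f (p (Transposition.transpose i j 1)) (p (Transposition.transpose i j 2)) (p (Transposition.transpose i j 3))
        (p (Transposition.transpose i j 4)) (p (Transposition.transpose i j 5)) (p (Transposition.transpose i j 6)))"
  by (subst altsum_compose[of "Transposition.transpose i j"])
    (use assms in \<open>auto simp: sign_swap_id permutes_swap_id\<close>)

lemma altsum_swap12: "altsum (\<lambda>a b c d e g. f b a c d e g) = - altsum f"
  by (subst altsum_transpose[of 1 2]) (simp_all add: altsum_def Transposition.transpose_def)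

lemma altsum_swap13: "altsum (\<lambda>a b c d e g. f c b a d e g) = - altsum f"
  by (subst altsum_transpose[of 1 3]) (simp_all add: altsum_def Transposition.transpose_def)

lemma altsum_swap24: "altsum (\<lambda>a b c d e g. f a d c b e g) = - altsum f"
  by (subst altsum_transpose[of 2 4]) (simp_all add: altsum_def Transposition.transpose_def)

lemma altsum_swap34: "altsum (\<lambda>a b c d e g. f a b d c e g) = - altsum f"
  by (subst altsum_transpose[of 3 4]) (simp_all add: altsum_def Transposition.transpose_def)

lemma altsum_swap15: "altsum (\<lambda>a b c d e g. f e b c d a g) = - altsum f"
  by (subst altsum_transpose[of 1 5]) (simp_all add: altsum_def Transposition.transpose_def)

lemma altsum_swap26: "altsum (\<lambda>a b c d e g. f a g c d e b) = - altsum f"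
  by (subst altsum_transpose[of 2 6]) (simp_all add: altsum_def Transposition.transpose_def)

lemma altsum_swap56: "altsum (\<lambda>a b c d e g. f a b c d g e) = - altsum f"
  by (subst altsum_transpose[of 5 6]) (simp_all add: altsum_def Transposition.transpose_def)

lemma altsum_cycle134: "altsum (\<lambda>a b c d e g. f d b a c e g) = altsum f"
  using altsum_swap34[of "\<lambda>a b c d. f c b a d"] altsum_swap13[of f] by simp

lemma altsum_cycle156: "altsum (\<lambda>a b c d e g. f g b c d a e) = altsum f"
  using altsum_swap56[of "\<lambda>a b c d e. f e b c d a"] altsum_swap15[of f] by simp

text \<open>Exchanging two pairs of indices is an even permutation; in terms of forms, 2-forms
  commute.\<close>

lemma altsum_pairs12: "altsum (\<lambda>a b c d e g. f c d a b e g) = altsum f"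
  using altsum_swap24[of "\<lambda>a b c d. f c b a d"] altsum_swap13[of f] by simp

lemma altsum_pairs13: "altsum (\<lambda>a b c d e g. f e g c d a b) = altsum f"
  using altsum_swap26[of "\<lambda>a b c d e. f e b c d a"] altsum_swap15[of f] by simp

text \<open>Places 1, 3 and 4 hold a derivative index and the two indices of a curvature. Their
  cyclic shifts are even, so the three terms have equal alternating sums, and three times that sum
  is 0.\<close>

lemma altsum_bianchi134:
  assumes "\<And>a b c d e g. f a b c d e g + f c b d a e g + f d b a c e g = (0 :: 'a::{comm_ring_1,ring_char_0,idom})"
  shows "altsum f = 0"
proof -
  have "altsum (\<lambda>a b c d e g. f a b c d e g + f c b d a e g + f d b a c e g) = altsum f + altsum f + altsum f"
    unfolding altsum_add altsum_cycle134[of f]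
    using altsum_cycle134[of "\<lambda>a b c d. f d b a c"] altsum_cycle134[of f] by simp
  then have "3 * altsum f = 0"
    unfolding assms by (simp add: altsum_def)
  then show ?thesis by simp
qed

lemma altsum_bianchi156:
  assumes "\<And>a b c d e g. f a b c d e g + f e b c d g a + f g b c d a e = (0 :: 'a::{comm_ring_1,ring_char_0,idom})"
  shows "altsum f = 0"
proof -
  have "altsum (\<lambda>a b c d e g. f a b c d e g + f e b c d g a + f g b c d a e) = altsum f + altsum f + altsum f"
    unfolding altsum_add altsum_cycle156[of f]
    using altsum_cycle156[of "\<lambda>a b c d e g. f g b c d a e"] altsum_cycle156[of f] by simp
  then have "3 * altsum f = 0"
    unfolding assms by (simp add: altsum_def)
  then show ?thesis by simp
qed

section \<open>Exterior derivative of the transgression form\<close>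

lemmas trace_simps =
  linear_simps(1)[OF bounded_linear_trace] linear_simps(2)[OF bounded_linear_trace]
  linear_simps(4)[OF bounded_linear_trace] 

text \<open>Under a trace ordinary derivatives may be replaced by covariant ones. The Leibniz rule
  then leaves the term with the derivative of \<open>\<theta>\<close>, and the terms with a
  differentiated curvature disappear by the Bianchi identity.\<close>

lemma altsum_pderiv_trace:
  fixes B \<theta> :: "6 \<Rightarrow> real^6 \<Rightarrow> complex^'n^'n"
  assumes B: "\<And>k. smooth_on (B k) UNIV" and \<theta>: "\<And>k. smooth_on (\<theta> k) UNIV"
  shows "altsum (\<lambda>a b c d e f. pderiv_at a (\<lambda>x. trace (\<theta> b x ** curvature B c d x ** curvature B e f x)) x) =
    altsum (\<lambda>a b c d e f. trace ((pderiv_at a (\<theta> b) x + B a x ** \<theta> b x - \<theta> b x ** B a x) **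
      curvature B c d x ** curvature B e f x))"
proof -
  define D where "D a c d = pderiv_at a (curvature B c d) x + B a x ** curvature B c d x - curvature B c d x ** B a x" for a c d
  note F = smooth_on_curvature[OF B]
  have Bianchi: "D k l m + D l m k + D m k l = 0" for k l m
    unfolding D_def by (rule bianchi[OF B])
  have eq: "pderiv_at a (\<lambda>x. trace (\<theta> b x ** curvature B c d x ** curvature B e f x)) x =
      trace ((pderiv_at a (\<theta> b) x + B a x ** \<theta> b x - \<theta> b x ** B a x) ** curvature B c d x ** curvature B e f x)
      + (trace (\<theta> b x ** D a c d ** curvature B e f x) + trace (\<theta> b x ** curvature B c d x ** D a e f))" for a b c d e f
  proof -
    note \<theta>F = smooth_on_matrix_mult[OF open_UNIV \<theta> F]
    \<comment> \<open>The commutators with \<open>B a x\<close> in the three factors add up to the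
      commutator with the whole product, which has trace 0 by this identity.\<close>
    have "trace (B a x ** (\<theta> b x ** curvature B c d x ** curvature B e f x)) =
        trace (\<theta> b x ** curvature B c d x ** curvature B e f x ** B a x)"
      by (rule trace_mul_sym)
    then show ?thesis
      unfolding pderiv_at_bounded_linear[OF open_UNIV UNIV_I bounded_linear_trace smooth_on_matrix_mult[OF open_UNIV \<theta>F F]]
        pderiv_at_matrix_mult[OF open_UNIV UNIV_I \<theta>F F] pderiv_at_matrix_mult[OF open_UNIV UNIV_I \<theta> F] D_def
      by (simp add: matrix_bilinear_simps trace_simps matrix_mul_assoc)
  qed
  have 1: "altsum (\<lambda>a b c d e f. trace (\<theta> b x ** D a c d ** curvature B e f x)) = 0"
  proof (rule altsum_bianchi134)
    fix a b c d e f
    have "trace (\<theta> b x ** D a c d ** curvature B e f x) + trace (\<theta> b x ** D c d a ** curvature B e f x) +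
        trace (\<theta> b x ** D d a c ** curvature B e f x) =
        trace (\<theta> b x ** (D a c d + D c d a + D d a c) ** curvature B e f x)"
      by (simp add: matrix_bilinear_simps trace_simps)
    then show "trace (\<theta> b x ** D a c d ** curvature B e f x) + trace (\<theta> b x ** D c d a ** curvature B e f x) +
        trace (\<theta> b x ** D d a c ** curvature B e f x) = 0"
      by (simp add: Bianchi trace_def matrix_matrix_mult_def)
  qed
  have 2: "altsum (\<lambda>a b c d e f. trace (\<theta> b x ** curvature B c d x ** D a e f)) = 0"
  proof (rule altsum_bianchi156)
    fix a b c d e f
    have "trace (\<theta> b x ** curvature B c d x ** D a e f) + trace (\<theta> b x ** curvature B c d x ** D e f a) +
        trace (\<theta> b x ** curvature B c d x ** D f a e) =
        trace (\<theta> b x ** curvature B c d x ** (D a e f + D e f a + D f a e))"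
      by (simp add: matrix_bilinear_simps trace_simps)
    then show "trace (\<theta> b x ** curvature B c d x ** D a e f) + trace (\<theta> b x ** curvature B c d x ** D e f a) +
        trace (\<theta> b x ** curvature B c d x ** D f a e) = 0"
      by (simp add: Bianchi trace_def matrix_matrix_mult_def)
  qed
  show ?thesis
    unfolding eq altsum_add 1 2 by simp
qed

text \<open>Boole's quadrature rule on \<open>[0, 1]\<close>. It is exact up to degree \<open>5\<close>, the degree in \<open>t\<close> of the
  derivative of \<open>tr F\<^sub>t\<^sup>3\<close>, and thus replaces the integral over \<open>t\<close> of the transgression formula.\<close>

definition boole :: "(real \<Rightarrow> complex) \<Rightarrow> complex" where
  "boole f = (7 * f 0 + 32 * f (1/4) + 12 * f (1/2) + 32 * f (3/4) + 7 * f 1) / 90"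

lemma boole_sum: "boole (\<lambda>t. \<Sum>i\<in>I. f i t) = (\<Sum>i\<in>I. boole (f i))"
  by (simp add: boole_def sum_distrib_left sum_distrib_right sum.distrib sum_divide_distrib add_divide_distrib)

lemma boole_cmult: "boole (\<lambda>t. c * f t) = c * boole f"
  by (simp add: boole_def algebra_simps)

text \<open>The fundamental theorem of calculus for a product of three quadratic polynomials, given
  by their coefficients; the derivative of the product has degree 5.\<close>

lemma boole_exact:
  fixes p q :: "complex \<times> complex \<times> complex" and r :: "complex \<times> complex \<times> complex"
  defines "u \<equiv> \<lambda>(a, b, c) t. a + of_real t * b + of_real (t\<^sup>2) * c :: complex"
    and "u' \<equiv> \<lambda>(a, b, c) t. b + of_real (2 * t) * c :: complex"
  shows "u p 1 * u q 1 * u r 1 - u p 0 * u q 0 * u r 0 =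
    boole (\<lambda>t. u' p t * u q t * u r t + u p t * u' q t * u r t + u p t * u q t * u' r t)"
  by (cases p; cases q; cases r) (simp add: u_def u'_def boole_def field_simps power2_eq_square)

lemma trace_triple: "trace (X ** Y ** Z :: 'a::comm_semiring_1^'n^'n) = (\<Sum>i\<in>UNIV. \<Sum>k\<in>UNIV. \<Sum>j\<in>UNIV. X $ i $ j * Y $ j $ k * Z $ k $ i)"
  by (simp add: trace_def matrix_matrix_mult_def sum_distrib_right)

text \<open>The trace of a triple product is a sum of products of three entries, and along a line of
  connections every entry of the curvature is quadratic in \<open>t\<close>. \<open>G\<close> is the
  derivative of \<open>F\<close> in \<open>t\<close>.\<close>

lemma boole_exact_trace:
  fixes P Q R :: "6 \<Rightarrow> 6 \<Rightarrow> complex^'n^'n"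
  defines "F \<equiv> \<lambda>t k l. P k l + t *\<^sub>R Q k l + t\<^sup>2 *\<^sub>R R k l"
    and "G \<equiv> \<lambda>t k l. Q k l + (2 * t) *\<^sub>R R k l"
  shows "trace (F 1 a b ** F 1 c d ** F 1 e f) - trace (F 0 a b ** F 0 c d ** F 0 e f) =
    boole (\<lambda>t. trace (G t a b ** F t c d ** F t e f) + trace (F t a b ** G t c d ** F t e f) +
      trace (F t a b ** F t c d ** G t e f))"
proof -
  define v where "v k l i j = (P k l $ i $ j, Q k l $ i $ j, R k l $ i $ j)" for k l i j
  have F: "F t k l $ i $ j = (\<lambda>(a, b, c) t. a + of_real t * b + of_real (t\<^sup>2) * c) (v k l i j) t"
    and G: "G t k l $ i $ j = (\<lambda>(a, b, c) t. b + of_real (2 * t) * c) (v k l i j) t" for t k l i j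
    by (simp_all add: F_def G_def v_def scaleR_conv_of_real[where 'a=complex])
  show ?thesis
    unfolding trace_triple F G sum.distrib[symmetric] sum_subtractf[symmetric] boole_sum boole_exact ..
qed

text \<open>The factor 6 is 3 times 2: any of the three curvatures may be differentiated in
  \<open>t\<close>, and each derivative is the antisymmetrisation of the covariant derivative of
  \<open>\<theta>\<close>, whose two halves contribute equally.\<close>

theorem transgression:
  fixes A\<^sub>0 A\<^sub>1 :: "6 \<Rightarrow> real^6 \<Rightarrow> complex^'n^'n"
  assumes A0: "\<And>k. smooth_on (A\<^sub>0 k) UNIV" and A1: "\<And>k. smooth_on (A\<^sub>1 k) UNIV"
  defines "\<theta> \<equiv> \<lambda>k x. A\<^sub>1 k x - A\<^sub>0 k x"
  defines "B \<equiv> \<lambda>t k x. A\<^sub>0 k x + t *\<^sub>R \<theta> k x"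
  shows "altsum (\<lambda>a b c d e f. trace (curvature A\<^sub>1 a b x ** curvature A\<^sub>1 c d x ** curvature A\<^sub>1 e f x)) -
      altsum (\<lambda>a b c d e f. trace (curvature A\<^sub>0 a b x ** curvature A\<^sub>0 c d x ** curvature A\<^sub>0 e f x)) =
    6 * boole (\<lambda>t. altsum (\<lambda>a b c d e f.
      pderiv_at a (\<lambda>x. trace (\<theta> b x ** curvature (B t) c d x ** curvature (B t) e f x)) x))"
proof -
  have \<theta>: "smooth_on (\<theta> k) UNIV" for k
    unfolding \<theta>_def by (intro smooth_on_diff open_UNIV A0 A1)
  have s\<theta>: "smooth_on (\<lambda>x. t *\<^sub>R \<theta> k x) UNIV" for k t
    by (rule smooth_on_bounded_linear[OF open_UNIV bounded_linear_scaleR_right \<theta>])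
  have B: "smooth_on (B t k) UNIV" for t k
    unfolding B_def by (intro smooth_on_add open_UNIV A0 s\<theta>)
  \<comment> \<open>The covariant derivative of \<open>\<theta>\<close> for the connection
    \<open>B t\<close>, before antisymmetrisation.\<close>
  define E where "E t a b = pderiv_at a (\<theta> b) x + B t a x ** \<theta> b x - \<theta> b x ** B t a x" for t a b
  define Q where "Q k l = E 0 k l - E 0 l k" for k l
  define R where "R k l = \<theta> k x ** \<theta> l x - \<theta> l x ** \<theta> k x" for k l
  have dB: "pderiv_at k (B t l) x = pderiv_at k (A\<^sub>0 l) x + t *\<^sub>R pderiv_at k (\<theta> l) x" for t k l
    unfolding B_def pderiv_at_add[OF open_UNIV UNIV_I A0 s\<theta>]
      pderiv_at_bounded_linear[OF open_UNIV UNIV_I bounded_linear_scaleR_right \<theta>] ..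
  have F: "curvature (B t) k l x = curvature A\<^sub>0 k l x + t *\<^sub>R Q k l + t\<^sup>2 *\<^sub>R R k l" for t k l
    unfolding curvature_def dB Q_def R_def E_def
    unfolding B_def
    by (simp add: matrix_bilinear_simps algebra_simps power2_eq_square)
  have G: "Q k l + (2 * t) *\<^sub>R R k l = E t k l - E t l k" for t k l
    unfolding Q_def R_def E_def B_def
    by (simp add: matrix_bilinear_simps algebra_simps scaleR_2[symmetric])
  have B01: "B 1 = A\<^sub>1" "B 0 = A\<^sub>0"
    by (auto simp: B_def \<theta>_def)
  let ?F = "\<lambda>t k l. curvature (B t) k l x"
  have 1: "altsum (\<lambda>a b c d e f. trace (?F 1 a b ** ?F 1 c d ** ?F 1 e f)) -
      altsum (\<lambda>a b c d e f. trace (?F 0 a b ** ?F 0 c d ** ?F 0 e f)) =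
      boole (\<lambda>t. altsum (\<lambda>a b c d e f. trace ((E t a b - E t b a) ** ?F t c d ** ?F t e f) +
        trace (?F t a b ** (E t c d - E t d c) ** ?F t e f) +
        trace (?F t a b ** ?F t c d ** (E t e f - E t f e))))"
  proof -
    have "altsum (\<lambda>a b c d e f. boole (h a b c d e f)) = boole (\<lambda>t. altsum (\<lambda>a b c d e f. h a b c d e f t))" for h
      unfolding altsum_def boole_sum boole_cmult ..
    then show ?thesis
      unfolding altsum_diff[symmetric]
        boole_exact_trace[where P="\<lambda>k l. curvature A\<^sub>0 k l x" and Q=Q and R=R, folded F, unfolded G] .
  qed
  have 2: "altsum (\<lambda>a b c d e f. trace ((E t a b - E t b a) ** ?F t c d ** ?F t e f) +
        trace (?F t a b ** (E t c d - E t d c) ** ?F t e f) +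
        trace (?F t a b ** ?F t c d ** (E t e f - E t f e))) =
      6 * altsum (\<lambda>a b c d e f. trace (E t a b ** ?F t c d ** ?F t e f))" for t
  proof -
    let ?h = "\<lambda>a b c d e f. trace ((E t a b - E t b a) ** ?F t c d ** ?F t e f)"
    \<comment> \<open>Cyclicity of the trace brings the differentiated factor to the front; the
      resulting permutation of index pairs is even.\<close>
    have i: "altsum (\<lambda>a b c d e f. trace (?F t a b ** (E t c d - E t d c) ** ?F t e f)) = altsum ?h"
    proof -
      have "altsum (\<lambda>a b c d e f. trace (?F t a b ** (E t c d - E t d c) ** ?F t e f)) =
          altsum (\<lambda>a b c d e f. ?h c d e f a b)"
        by (subst trace_mul_sym, subst trace_mul_sym, subst matrix_mul_assoc[symmetric], subst trace_mul_sym)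
          (simp add: matrix_mul_assoc)
      also have "\<dots> = altsum ?h"
        using altsum_pairs12[of "\<lambda>a b c d e f. ?h a b e f c d"] altsum_pairs12[of ?h]
          altsum_pairs13[of ?h] altsum_pairs13[of "\<lambda>a b c d e f. ?h c d a b e f"] by simp
      finally show ?thesis .
    qed
    have ii: "altsum (\<lambda>a b c d e f. trace (?F t a b ** ?F t c d ** (E t e f - E t f e))) = altsum ?h"
    proof -
      have "altsum (\<lambda>a b c d e f. trace (?F t a b ** ?F t c d ** (E t e f - E t f e))) =
          altsum (\<lambda>a b c d e f. ?h e f a b c d)"
        by (subst trace_mul_sym) (simp add: matrix_mul_assoc)
      also have "\<dots> = altsum ?h"
        using altsum_pairs13[of "\<lambda>a b c d e f. ?h a b e f c d"] altsum_pairs12[of ?h]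
          altsum_pairs13[of ?h] altsum_pairs12[of "\<lambda>a b c d e f. ?h e f c d a b"] by simp
      finally show ?thesis .
    qed
    have "altsum ?h = altsum (\<lambda>a b c d e f. trace (E t a b ** ?F t c d ** ?F t e f) -
        trace (E t b a ** ?F t c d ** ?F t e f))"
      by (simp add: matrix_bilinear_simps trace_simps)
    also have "\<dots> = 2 * altsum (\<lambda>a b c d e f. trace (E t a b ** ?F t c d ** ?F t e f))"
      unfolding altsum_diff
      using altsum_swap12[of "\<lambda>a b c d e f. trace (E t a b ** ?F t c d ** ?F t e f)"] by simp
    finally show ?thesis
      unfolding altsum_add i ii by simp
  qed
  have 3: "altsum (\<lambda>a b c d e f. trace (E t a b ** ?F t c d ** ?F t e f)) = altsum (\<lambda>a b c d e f.
      pderiv_at a (\<lambda>x. trace (\<theta> b x ** curvature (B t) c d x ** curvature (B t) e f x)) x)" for t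
    unfolding E_def altsum_pderiv_trace[OF B \<theta>] ..
  show ?thesis
    using 1 unfolding 2 3 B01 by (simp add: boole_def algebra_simps)
qed

lemma ch3_form_altsum: "ch3_form A x = 1 / fact 3 * (\<i> / (2 * of_real pi)) ^ 3 * (1 / 8 *
    altsum (\<lambda>a b c d e f. trace (curvature A a b x ** curvature A c d x ** curvature A e f x)))"
  unfolding ch3_form_def altsum_def ..

text \<open>\<open>F\<close> is skew for the bilinear form \<open>H\<close>. Transposing the product
  gives the sign -1 and reverses the three factors; the reversal exchanges the first and last index
  pair, which is even, so the alternating sum equals its own negative.\<close>

lemma altsum_trace_skew:
  fixes F :: "6 \<Rightarrow> 6 \<Rightarrow> complex^'n^'n" and H :: "complex^'n^'n"
  assumes "invertible H" and skew: "\<And>k l. H ** F k l = - (transpose (F k l) ** H)"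
  shows "altsum (\<lambda>a b c d e f. trace (F a b ** F c d ** F e f)) = 0"
proof -
  obtain K where K: "H ** K = mat 1" "K ** H = mat 1"
    using assms(1) unfolding invertible_def by blast
  have skew': "H ** (F k l ** Z) = - (transpose (F k l) ** (H ** Z))" for k l and Z :: "complex^'n^'n"
    by (simp add: matrix_mul_assoc skew matrix_bilinear_simps)
  have "trace (F a b ** F c d ** F e f) = - trace (F e f ** F c d ** F a b)" for a b c d e f
  proof -
    have "H ** (F a b ** F c d ** F e f) = - (transpose (F e f ** F c d ** F a b) ** H)"
      by (simp add: matrix_transpose_mul matrix_mul_assoc[symmetric] skew skew' matrix_bilinear_simps)
    then have "F a b ** F c d ** F e f = - (K ** (transpose (F e f ** F c d ** F a b) ** H))"
      using K(2) by (metis matrix_mul_assoc matrix_mul_lid matrix_bilinear_simps(6))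
    then have "trace (F a b ** F c d ** F e f) = - trace (K ** (transpose (F e f ** F c d ** F a b) ** H))"
      by (simp add: trace_simps trace_def sum_negf)
    also have "trace (K ** (transpose (F e f ** F c d ** F a b) ** H)) = trace (transpose (F e f ** F c d ** F a b))"
      by (subst trace_mul_sym) (simp add: matrix_mul_assoc[symmetric] K)
    also have "\<dots> = trace (F e f ** F c d ** F a b)"
      by (simp add: trace_def transpose_def)
    finally show ?thesis .
  qed
  then have "altsum (\<lambda>a b c d e f. trace (F a b ** F c d ** F e f)) =
      - altsum (\<lambda>a b c d e f. trace (F e f ** F c d ** F a b))"
    unfolding altsum_minus[symmetric] by (intro arg_cong[where f = altsum] ext)
  then show ?thesis
    using altsum_pairs13[of "\<lambda>a b c d e f. trace (F a b ** F c d ** F e f)"] by simp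
qed

section \<open>Integration by parts with cut-off functions\<close>

lemma lborel_integral_translate:
  fixes f :: "'a::euclidean_space \<Rightarrow> real"
  assumes "f \<in> borel_measurable borel"
  shows "(LINT x|lborel. f (x + v)) = (LINT x|lborel. f x)"
proof -
  have "(LINT x|lborel. f x) = (LINT x|distr lborel borel ((+) v). f x)"
    by (simp add: lborel_distr_plus)
  also have "\<dots> = (LINT x|lborel. f (v + x))"
    by (rule integral_distr) (use assms in auto)
  finally show ?thesis by (simp add: add.commute)
qed

lemma integrable_continuous_compact_support:
  fixes f :: "'a::euclidean_space \<Rightarrow> 'b::euclidean_space"
  assumes "continuous_on UNIV f" "\<And>x. norm x > r \<Longrightarrow> f x = 0"
  shows "integrable lborel f"
proof -
  have "integrable lborel (\<lambda>x. indicator (cball 0 r) x *\<^sub>R f x)"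
    by (rule borel_integrable_compact) (use assms(1) continuous_on_subset in auto)
  also have "(\<lambda>x. indicator (cball 0 r) x *\<^sub>R f x) = f"
    using assms(2) by (auto simp: indicator_def fun_eq_iff not_le)
  finally show ?thesis .
qed

lemma directional_mean_value:
  fixes f :: "'a::euclidean_space \<Rightarrow> real"
  assumes "\<And>x. (f has_derivative f' x) (at x)" "h > 0"
  shows "\<exists>t. 0 < t \<and> t < h \<and> f (x + h *\<^sub>R v) - f x = h * f' (x + t *\<^sub>R v) v"
proof -
  have "((\<lambda>t. f (x + t *\<^sub>R v)) has_real_derivative f' (x + t *\<^sub>R v) v) (at t)" for t
  proof -
    have "((\<lambda>t. f (x + t *\<^sub>R v)) has_derivative (\<lambda>r. f' (x + t *\<^sub>R v) (r *\<^sub>R v))) (at t)"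
      by (rule has_derivative_compose[of "\<lambda>t. x + t *\<^sub>R v", OF _ assms(1)])
        (auto intro!: derivative_eq_intros)
    then show ?thesis
      unfolding has_field_derivative_def
      using linear_simps(5)[OF has_derivative_bounded_linear[OF assms(1)]]
      by (simp add: mult_commute_abs)
  qed
  then show ?thesis
    using MVT2[OF assms(2), of "\<lambda>t. f (x + t *\<^sub>R v)" "\<lambda>t. f' (x + t *\<^sub>R v) v"] by auto
qed

text \<open>By translation invariance every difference quotient has integral 0. The mean value
  theorem bounds the quotients uniformly on a fixed ball, and dominated convergence passes to the
  derivative.\<close>

lemma integral_directional_derivative_real:
  fixes f :: "'a::euclidean_space \<Rightarrow> real"
  assumes f: "\<And>x. (f has_derivative f' x) (at x)" and cont: "continuous_on UNIV (\<lambda>x. f' x v)"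
    and supp: "\<And>x. norm x > r \<Longrightarrow> f x = 0"
  shows "(LINT x|lborel. f' x v) = 0"
proof -
  define h where "h n = inverse (real (Suc n))" for n
  have h: "h n > 0" "h n \<le> 1" for n by (auto simp: h_def field_simps)
  define s where "s n x = (f (x + h n *\<^sub>R v) - f x) / h n" for n x
  have cf: "continuous_on UNIV f"
    by (intro continuous_at_imp_continuous_on ballI has_derivative_continuous[OF f])
  have mf: "f \<in> borel_measurable borel" using cf by (rule borel_measurable_continuous_onI)
  have intf: "integrable lborel f" by (rule integrable_continuous_compact_support[OF cf supp])
  have cfs: "continuous_on UNIV (\<lambda>x. f (x + w))" for w
    by (rule continuous_on_compose2[OF cf]) (auto intro!: continuous_intros)
  have intfs: "integrable lborel (\<lambda>x. f (x + w))" for w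
  proof (rule integrable_continuous_compact_support[OF cfs])
    fix x :: 'a assume "norm x > r + norm w"
    moreover have "norm x \<le> norm (x + w) + norm w"
      using norm_triangle_ineq4[of "x + w" w] by simp
    ultimately show "f (x + w) = 0" by (intro supp) simp
  qed
  have int_s: "(LINT x|lborel. s n x) = 0" for n
    unfolding s_def using intf intfs lborel_integral_translate[OF mf] by simp
  \<comment> \<open>The quotient can be nonzero only for norm x \<le> \<open>r + norm v\<close>, and
    the intermediate point of the mean value theorem is at most \<open>norm v\<close> further out
    because \<open>h n\<close> is at most 1.\<close>
  have "compact ((\<lambda>x. f' x v) ` cball 0 (r + 2 * norm v))"
    by (rule compact_continuous_image) (use cont continuous_on_subset in auto)
  then have "bounded ((\<lambda>x. f' x v) ` cball 0 (r + 2 * norm v))" by (rule compact_imp_bounded)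
  then obtain M where "\<forall>x\<in>cball 0 (r + 2 * norm v). \<bar>f' x v\<bar> \<le> M"
    by (auto simp: bounded_iff)
  then have M: "\<bar>f' x v\<bar> \<le> M" if "norm x \<le> r + 2 * norm v" for x
    using that by simp
  define w where "w = (\<lambda>x::'a. indicator (cball 0 (r + norm v)) x *\<^sub>R M)"
  have "(\<lambda>n. LINT x|lborel. s n x) \<longlonglongrightarrow> (LINT x|lborel. f' x v)"
  proof (rule integral_dominated_convergence[where w=w])
    show "(\<lambda>x. f' x v) \<in> borel_measurable lborel"
      using borel_measurable_continuous_onI[OF cont] by simp
    show "s n \<in> borel_measurable lborel" for n
      unfolding s_def[abs_def] using intf intfs by auto
    show "integrable lborel w"
      unfolding w_def by (rule borel_integrable_compact) auto
    show "AE x in lborel. norm (s n x) \<le> w x" for n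
    proof (rule AE_I2)
      fix x
      show "norm (s n x) \<le> w x"
      proof (cases "norm x \<le> r + norm v")
        case True
        obtain t where t: "0 < t" "t < h n" "f (x + h n *\<^sub>R v) - f x = h n * f' (x + t *\<^sub>R v) v"
          using directional_mean_value[OF f h(1)] by blast
        have "norm (x + t *\<^sub>R v) \<le> norm x + t * norm v"
          using norm_triangle_ineq[of x "t *\<^sub>R v"] t by simp
        also have "\<dots> \<le> r + 2 * norm v"
          using True t(2) h(2)[of n] mult_left_le_one_le[of "norm v" t] t(1) by auto
        finally show ?thesis
          using True M[of "x + t *\<^sub>R v"] h(1)[of n] by (simp add: s_def t(3) w_def)
      next
        case False
        have "norm x \<le> norm (x + h n *\<^sub>R v) + h n * norm v"
          using norm_triangle_ineq4[of "x + h n *\<^sub>R v" "h n *\<^sub>R v"] h(1)[of n] by simp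
        also have "h n * norm v \<le> norm v"
          using h[of n] mult_left_le_one_le[of "norm v" "h n"] by auto
        finally have "f (x + h n *\<^sub>R v) = 0" using False by (intro supp) auto
        moreover have "f x = 0" using False norm_ge_zero[of v] by (intro supp) linarith
        ultimately show ?thesis using False by (simp add: s_def w_def)
      qed
    qed
    show "AE x in lborel. (\<lambda>n. s n x) \<longlonglongrightarrow> f' x v"
    proof (rule AE_I2)
      fix x
      have "((\<lambda>t. f (x + t *\<^sub>R v)) has_derivative (\<lambda>r. f' (x + 0 *\<^sub>R v) (r *\<^sub>R v))) (at 0)"
        by (rule has_derivative_compose[of "\<lambda>t. x + t *\<^sub>R v", OF _ f])
          (auto intro!: derivative_eq_intros)
      then have "((\<lambda>t. f (x + t *\<^sub>R v)) has_real_derivative f' x v) (at 0)"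
        unfolding has_field_derivative_def
        using linear_simps(5)[OF has_derivative_bounded_linear[OF f]]
        by (simp add: mult_commute_abs)
      from DERIV_D[OF this] have lim: "((\<lambda>t. (f (x + t *\<^sub>R v) - f x) / t) \<longlongrightarrow> f' x v) (at 0)" by simp
      have "filterlim h (at 0) sequentially"
        unfolding filterlim_at using h(1) LIMSEQ_inverse_real_of_nat
        by (auto simp: h_def[abs_def] simp del: of_nat_Suc)
      from filterlim_compose[OF lim this] show "(\<lambda>n. s n x) \<longlonglongrightarrow> f' x v"
        by (simp add: s_def)
    qed
  qed
  then have "(\<lambda>n. 0) \<longlonglongrightarrow> (LINT x|lborel. f' x v)" by (simp add: int_s)
  then show ?thesis by (simp add: LIMSEQ_const_iff)
qed

lemma integral_directional_derivative:
  fixes f :: "'a::euclidean_space \<Rightarrow> complex"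
  assumes f: "\<And>x. (f has_derivative f' x) (at x)" and cont: "continuous_on UNIV (\<lambda>x. f' x v)"
    and supp: "\<And>x. norm x > r \<Longrightarrow> f x = 0"
  shows "(LINT x|lborel. f' x v) = 0"
proof -
  \<comment> \<open>The derivative inherits the support; its integrability is needed to exchange the
    integral with \<open>Re\<close> and \<open>Im\<close>.\<close>
  have supp': "f' x v = 0" if "norm x > r" for x
  proof -
    have "((\<lambda>x. 0) has_derivative f' x) (at x)"
      by (rule has_derivative_transform_within_open[OF f, where s="- cball 0 r"])
        (use that supp in auto)
    then show ?thesis using has_derivative_unique[OF _ has_derivative_const] by metis
  qed
  have int: "integrable lborel (\<lambda>x. f' x v)"
    by (rule integrable_continuous_compact_support[OF cont supp'])
  have "(LINT x|lborel. Re (f' x v)) = 0"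
    by (rule integral_directional_derivative_real[of "\<lambda>x. Re (f x)" "\<lambda>x v. Re (f' x v)" v r])
      (use f cont supp in \<open>auto intro!: derivative_intros continuous_intros\<close>)
  moreover have "(LINT x|lborel. Im (f' x v)) = 0"
    by (rule integral_directional_derivative_real[of "\<lambda>x. Im (f x)" "\<lambda>x v. Im (f' x v)" v r])
      (use f cont supp in \<open>auto intro!: derivative_intros continuous_intros\<close>)
  ultimately show ?thesis
    using int by (simp add: complex_eq_iff integral_Re integral_Im)
qed

section \<open>A continuously differentiable cut-off\<close>

text \<open>A ramp of class C^1. Integration by parts differentiates the cut-off once, so no smooth
  bump function is called for.\<close>

definition pos_square :: "real \<Rightarrow> real" where
  "pos_square s = (max 0 s)\<^sup>2"

lemma DERIV_pos_square: "(pos_square has_real_derivative 2 * max 0 s) (at s)"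
proof -
  consider "s > 0" | "s < 0" | "s = 0" by linarith
  then show ?thesis
  proof cases
    case 1
    have "((\<lambda>s. s\<^sup>2) has_real_derivative 2 * s) (at s)"
      by (auto intro!: derivative_eq_intros)
    then have "(pos_square has_real_derivative 2 * s) (at s)"
      by (rule has_field_derivative_transform_within_open[where S="{0<..}"])
        (use 1 in \<open>auto simp: pos_square_def max_def\<close>)
    then show ?thesis using 1 by simp
  next
    case 2
    have "(pos_square has_real_derivative 0) (at s)"
      by (rule has_field_derivative_transform_within_open[OF DERIV_const[of 0], where S="{..<0}"])
        (use 2 in \<open>auto simp: pos_square_def max_def\<close>)
    then show ?thesis using 2 by simp
  next
    case 3
    have "((\<lambda>h. pos_square h / h) \<longlongrightarrow> 0) (at 0)"
    proof (rule Lim_null_comparison)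
      show "\<forall>\<^sub>F h in at 0. norm (pos_square h / h) \<le> \<bar>h\<bar>"
        by (rule always_eventually) (auto simp: pos_square_def max_def power2_eq_square)
      show "((\<lambda>h::real. \<bar>h\<bar>) \<longlongrightarrow> 0) (at 0)"
        by (rule tendsto_eq_intros | simp)+
    qed
    then show ?thesis
      using 3 by (simp add: DERIV_def pos_square_def)
  qed
qed

text \<open>For positive \<open>R\<close> this is 1 where norm x \<le> R and 0 where the squared
  norm is at least 2 R^2; the nested ramps make both transitions C^1. The inner product in place of
  the norm keeps it differentiable at the origin.\<close>

definition cutoff :: "real \<Rightarrow> 'a::euclidean_space \<Rightarrow> real" where
  "cutoff R x = pos_square (1 - pos_square ((x \<bullet> x) / R\<^sup>2 - 1))"

text \<open>The 8 collects a factor 2 from each of the two ramps and one from the gradient of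
  \<open>x \<bullet> x\<close>.\<close>

definition cutoff_deriv :: "real \<Rightarrow> 'a::euclidean_space \<Rightarrow> 'a \<Rightarrow> real" where
  "cutoff_deriv R x v = - 8 * max 0 (1 - pos_square ((x \<bullet> x) / R\<^sup>2 - 1)) * max 0 ((x \<bullet> x) / R\<^sup>2 - 1) * (x \<bullet> v) / R\<^sup>2"

lemma cutoff_has_derivative:
  "(cutoff R has_derivative cutoff_deriv R x) (at x)"
proof -
  have "((\<lambda>x. x \<bullet> x) has_derivative (\<lambda>v. 2 * (x \<bullet> v))) (at x)"
    by (auto intro!: derivative_eq_intros simp: inner_commute)
  from bounded_linear.has_derivative[OF bounded_linear_divide this]
  have 1: "((\<lambda>x. (x \<bullet> x) / R\<^sup>2 - 1) has_derivative (\<lambda>v. 2 * (x \<bullet> v) / R\<^sup>2)) (at x)"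
    using has_derivative_diff[OF _ has_derivative_const] by fastforce
  have 2: "((\<lambda>x. 1 - pos_square ((x \<bullet> x) / R\<^sup>2 - 1)) has_derivative
      (\<lambda>v. - (2 * max 0 ((x \<bullet> x) / R\<^sup>2 - 1) * (2 * (x \<bullet> v) / R\<^sup>2)))) (at x)"
    using has_derivative_compose[OF 1 DERIV_pos_square[unfolded has_field_derivative_def]]
    by (auto intro!: derivative_eq_intros)
  show ?thesis
    using has_derivative_compose[OF 2 DERIV_pos_square[unfolded has_field_derivative_def]]
    unfolding cutoff_def[abs_def] by (rule has_derivative_eq_rhs) (auto simp: cutoff_deriv_def field_simps)
qed

lemma continuous_on_cutoff: "continuous_on UNIV (cutoff R)"
  by (intro continuous_at_imp_continuous_on ballI has_derivative_continuous[OF cutoff_has_derivative])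

lemma continuous_on_cutoff_deriv: "continuous_on UNIV (\<lambda>x. cutoff_deriv R x v)"
  unfolding cutoff_deriv_def pos_square_def divide_inverse by (intro continuous_intros)

lemma cutoff_bounds: "0 \<le> cutoff R x" "cutoff R x \<le> 1"
  by (auto simp: cutoff_def pos_square_def power_le_one_iff)

lemma cutoff_support:
  assumes "R > 0" "norm x > 2 * R"
  shows "cutoff R x = 0" "cutoff_deriv R x v = 0"
proof -
  have "(2 * R)\<^sup>2 \<le> (norm x)\<^sup>2" using assms by (intro power_mono) auto
  then have "4 * R\<^sup>2 \<le> x \<bullet> x"
    by (simp add: power2_norm_eq_inner power_mult_distrib)
  then have "2 * R\<^sup>2 \<le> x \<bullet> x"
    using zero_le_power2[of R] by linarith
  then have "(x \<bullet> x) / R\<^sup>2 - 1 \<ge> 1"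
    using assms(1) by (simp add: field_simps)
  then have "1 \<le> pos_square ((x \<bullet> x) / R\<^sup>2 - 1)"
    by (simp add: pos_square_def one_le_power)
  then show "cutoff R x = 0" "cutoff_deriv R x v = 0"
    by (simp_all add: cutoff_def cutoff_deriv_def pos_square_def[of "1 - _"] max_def)
qed

lemma cutoff_deriv_support_inner:
  assumes "R > 0" "norm x < R"
  shows "cutoff_deriv R x v = 0"
proof -
  have "(norm x)\<^sup>2 \<le> R\<^sup>2" using assms by (intro power_mono) auto
  then have "(x \<bullet> x) / R\<^sup>2 - 1 \<le> 0"
    using assms(1) by (simp add: power2_norm_eq_inner field_simps)
  then show ?thesis
    by (simp add: cutoff_deriv_def pos_square_def max_def)
qed

text \<open>The two ramp factors have product at most 1, since the outer one vanishes once the inner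
  exceeds 1. With |x \<bullet> v| at most 2 R this gives 8 * 2 R / R^2.\<close>

lemma cutoff_deriv_bound:
  assumes "R > 0" "norm v = 1"
  shows "\<bar>cutoff_deriv R x v\<bar> \<le> 16 / R"
proof (cases "norm x \<le> 2 * R")
  case False
  then show ?thesis using assms cutoff_support(2)[of R x v] by simp
next
  case True
  define s where "s = (x \<bullet> x) / R\<^sup>2 - 1"
  have "max 0 (1 - pos_square s) * max 0 s \<le> 1"
  proof (cases "s \<le> 1")
    case True
    then show ?thesis by (intro mult_le_one) (auto simp: pos_square_def)
  next
    case False
    then have "1 \<le> pos_square s" by (simp add: pos_square_def one_le_power)
    then show ?thesis by (simp add: max_def)
  qed
  moreover have "0 \<le> max 0 (1 - pos_square s) * max 0 s" by simp
  moreover have "\<bar>x \<bullet> v\<bar> \<le> 2 * R"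
    using Cauchy_Schwarz_ineq2[of x v] True assms(2) by simp
  ultimately have "max 0 (1 - pos_square s) * max 0 s * \<bar>x \<bullet> v\<bar> \<le> 1 * (2 * R)"
    by (intro mult_mono) auto
  then show ?thesis
    using assms(1) unfolding cutoff_deriv_def s_def[symmetric]
    by (simp add: abs_mult field_simps power2_eq_square)
qed

lemma cutoff_tendsto: "(\<lambda>n. cutoff (real (Suc n)) x) \<longlonglongrightarrow> 1"
proof (rule tendsto_eventually)
  obtain N :: nat where N: "norm x < real N" using reals_Archimedean2 by blast
  show "\<forall>\<^sub>F n in sequentially. cutoff (real (Suc n)) x = 1"
    unfolding eventually_sequentially
  proof (intro exI[of _ N] allI impI)
    fix n assume "N \<le> n"
    then have "(norm x)\<^sup>2 \<le> (real (Suc n))\<^sup>2" using N by (intro power_mono) auto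
    then have "(x \<bullet> x) / (real (Suc n))\<^sup>2 - 1 \<le> 0"
      by (simp add: power2_norm_eq_inner field_simps del: of_nat_Suc)
    then show "cutoff (real (Suc n)) x = 1"
      by (simp add: cutoff_def pos_square_def max_def del: of_nat_Suc)
  qed
qed

section \<open>Cut-off integration by parts and its error\<close>

text \<open>If \<open>T\<close> is not integrable the claim is the convention for the Bochner
  integral; otherwise dominated convergence applies with \<open>T\<close> itself as
  majorant.\<close>

lemma integral_eq_0_cutoff:
  fixes T :: "'a::euclidean_space \<Rightarrow> complex"
  assumes cont: "continuous_on UNIV T"
    and bound: "\<And>R. R \<ge> 2 \<Longrightarrow> norm (LINT x|lborel. cutoff R x *\<^sub>R T x) \<le> C / R"
  shows "(LINT x|lborel. T x) = 0"
proof (cases "integrable lborel T")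
  case False
  then show ?thesis by (rule not_integrable_integral_eq)
next
  case True
  have "(\<lambda>n. LINT x|lborel. cutoff (real (Suc n)) x *\<^sub>R T x) \<longlonglongrightarrow> (LINT x|lborel. T x)"
  proof (rule integral_dominated_convergence[where w="\<lambda>x. norm (T x)"])
    show "T \<in> borel_measurable lborel" using True by auto
    show "(\<lambda>x. cutoff (real (Suc n)) x *\<^sub>R T x) \<in> borel_measurable lborel" for n
      using borel_measurable_continuous_onI[OF continuous_on_scaleR[OF continuous_on_cutoff cont]] by simp
    show "integrable lborel (\<lambda>x. norm (T x))" using True by simp
    show "AE x in lborel. (\<lambda>n. cutoff (real (Suc n)) x *\<^sub>R T x) \<longlonglongrightarrow> T x"
      using tendsto_scaleR[OF cutoff_tendsto tendsto_const] by (intro AE_I2) fastforce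
    show "AE x in lborel. norm (cutoff (real (Suc n)) x *\<^sub>R T x) \<le> norm (T x)" for n
      by (intro AE_I2) (simp add: cutoff_bounds mult_left_le_one_le)
  qed
  moreover have "(\<lambda>n. LINT x|lborel. cutoff (real (Suc n)) x *\<^sub>R T x) \<longlonglongrightarrow> 0"
  proof (rule Lim_null_comparison)
    show "\<forall>\<^sub>F n in sequentially. norm (LINT x|lborel. cutoff (real (Suc n)) x *\<^sub>R T x) \<le> C * inverse (real (Suc n))"
      unfolding eventually_sequentially
      using bound by (intro exI[of _ 1]) (auto simp: divide_inverse simp del: of_nat_Suc)
    show "(\<lambda>n. C * inverse (real (Suc n))) \<longlonglongrightarrow> 0"
      using tendsto_mult_right_zero[OF LIMSEQ_inverse_real_of_nat] by auto
  qed
  ultimately show ?thesis using LIMSEQ_unique by blast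
qed

lemma integral_altsum:
  fixes h :: "6 \<Rightarrow> 6 \<Rightarrow> 6 \<Rightarrow> 6 \<Rightarrow> 6 \<Rightarrow> 6 \<Rightarrow> 'b \<Rightarrow> complex"
  assumes "\<And>a b c d e f. integrable M (h a b c d e f)"
  shows "(LINT x|M. altsum (\<lambda>a b c d e f. h a b c d e f x)) = altsum (\<lambda>a b c d e f. LINT x|M. h a b c d e f x)"
  unfolding altsum_def using assms by simp

text \<open>Integration by parts, term by term. The cut-off makes every single term integrable,
  which the uncut terms need not be.\<close>

lemma integral_cutoff_altsum_pderiv:
  fixes h :: "6 \<Rightarrow> 6 \<Rightarrow> 6 \<Rightarrow> 6 \<Rightarrow> 6 \<Rightarrow> real^6 \<Rightarrow> complex"
  assumes h: "\<And>b c d e f. smooth_on (h b c d e f) UNIV" and R: "R > 0"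
  shows "(LINT x|lborel. cutoff R x *\<^sub>R altsum (\<lambda>a b c d e f. pderiv_at a (h b c d e f) x)) =
    - (LINT x|lborel. altsum (\<lambda>a b c d e f. of_real (cutoff_deriv R x (axis a 1)) * h b c d e f x))"
proof -
  have ch: "continuous_on UNIV (h b c d e f)" for b c d e f
    by (rule smooth_on_continuous_on[OF h])
  have cdh: "continuous_on UNIV (pderiv_at a (h b c d e f))" for a b c d e f
    by (rule smooth_on_continuous_on[OF smooth_on_pderiv_at[OF h]])
  have i1: "integrable lborel (\<lambda>x. cutoff R x *\<^sub>R pderiv_at a (h b c d e f) x)" for a b c d e f
    by (rule integrable_continuous_compact_support[where r = "2 * R"])
      (auto intro!: continuous_intros continuous_on_cutoff cdh simp: cutoff_support R)
  have i2: "integrable lborel (\<lambda>x. of_real (cutoff_deriv R x (axis a 1)) * h b c d e f x)" for a b c d e f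
    by (rule integrable_continuous_compact_support[where r = "2 * R"])
      (auto intro!: continuous_intros continuous_on_cutoff_deriv ch simp: cutoff_support(2) R)
  have 0: "(LINT x|lborel. cutoff R x *\<^sub>R pderiv_at a (h b c d e f) x) +
      (LINT x|lborel. of_real (cutoff_deriv R x (axis a 1)) * h b c d e f x) = 0" for a b c d e f
  proof -
    have "(LINT x|lborel. cutoff R x *\<^sub>R frechet_derivative (h b c d e f) (at x) (axis a 1) +
        cutoff_deriv R x (axis a 1) *\<^sub>R h b c d e f x) = 0"
    proof (rule integral_directional_derivative[where v="axis a 1" and f="\<lambda>x. cutoff R x *\<^sub>R h b c d e f x" and r="2 * R"])
      show "((\<lambda>x. cutoff R x *\<^sub>R h b c d e f x) has_derivative
          (\<lambda>v. cutoff R x *\<^sub>R frechet_derivative (h b c d e f) (at x) v + cutoff_deriv R x v *\<^sub>R h b c d e f x)) (at x)" for x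
        by (intro has_derivative_scaleR cutoff_has_derivative smooth_on_has_derivative[OF h] open_UNIV UNIV_I)
      show "continuous_on UNIV (\<lambda>x. cutoff R x *\<^sub>R frechet_derivative (h b c d e f) (at x) (axis a 1) +
          cutoff_deriv R x (axis a 1) *\<^sub>R h b c d e f x)"
        using cdh[of a b c d e f] unfolding pderiv_at_def[abs_def]
        by (intro continuous_intros continuous_on_cutoff continuous_on_cutoff_deriv ch)
      show "cutoff R x *\<^sub>R h b c d e f x = 0" if "norm x > 2 * R" for x
        using cutoff_support(1)[OF R that] by simp
    qed
    then show ?thesis
      using i1[of a b c d e f] i2[of a b c d e f]
      by (simp add: pderiv_at_def scaleR_conv_of_real)
  qed
  have "(LINT x|lborel. cutoff R x *\<^sub>R altsum (\<lambda>a b c d e f. pderiv_at a (h b c d e f) x)) =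
      (LINT x|lborel. altsum (\<lambda>a b c d e f. cutoff R x *\<^sub>R pderiv_at a (h b c d e f) x))"
    unfolding scaleR_conv_of_real altsum_cmult ..
  also have "\<dots> = altsum (\<lambda>a b c d e f. LINT x|lborel. cutoff R x *\<^sub>R pderiv_at a (h b c d e f) x)"
    by (rule integral_altsum[OF i1])
  also have "\<dots> = - altsum (\<lambda>a b c d e f. LINT x|lborel. of_real (cutoff_deriv R x (axis a 1)) * h b c d e f x)"
    unfolding altsum_minus[symmetric] using 0 by (simp add: add_eq_0_iff2)
  also have "altsum (\<lambda>a b c d e f. LINT x|lborel. of_real (cutoff_deriv R x (axis a 1)) * h b c d e f x) =
      (LINT x|lborel. altsum (\<lambda>a b c d e f. of_real (cutoff_deriv R x (axis a 1)) * h b c d e f x))"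
    by (rule integral_altsum[OF i2, symmetric])
  finally show ?thesis .
qed

text \<open>The factor 64 is 2^6, from the volume of the ball of radius 2 R; one power of 1/R
  survives.\<close>

lemma integral_annulus_bound:
  fixes f :: "real^6 \<Rightarrow> complex"
  assumes R: "R > 0" and C: "C \<ge> 0"
    and zero: "\<And>x. norm x < R \<or> norm x > 2 * R \<Longrightarrow> f x = 0"
    and bound: "\<And>x. norm x \<ge> R \<Longrightarrow> norm (f x) \<le> C / R ^ 7"
  shows "norm (LINT x|lborel. f x) \<le> (64 * unit_ball_vol 6 * C) / R"
proof (cases "integrable lborel f")
  case False
  then show ?thesis using R C by (simp add: not_integrable_integral_eq)
next
  case True
  have "norm (LINT x|lborel. f x) \<le> (LINT x|lborel. norm (f x))"
    by (rule integral_norm_bound)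
  also have "\<dots> \<le> (LINT x|lborel. indicator (cball (0::real^6) (2 * R)) x *\<^sub>R (C / R ^ 7))"
  proof (rule Bochner_Integration.integral_mono)
    show "integrable lborel (\<lambda>x. norm (f x))" using True by simp
    show "integrable lborel (\<lambda>x::real^6. indicator (cball 0 (2 * R)) x *\<^sub>R (C / R ^ 7))"
      by (rule borel_integrable_compact) auto
    show "norm (f x) \<le> indicator (cball 0 (2 * R)) x *\<^sub>R (C / R ^ 7)" for x
      using zero[of x] bound[of x] C R by (cases "norm x < R") (auto simp: indicator_def)
  qed
  also have "\<dots> = measure lborel (cball (0::real^6) (2 * R)) * (C / R ^ 7)"
    by (simp add: mult.commute)
  also have "measure lborel (cball (0::real^6) (2 * R)) = unit_ball_vol 6 * (2 * R) ^ 6"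
    using R by (simp add: content_cball)
  finally show ?thesis
    using R by (simp add: field_simps power_mult_distrib eval_nat_numeral)
qed

section \<open>Index types with six and four elements\<close>

lemma exhaust_6:
  fixes x :: 6
  shows "x = 1 \<or> x = 2 \<or> x = 3 \<or> x = 4 \<or> x = 5 \<or> x = 6"
proof (induct x)
  case (of_int z)
  then have "z = 0 \<or> z = 1 \<or> z = 2 \<or> z = 3 \<or> z = 4 \<or> z = 5" by fastforce
  then show ?case by auto
qed

lemma UNIV_6: "UNIV = {1, 2, 3, 4, 5, 6 :: 6}"
  using exhaust_6 by auto

lemma exhaust_4_offset:
  fixes k i :: 4
  shows "k = i \<or> k = i + 1 \<or> k = i + 2 \<or> k = i + 3"
  using exhaust_4[of "k - i"] by (auto simp: diff_eq_eq add.commute)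

lemma vec_4_eqI:
  fixes v w :: "'a^4" and i :: 4
  assumes "v $ i = w $ i" "v $ (i + 1) = w $ (i + 1)" "v $ (i + 2) = w $ (i + 2)" "v $ (i + 3) = w $ (i + 3)"
  shows "v = w"
  unfolding vec_eq_iff
proof
  show "v $ k = w $ k" for k
    using exhaust_4_offset[of k i] assms by auto
qed

section \<open>Determinants of complex linear maps\<close>

definition of_real_matrix :: "real^'n^'m \<Rightarrow> complex^'n^'m" where
  "of_real_matrix A = (\<chi> r c. complex_of_real (A $ r $ c))"

lemma of_real_matrix_nth [simp]: "of_real_matrix A $ r $ c = complex_of_real (A $ r $ c)"
  by (simp add: of_real_matrix_def)

lemma of_real_matrix_mult: "of_real_matrix (A ** B) = of_real_matrix A ** of_real_matrix B"
  by (simp add: vec_eq_iff matrix_matrix_mult_def)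

lemma of_real_matrix_add: "of_real_matrix (A + B) = of_real_matrix A + of_real_matrix B"
  by (simp add: vec_eq_iff)

lemma of_real_matrix_mat [simp]: "of_real_matrix (mat 1) = mat 1"
  by (simp add: vec_eq_iff mat_def)

lemma det_of_real_matrix: "det (of_real_matrix A) = of_real (det A)"
  by (simp add: det_def)

lemma det_cnj: "det (\<chi> r c. cnj (A $ r $ c)) = cnj (det A)"
  by (simp add: det_def)

text \<open>With the projections \<open>P\<close>, \<open>P'\<close> onto the \<open>\<plusminus>\<i>\<close>-eigenspaces of \<open>J\<close> one has
  \<open>M = (M P + P') (P + M P')\<close>, and the two factors are complex conjugate.\<close>

lemma det_nonneg_of_commutes_complex_structure:
  fixes M J :: "real^'n^'n"
  assumes J: "J ** J = - mat 1" and M: "M ** J = J ** M"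
  shows "0 \<le> det M"
proof -
  \<comment> \<open>\<open>K\<close> is i times \<open>J\<close>, hence an involution. It is purely
    imaginary, so conjugation turns \<open>K\<close> into its negative and exchanges
    \<open>P\<close> and \<open>P'\<close>.\<close>
  define K :: "complex^'n^'n" where "K = (\<chi> r c. \<i> * of_real (J $ r $ c))"
  define P where "P = (1/2) *\<^sub>R (mat 1 + K)"
  define P' where "P' = (1/2) *\<^sub>R (mat 1 - K)"
  let ?M = "of_real_matrix M"
  have "K ** K = (\<chi> r c. - of_real ((J ** J) $ r $ c))"
    by (simp add: K_def vec_eq_iff matrix_matrix_mult_def sum_negf[symmetric])
      (simp add: algebra_simps sum_negf)
  then have K: "K ** K = mat 1"
    by (simp add: J vec_eq_iff mat_def)
  have comm: "K ** ?M = ?M ** K"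
  proof -
    have "K ** ?M = (\<chi> r c. \<i> * of_real ((J ** M) $ r $ c))"
      by (simp add: K_def vec_eq_iff matrix_matrix_mult_def sum_distrib_left mult.assoc)
    moreover have "?M ** K = (\<chi> r c. \<i> * of_real ((M ** J) $ r $ c))"
      by (simp add: K_def vec_eq_iff matrix_matrix_mult_def sum_distrib_left mult.left_commute)
    ultimately show ?thesis by (simp add: M)
  qed
  have PP: "P ** P = P" "P' ** P' = P'" "P ** P' = 0" "P' ** P = 0" "P + P' = mat 1"
    unfolding P_def P'_def
    by (simp_all only: matrix_bilinear_simps K matrix_mul_lid matrix_mul_rid)
      (simp_all add: vec_eq_iff scaleR_conv_of_real[where 'a=complex] field_simps)
  have PM: "P ** ?M = ?M ** P" "P' ** ?M = ?M ** P'"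
    unfolding P_def P'_def by (simp_all add: matrix_bilinear_simps comm)
  have "(?M ** P + P') ** (P + ?M ** P') =
      ?M ** (P ** P) + (P ** ?M) ** (?M ** P') * 0 + ?M ** P ** ?M ** P' + P' ** P + P' ** ?M ** P'"
    by (simp add: matrix_bilinear_simps matrix_mul_assoc)
  also have "\<dots> = ?M ** P + ?M ** (P' ** P') + ?M ** ?M ** (P ** P')"
    unfolding PP(1,4) PM(2) matrix_mul_assoc[symmetric] by (simp add: PM(1) matrix_mul_assoc)
  also have "\<dots> = ?M"
    unfolding PP by (simp add: matrix_bilinear_simps[symmetric] PP(5) matrix_matrix_mult_def[of _ 0])
  finally have fact: "?M = (?M ** P + P') ** (P + ?M ** P')" ..
  have "P + ?M ** P' = (\<chi> r c. cnj ((?M ** P + P') $ r $ c))"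
    by (simp add: P_def P'_def K_def vec_eq_iff matrix_matrix_mult_def mat_def if_distrib[of cnj] cong: if_cong)
  then have "complex_of_real (det M) = det (?M ** P + P') * cnj (det (?M ** P + P'))"
    unfolding det_of_real_matrix[symmetric] det_cnj[symmetric] det_mul[symmetric] using fact by simp
  then have "complex_of_real (det M) = of_real ((cmod (det (?M ** P + P')))\<^sup>2)"
    unfolding complex_norm_square .
  then show ?thesis
    by (simp only: of_real_eq_iff) simp
qed

section \<open>The standard charts of projective space\<close>

text \<open>The linear part of the affine chart: it turns real coordinates into a direction tangent
  to the slice Z_i = 1.\<close>

definition hom_dir :: "4 \<Rightarrow> real^6 \<Rightarrow> complex^4" where
  "hom_dir i x = affine_coords i x - axis i 1"

text \<open>The \<open>i\<close>-th entry is ignored, so this inverts both \<open>hom_dir i\<close>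
  and \<open>affine_coords i\<close> from the left.\<close>

definition real_coords :: "4 \<Rightarrow> complex^4 \<Rightarrow> real^6" where
  "real_coords i v = (\<chi> r. if r = 1 then Re (v $ (i + 1)) else if r = 2 then Im (v $ (i + 1))
     else if r = 3 then Re (v $ (i + 2)) else if r = 4 then Im (v $ (i + 2))
     else if r = 5 then Re (v $ (i + 3)) else Im (v $ (i + 3)))"

lemma hom_dir_nth [simp]:
  "hom_dir i x $ i = 0"
  "hom_dir i x $ (i + 1) = Complex (x $ 1) (x $ 2)"
  "hom_dir i x $ (i + 2) = Complex (x $ 3) (x $ 4)"
  "hom_dir i x $ (i + 3) = Complex (x $ 5) (x $ 6)"
  by (simp_all add: hom_dir_def affine_coords_def axis_def)

lemma affine_coords_conv: "affine_coords i x = axis i 1 + hom_dir i x"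
  by (simp add: hom_dir_def)

lemma affine_coords_self [simp]: "affine_coords i x $ i = 1"
  by (simp add: affine_coords_def)

lemma affine_coords_nonzero [simp]: "affine_coords i x \<noteq> 0"
  by (metis affine_coords_self zero_index zero_neq_one)

lemma real_coords_nth [simp]:
  "real_coords i v $ 1 = Re (v $ (i + 1))" "real_coords i v $ 2 = Im (v $ (i + 1))"
  "real_coords i v $ 3 = Re (v $ (i + 2))" "real_coords i v $ 4 = Im (v $ (i + 2))"
  "real_coords i v $ 5 = Re (v $ (i + 3))" "real_coords i v $ 6 = Im (v $ (i + 3))"
  by (simp_all add: real_coords_def)

lemma real_coords_hom_dir [simp]: "real_coords i (hom_dir i x) = x"
proof -
  have "real_coords i (hom_dir i x) $ r = x $ r" for r
    using exhaust_6[of r] by auto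
  then show ?thesis by (simp add: vec_eq_iff)
qed

lemma real_coords_affine_coords [simp]: "real_coords i (affine_coords i x) = x"
proof -
  have "real_coords i (affine_coords i x) = real_coords i (hom_dir i x)"
    by (simp add: affine_coords_conv real_coords_def axis_def vec_eq_iff)
  then show ?thesis by simp
qed

lemma hom_dir_real_coords: "hom_dir i (real_coords i v) = v - axis i (v $ i)"
  by (rule vec_4_eqI[of _ i]) (simp_all add: axis_def complex_eq_iff)

lemma affine_coords_real_coords: "v $ i = 1 \<Longrightarrow> affine_coords i (real_coords i v) = v"
  by (simp add: affine_coords_conv hom_dir_real_coords)

lemma bounded_linear_hom_dir: "bounded_linear (hom_dir i)"
  unfolding linear_conv_bounded_linear[symmetric] linear_iff
  by (intro conjI allI; rule vec_4_eqI[of _ i]) (simp_all add: complex_eq_iff)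

lemma bounded_linear_real_coords: "bounded_linear (real_coords i)"
  unfolding linear_conv_bounded_linear[symmetric] linear_iff
  by (auto simp: vec_eq_iff real_coords_def)

lemma smooth_on_affine_coords: "open S \<Longrightarrow> smooth_on (affine_coords i) S"
  unfolding affine_coords_conv[abs_def]
  by (intro smooth_on_add smooth_on_const smooth_on_linear bounded_linear_hom_dir)

section \<open>Changes of affine chart\<close>

text \<open>Explicit forms of \<open>overlap\<close> and \<open>transition\<close>. All calculus is
  done with them; they are identified later with those of projective space and of either
  sheet.\<close>

definition chart_overlap :: "4 \<Rightarrow> 4 \<Rightarrow> (real^6) set" where
  "chart_overlap i j = {x. affine_coords i x $ j \<noteq> 0}"

definition chart_change :: "4 \<Rightarrow> 4 \<Rightarrow> real^6 \<Rightarrow> real^6" where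
  "chart_change i j x = real_coords j (inverse (affine_coords i x $ j) *s affine_coords i x)"

text \<open>The quotient rule for Z / Z_j in direction \<open>v\<close>. Kept on complex vectors, it
  displays complex linearity in \<open>v\<close>.\<close>

definition chart_change_deriv :: "4 \<Rightarrow> 4 \<Rightarrow> real^6 \<Rightarrow> complex^4 \<Rightarrow> complex^4" where
  "chart_change_deriv i j x v = inverse (affine_coords i x $ j) *s v -
     (v $ j * (inverse (affine_coords i x $ j))\<^sup>2) *s affine_coords i x"

lemma continuous_on_affine_coords: "continuous_on S (affine_coords i)"
  using smooth_on_continuous_on[OF smooth_on_affine_coords[OF open_UNIV]] continuous_on_subset by blast

lemma open_chart_overlap: "open (chart_overlap i j)"
  unfolding chart_overlap_def
  by (intro open_Collect_neq continuous_intros continuous_on_affine_coords)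

lemma affine_coords_chart_change:
  "x \<in> chart_overlap i j \<Longrightarrow> affine_coords j (chart_change i j x) = inverse (affine_coords i x $ j) *s affine_coords i x"
  unfolding chart_change_def chart_overlap_def by (simp add: affine_coords_real_coords)

lemma chart_overlap_self [simp]: "chart_overlap i i = UNIV"
  by (simp add: chart_overlap_def)

lemma chart_change_self [simp]: "chart_change i i x = x"
proof -
  have "chart_change i i x = real_coords i (1 *s affine_coords i x)"
    by (simp add: chart_change_def)
  then show ?thesis by (simp del: scalar_mult_eq_scaleR)
qed

lemma smooth_on_chart_change: "smooth_on (chart_change i j) (chart_overlap i j)"
  unfolding chart_change_def[abs_def] vector_scalar_mult_def
  by (intro smooth_on_bounded_linear[OF _ bounded_linear_real_coords] smooth_on_vec_lambda
      smooth_on_mult smooth_on_inverse smooth_on_vec_nth smooth_on_affine_coords open_chart_overlap)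
    (simp add: chart_overlap_def)

lemma affine_coords_has_derivative: "(affine_coords i has_derivative hom_dir i) (at x)"
  unfolding affine_coords_conv[abs_def]
  using has_derivative_add[OF has_derivative_const bounded_linear_imp_has_derivative[OF bounded_linear_hom_dir]]
  by simp

lemma has_derivative_vec_lambda:
  fixes f :: "'n::finite \<Rightarrow> 'a::real_normed_vector \<Rightarrow> complex"
  assumes "\<And>i. (f i has_derivative f' i) F"
  shows "((\<lambda>x. \<chi> i. f i x) has_derivative (\<lambda>v. \<chi> i. f' i v)) F"
proof -
  have bl: "bounded_linear (\<lambda>c::complex. axis i c :: complex^'n)" for i
    unfolding linear_conv_bounded_linear[symmetric] linear_iff by (simp add: axis_def vec_eq_iff)
  have eq: "(\<chi> i. g i) = (\<Sum>i\<in>UNIV. axis i (g i) :: complex^'n)" for g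
    by (simp add: vec_eq_iff axis_def)
  show ?thesis
    unfolding eq by (intro has_derivative_sum bounded_linear.has_derivative[OF bl] assms)
qed

lemma chart_change_has_derivative:
  assumes "x \<in> chart_overlap i j"
  shows "(chart_change i j has_derivative (\<lambda>u. real_coords j (chart_change_deriv i j x (hom_dir i u)))) (at x)"
proof -
  let ?Z = "affine_coords i x"
  have Z: "((\<lambda>x. affine_coords i x $ k) has_derivative (\<lambda>u. hom_dir i u $ k)) (at x)" for k
    by (rule bounded_linear.has_derivative[OF bounded_linear_vec_nth affine_coords_has_derivative])
  have nz: "?Z $ j \<noteq> 0" using assms by (simp add: chart_overlap_def)
  have "((\<lambda>x. inverse (affine_coords i x $ j) * affine_coords i x $ k) has_derivative
      (\<lambda>u. inverse (?Z $ j) * hom_dir i u $ k +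
        - (inverse (?Z $ j) * hom_dir i u $ j * inverse (?Z $ j)) * ?Z $ k)) (at x)" for k
    by (rule has_derivative_mult[OF Deriv.has_derivative_inverse[OF nz Z] Z])
  from has_derivative_vec_lambda[OF this]
  have "((\<lambda>x. inverse (affine_coords i x $ j) *s affine_coords i x) has_derivative
      (\<lambda>u. chart_change_deriv i j x (hom_dir i u))) (at x)"
    unfolding vector_scalar_mult_def
    by (rule has_derivative_eq_rhs) (auto simp: chart_change_deriv_def vec_eq_iff power2_eq_square fun_eq_iff)
  from bounded_linear.has_derivative[OF bounded_linear_real_coords this]
  show ?thesis unfolding chart_change_def[abs_def] .
qed

text \<open>Each chart change normalises the same homogeneous vector by a different entry, and
  successive scalings collapse.\<close>

lemma chart_change_cocycle:
  assumes "x \<in> chart_overlap i j" "x \<in> chart_overlap i k"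
  shows "chart_change i j x \<in> chart_overlap j k" "chart_change j k (chart_change i j x) = chart_change i k x"
proof -
  let ?Z = "affine_coords i x"
  have nz: "?Z $ j \<noteq> 0" "?Z $ k \<noteq> 0" using assms by (auto simp: chart_overlap_def)
  show "chart_change i j x \<in> chart_overlap j k"
    using nz affine_coords_chart_change[OF assms(1)] by (simp add: chart_overlap_def)
  have "inverse (affine_coords j (chart_change i j x) $ k) *s affine_coords j (chart_change i j x) = inverse (?Z $ k) *s ?Z"
    unfolding affine_coords_chart_change[OF assms(1)] using nz by (simp add: vec_eq_iff field_simps)
  then show "chart_change j k (chart_change i j x) = chart_change i k x"
    by (simp add: chart_change_def)
qed

lemma jacobian_eq_matrix: "(f has_derivative f') (at x) \<Longrightarrow> jacobian f (at x) = matrix f'"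
  unfolding jacobian_def using frechet_derivative_at by metis

lemma jacobian_chart_change:
  assumes "x \<in> chart_overlap i j"
  shows "jacobian (chart_change i j) (at x) = matrix (\<lambda>u. real_coords j (chart_change_deriv i j x (hom_dir i u)))"
  by (rule jacobian_eq_matrix[OF chart_change_has_derivative[OF assms]])

lemma jacobian_chart_change_cocycle:
  assumes "x \<in> chart_overlap i j" "x \<in> chart_overlap i k"
  shows "jacobian (chart_change i k) (at x) =
    jacobian (chart_change j k) (at (chart_change i j x)) ** jacobian (chart_change i j) (at x)"
proof -
  note d1 = chart_change_has_derivative[OF assms(1)]
  note d2 = chart_change_has_derivative[OF chart_change_cocycle(1)[OF assms]]
  have "open (chart_overlap i j \<inter> chart_overlap i k)"
    by (intro open_Int open_chart_overlap)
  from has_derivative_transform_within_open[OF has_derivative_compose[OF d1 d2] this, of "chart_change i k"]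
  have "(chart_change i k has_derivative (\<lambda>u. real_coords k (chart_change_deriv j k (chart_change i j x)
      (hom_dir j (real_coords j (chart_change_deriv i j x (hom_dir i u))))))) (at x)"
    using assms chart_change_cocycle(2) by blast
  from jacobian_eq_matrix[OF this] show ?thesis
    unfolding jacobian_eq_matrix[OF d1] jacobian_eq_matrix[OF d2]
    using matrix_compose[OF has_derivative_linear[OF d1] has_derivative_linear[OF d2]]
    by (simp add: o_def)
qed

lemma jacobian_chart_change_self: "jacobian (chart_change i i) (at x) = mat 1"
proof -
  have "(chart_change i i has_derivative (\<lambda>x. x)) (at x)"
    using has_derivative_ident by (simp add: fun_eq_iff[of "chart_change i i" "\<lambda>x. x", simplified])
  from jacobian_eq_matrix[OF this] show ?thesis using matrix_id_mat_1 by (simp add: id_def)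
qed

lemma jacobian_chart_change_inverse:
  assumes "x \<in> chart_overlap i j"
  shows "jacobian (chart_change j i) (at (chart_change i j x)) ** jacobian (chart_change i j) (at x) = mat 1"
  using jacobian_chart_change_cocycle[OF assms, of i] by (simp add: jacobian_chart_change_self)

section \<open>Complex structure and orientation\<close>

text \<open>Multiplication by i in real coordinates. The three affine coordinates fill the real
  slots in the same pattern in every chart, so chart 0 can serve for all.\<close>

definition mult_i :: "real^6 \<Rightarrow> real^6" where
  "mult_i x = real_coords 0 (\<i> *s hom_dir 0 x)"

lemma real_coords_mult_i: "real_coords i (\<i> *s v) = mult_i (real_coords i v)"
proof -
  have "real_coords i (\<i> *s v) $ r = mult_i (real_coords i v) $ r" for r
    unfolding mult_i_def using exhaust_6[of r] hom_dir_nth[of 0 "real_coords i v"] by auto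
  then show ?thesis by (simp add: vec_eq_iff)
qed

lemma hom_dir_mult_i: "hom_dir i (mult_i x) = \<i> *s hom_dir i x"
proof -
  have "hom_dir i (mult_i x) = hom_dir i (real_coords i (\<i> *s hom_dir i x))"
    by (simp add: real_coords_mult_i)
  also have "\<dots> = \<i> *s hom_dir i x"
    by (simp add: hom_dir_real_coords)
  finally show ?thesis .
qed

text \<open>The chart change is holomorphic: its derivative commutes with \<open>mult_i\<close>, so
  its determinant is nonnegative, and the inverse chart change makes it nonzero.\<close>

lemma det_jacobian_chart_change_pos:
  assumes "x \<in> chart_overlap i j"
  shows "det (jacobian (chart_change i j) (at x)) > 0"
proof -
  let ?D = "\<lambda>u. real_coords j (chart_change_deriv i j x (hom_dir i u))"
  have lin: "linear ?D"
    by (rule has_derivative_linear[OF chart_change_has_derivative[OF assms]])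
  have lini: "linear mult_i"
    unfolding mult_i_def linear_iff
    by (simp add: linear_simps[OF bounded_linear_hom_dir] linear_simps[OF bounded_linear_real_coords]
        vector_add_ldistrib)
      (metis (no_types) linear_simps(5)[OF bounded_linear_real_coords] vector_scaleR_component
        vec_eq_iff vector_smult_component mult_scaleR_right)
  have sq: "matrix mult_i ** matrix mult_i = - mat 1"
  proof -
    have "mult_i (mult_i x) = - x" for x
    proof -
      have "mult_i (mult_i x) = real_coords 0 (\<i> *s (\<i> *s hom_dir 0 x))"
        by (simp only: real_coords_mult_i real_coords_hom_dir)
      also have "\<i> *s (\<i> *s hom_dir 0 x) = - hom_dir 0 x"
        by (simp add: vec_eq_iff)
      also have "real_coords 0 (- hom_dir 0 x) = - x"
        by (simp add: linear_simps[OF bounded_linear_real_coords])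
      finally show ?thesis .
    qed
    then have "mult_i \<circ> mult_i = uminus" by auto
    then have "matrix mult_i ** matrix mult_i = matrix (uminus :: real^6 \<Rightarrow> real^6)"
      using matrix_compose[OF lini lini] by simp
    also have "\<dots> = - mat 1"
      by (simp add: matrix_def vec_eq_iff mat_def axis_def)
    finally show ?thesis .
  qed
  have "chart_change_deriv i j x (\<i> *s v) = \<i> *s chart_change_deriv i j x v" for v
    by (simp add: chart_change_deriv_def vec_eq_iff algebra_simps)
  then have "?D \<circ> mult_i = mult_i \<circ> ?D"
    by (auto simp: hom_dir_mult_i real_coords_mult_i)
  then have "matrix ?D ** matrix mult_i = matrix mult_i ** matrix ?D"
    using matrix_compose[OF lini lin] matrix_compose[OF lin lini] by simp
  from det_nonneg_of_commutes_complex_structure[OF sq this]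
  have "0 \<le> det (jacobian (chart_change i j) (at x))"
    by (simp add: jacobian_chart_change[OF assms])
  moreover have "det (jacobian (chart_change i j) (at x)) \<noteq> 0"
    using arg_cong[OF jacobian_chart_change_inverse[OF assms], of det] by (auto simp: det_mul)
  ultimately show ?thesis by simp
qed

section \<open>Topology of the sheets\<close>

text \<open>\<open>topology\<close> inverts \<open>openin\<close> only on families closed under
  finite intersections and unions, so that closure is checked here.\<close>

lemma openin_quotient_topology:
  "openin (quotient_topology T q) U \<longleftrightarrow> U \<subseteq> q ` topspace T \<and> openin T {x \<in> topspace T. q x \<in> U}"
proof -
  let ?P = "\<lambda>U. U \<subseteq> q ` topspace T \<and> openin T {x \<in> topspace T. q x \<in> U}"
  have "istopology ?P"
    unfolding istopology_def
  proof (intro conjI allI impI)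
    fix U V assume "?P U" "?P V"
    then show "U \<inter> V \<subseteq> q ` topspace T" by auto
    have "{x \<in> topspace T. q x \<in> U \<inter> V} = {x \<in> topspace T. q x \<in> U} \<inter> {x \<in> topspace T. q x \<in> V}" by auto
    then show "openin T {x \<in> topspace T. q x \<in> U \<inter> V}"
      using \<open>?P U\<close> \<open>?P V\<close> by auto
  next
    fix \<U> assume U: "\<forall>U\<in>\<U>. ?P U"
    then show "\<Union>\<U> \<subseteq> q ` topspace T" by auto
    have "{x \<in> topspace T. q x \<in> \<Union>\<U>} = \<Union>((\<lambda>U. {x \<in> topspace T. q x \<in> U}) ` \<U>)" by auto
    then show "openin T {x \<in> topspace T. q x \<in> \<Union>\<U>}"
      using U by (auto intro!: openin_Union)
  qed
  then show ?thesis
    by (simp add: quotient_topology_def topology_inverse')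
qed

lemma topspace_quotient_topology [simp]: "topspace (quotient_topology T q) = q ` topspace T"
proof (rule antisym)
  show "topspace (quotient_topology T q) \<subseteq> q ` topspace T"
    using openin_quotient_topology[of T q "topspace (quotient_topology T q)"] by simp
  have "{x \<in> topspace T. q x \<in> q ` topspace T} = topspace T" by auto
  then have "openin (quotient_topology T q) (q ` topspace T)"
    by (simp add: openin_quotient_topology)
  then show "q ` topspace T \<subseteq> topspace (quotient_topology T q)"
    by (rule openin_subset)
qed

section \<open>Complex lines and affine charts\<close>

lemma complex_line_scale: "c \<noteq> 0 \<Longrightarrow> complex_line (c *s z) = complex_line z"
proof -
  assume c: "c \<noteq> 0"
  have "d *s z = (d / c) *s (c *s z)" for d
    using c by (simp add: vec_eq_iff)
  moreover have "d *s (c *s z) = (d * c) *s z" for d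
    by (simp add: vec_eq_iff)
  ultimately show ?thesis
    unfolding complex_line_def by (metis (mono_tags, lifting) image_subset_iff rangeI subset_antisym)
qed

lemma complex_line_eqD:
  assumes "complex_line z = complex_line w"
  shows "\<exists>c. z = c *s w"
proof -
  have "1 *s z \<in> complex_line z" unfolding complex_line_def by blast
  then have "z \<in> complex_line w" using assms by (simp del: scalar_mult_eq_scaleR)
  then show ?thesis by (auto simp: complex_line_def)
qed

lemma inj_CP3_chart: "inj (CP3_chart i)"
proof (rule injI)
  fix x y assume "CP3_chart i x = CP3_chart i y"
  then obtain c where c: "affine_coords i x = c *s affine_coords i y"
    unfolding CP3_chart_def using complex_line_eqD by blast
  from arg_cong[OF c, of "\<lambda>v. v $ i"] have "c = 1" by simp
  then have "affine_coords i x = affine_coords i y"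
    using c by (simp add: vec_eq_iff)
  then show "x = y" by (metis real_coords_affine_coords)
qed

lemma complex_line_in_chart:
  assumes "z $ j \<noteq> 0"
  shows "complex_line z = CP3_chart j (real_coords j (inverse (z $ j) *s z))"
  unfolding CP3_chart_def
  by (subst affine_coords_real_coords) (use assms in \<open>simp_all add: complex_line_scale\<close>)

lemma CP3_chart_eqD:
  assumes "complex_line z = CP3_chart j y"
  shows "z = z $ j *s affine_coords j y"
proof -
  obtain c where c: "z = c *s affine_coords j y"
    using complex_line_eqD[OF assms[unfolded CP3_chart_def]] by blast
  then show ?thesis using arg_cong[OF c, of "\<lambda>v. v $ j"] by simp
qed

text \<open>Domain and inverse of a chart in homogeneous coordinates at once; overlaps and openness
  of the charts are read off from it.\<close>

lemma CP3_chart_eq_iff: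
  assumes "z \<noteq> 0"
  shows "complex_line z = CP3_chart j y \<longleftrightarrow> z $ j \<noteq> 0 \<and> y = real_coords j (inverse (z $ j) *s z)"
proof
  assume e: "complex_line z = CP3_chart j y"
  have nz: "z $ j \<noteq> 0"
    using CP3_chart_eqD[OF e] assms by (metis vector_smult_lzero)
  then show "z $ j \<noteq> 0 \<and> y = real_coords j (inverse (z $ j) *s z)"
    using e complex_line_in_chart[OF nz] inj_CP3_chart by (metis injD)
next
  assume "z $ j \<noteq> 0 \<and> y = real_coords j (inverse (z $ j) *s z)"
  then show "complex_line z = CP3_chart j y" using complex_line_in_chart by simp
qed

lemma overlap_CP3_chart: "overlap CP3_chart i j = chart_overlap i j"
  unfolding overlap_def chart_overlap_def
  using CP3_chart_eq_iff[OF affine_coords_nonzero] by (auto simp: CP3_chart_def[of i])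

lemma CP3_chart_chart_change:
  "x \<in> chart_overlap i j \<Longrightarrow> CP3_chart i x = CP3_chart j (chart_change i j x)"
  unfolding CP3_chart_def[of i] chart_change_def
  using complex_line_in_chart by (simp add: chart_overlap_def)

lemma transition_CP3_chart:
  "x \<in> chart_overlap i j \<Longrightarrow> transition CP3_chart i j x = chart_change i j x"
  by (simp add: transition_def CP3_chart_chart_change inv_f_f[OF inj_CP3_chart])

section \<open>Charts of the sheets\<close>

lemma inj_glue: "glue Q (s, p) = glue Q (s, q) \<longleftrightarrow> p = q"
  by (auto simp: glue_def split: if_splits)

lemma glue_eqD: "glue Q (s, p) = glue Q (t, q) \<Longrightarrow> p = q"
  by (auto simp: glue_def split: if_splits)

lemma inj_sheet_chart: "inj (sheet_chart Q s i)"
  unfolding sheet_chart_def[abs_def] inj_def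
  using inj_CP3_chart by (auto simp: inj_glue dest: injD)

lemma overlap_sheet_chart: "overlap (sheet_chart Q s) i j = chart_overlap i j"
  unfolding overlap_CP3_chart[symmetric] overlap_def sheet_chart_def
  by (auto simp: image_def inj_glue)

lemma transition_sheet_chart:
  assumes "x \<in> chart_overlap i j"
  shows "transition (sheet_chart Q s) i j x = chart_change i j x"
proof -
  have "sheet_chart Q s i x = sheet_chart Q s j (chart_change i j x)"
    by (simp add: sheet_chart_def CP3_chart_chart_change[OF assms])
  then show ?thesis
    by (simp add: transition_def inv_f_f[OF inj_sheet_chart])
qed

section \<open>The topology of projective space\<close>

lemma topspace_CP3: "topspace CP3 = complex_line ` (- {0})"
  by (simp add: CP3_def)

lemma openin_CP3: "openin CP3 U \<longleftrightarrow> U \<subseteq> complex_line ` (- {0}) \<and> open {z. z \<noteq> 0 \<and> complex_line z \<in> U}"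
proof -
  have "{z \<in> topspace (top_of_set (- {0})). complex_line z \<in> U} = {z. z \<noteq> 0 \<and> complex_line z \<in> U}"
    by auto
  moreover have "open (- {0 :: complex^4})" by (simp add: open_Compl)
  ultimately show ?thesis
    unfolding CP3_def openin_quotient_topology by (auto simp: openin_open_eq)
qed

lemma range_CP3_chart_subset: "range (CP3_chart i) \<subseteq> topspace CP3"
  unfolding topspace_CP3 CP3_chart_def[abs_def] by auto

lemma continuous_map_CP3_chart: "continuous_map euclidean CP3 (CP3_chart i)"
  unfolding continuous_map_def
proof (intro conjI allI impI)
  show "CP3_chart i \<in> topspace euclidean \<rightarrow> topspace CP3"
    using range_CP3_chart_subset by auto
  fix U assume "openin CP3 U"
  then have "open {z. z \<noteq> 0 \<and> complex_line z \<in> U}" by (simp add: openin_CP3)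
  then have "open (affine_coords i -` {z. z \<noteq> 0 \<and> complex_line z \<in> U})"
    by (rule open_vimage[OF _ continuous_on_affine_coords])
  then show "openin euclidean {x \<in> topspace euclidean. CP3_chart i x \<in> U}"
    by (simp add: vimage_def CP3_chart_def)
qed

text \<open>The cone over the image of \<open>V\<close> is the preimage of \<open>V\<close> under
  the continuous map Z \<mapsto> Z / Z_i on the open set where Z_i is nonzero.\<close>

lemma open_map_CP3_chart: "open_map euclidean CP3 (CP3_chart i)"
  unfolding open_map_def
proof (intro allI impI)
  fix V :: "(real^6) set" assume "openin euclidean V"
  then have V: "open V" by simp
  have "{z. z \<noteq> 0 \<and> complex_line z \<in> CP3_chart i ` V} =
      {z. z $ i \<noteq> 0} \<inter> (\<lambda>z. real_coords i (inverse (z $ i) *s z)) -` V"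
  proof (rule set_eqI)
    fix z :: "complex^4"
    have "z $ i = 0" if "z = 0" using that by simp
    then show "z \<in> {z. z \<noteq> 0 \<and> complex_line z \<in> CP3_chart i ` V} \<longleftrightarrow>
        z \<in> {z. z $ i \<noteq> 0} \<inter> (\<lambda>z. real_coords i (inverse (z $ i) *s z)) -` V"
      using CP3_chart_eq_iff[of z i] by (cases "z = 0") (auto simp: image_iff)
  qed
  moreover have "open ({z::complex^4. z $ i \<noteq> 0} \<inter> (\<lambda>z. real_coords i (inverse (z $ i) *s z)) -` V)"
  proof (rule continuous_open_preimage[OF _ _ V])
    show "open {z::complex^4. z $ i \<noteq> 0}"
      by (intro open_Collect_neq continuous_intros)
    show "continuous_on {z::complex^4. z $ i \<noteq> 0} (\<lambda>z. real_coords i (inverse (z $ i) *s z))"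
      unfolding vector_scalar_mult_def
      by (intro bounded_linear.continuous_on[OF bounded_linear_real_coords] continuous_intros) auto
  qed
  ultimately show "openin CP3 (CP3_chart i ` V)"
    using range_CP3_chart_subset[of i] by (auto simp: openin_CP3 topspace_CP3)
qed

lemma topspace_CP3_charts: "topspace CP3 = (\<Union>i. range (CP3_chart i))"
proof (rule antisym)
  show "topspace CP3 \<subseteq> (\<Union>i. range (CP3_chart i))"
  proof
    fix p assume "p \<in> topspace CP3"
    then obtain z where z: "z \<noteq> 0" "p = complex_line z" by (auto simp: topspace_CP3)
    then obtain j where "z $ j \<noteq> 0" by (auto simp: vec_eq_iff)
    then show "p \<in> (\<Union>i. range (CP3_chart i))" using z complex_line_in_chart by blast
  qed
qed (use range_CP3_chart_subset in blast)

section \<open>The topology of the glued space and of its sheets\<close>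

lemma topspace_X_Q: "topspace (X_Q Q) = glue Q ` (UNIV \<times> topspace CP3)"
  by (simp add: X_Q_def o_def)

lemma openin_X_Q:
  "openin (X_Q Q) U \<longleftrightarrow> U \<subseteq> topspace (X_Q Q) \<and> (\<forall>s. openin CP3 {p \<in> topspace CP3. glue Q (s, p) \<in> U})"
  unfolding topspace_X_Q unfolding X_Q_def openin_quotient_topology
  by (auto simp: openin_sum_topology o_def)

lemma topspace_sheet_space: "topspace (sheet_space Q s) = (\<lambda>p. glue Q (s, p)) ` topspace CP3"
  unfolding sheet_space_def topspace_subtopology topspace_X_Q by auto

lemma continuous_map_sheet: "continuous_map CP3 (sheet_space Q s) (\<lambda>p. glue Q (s, p))"
  unfolding sheet_space_def continuous_map_in_subtopology
proof
  show "continuous_map CP3 (X_Q Q) (\<lambda>p. glue Q (s, p))"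
    unfolding continuous_map_def by (auto simp: openin_X_Q topspace_X_Q)
qed auto

text \<open>The copies of \<open>V\<close> in both sheets together form an open set of the glued
  space, and it meets this sheet exactly in the copy of \<open>V\<close>.\<close>

lemma open_map_sheet: "open_map CP3 (sheet_space Q s) (\<lambda>p. glue Q (s, p))"
  unfolding open_map_def
proof (intro allI impI)
  fix V assume V: "openin CP3 V"
  define U where "U = glue Q ` (UNIV \<times> V)"
  have sub: "V \<subseteq> topspace CP3" by (rule openin_subset[OF V])
  have "{p \<in> topspace CP3. glue Q (t, p) \<in> U} = V" for t
    using sub by (auto simp: U_def dest: glue_eqD)
  then have "openin (X_Q Q) U"
    using V sub by (auto simp: openin_X_Q topspace_X_Q U_def)
  moreover have "(\<lambda>p. glue Q (s, p)) ` V = U \<inter> (\<lambda>p. glue Q (s, p)) ` topspace CP3"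
    using sub by (auto simp: U_def dest: glue_eqD)
  ultimately show "openin (sheet_space Q s) ((\<lambda>p. glue Q (s, p)) ` V)"
    unfolding sheet_space_def openin_subtopology by blast
qed

lemma smooth_on_transition_sheet: "smooth_on (transition (sheet_chart Q s) i j) (chart_overlap i j)"
  by (rule smooth_on_cong[OF smooth_on_chart_change open_chart_overlap]) (simp add: transition_sheet_chart)

text \<open>\<open>transition\<close> is unspecified off the overlap, because of \<open>inv\<close>;
  its Jacobian only depends on values on an open neighbourhood.\<close>

lemma jacobian_transform:
  assumes "(f has_derivative f') (at x)" "open S" "x \<in> S" "\<And>y. y \<in> S \<Longrightarrow> f y = g y"
  shows "jacobian g (at x) = jacobian f (at x)"
  using jacobian_eq_matrix[OF assms(1)] jacobian_eq_matrix[OF has_derivative_transform_within_open[OF assms]]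
  by simp

lemma jacobian_transition_sheet:
  assumes "x \<in> chart_overlap i j"
  shows "jacobian (transition (sheet_chart Q s) i j) (at x) = jacobian (chart_change i j) (at x)"
  by (rule jacobian_transform[OF chart_change_has_derivative[OF assms] open_chart_overlap assms])
    (simp add: transition_sheet_chart)

lemma jacobian_transition_CP3:
  assumes "x \<in> chart_overlap i j"
  shows "jacobian (transition CP3_chart i j) (at x) = jacobian (chart_change i j) (at x)"
  by (rule jacobian_transform[OF chart_change_has_derivative[OF assms] open_chart_overlap assms])
    (simp add: transition_CP3_chart)

lemma oriented_atlas_sheet: "oriented_atlas (sheet_space Q s) (sheet_chart Q s)"
  unfolding oriented_atlas_def overlap_sheet_chart
proof (intro conjI allI ballI)
  fix i
  have chart: "sheet_chart Q s i = (\<lambda>p. glue Q (s, p)) \<circ> CP3_chart i"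
    by (auto simp: sheet_chart_def)
  have op: "open_map euclidean (sheet_space Q s) (sheet_chart Q s i)"
    unfolding chart by (rule open_map_compose[OF open_map_CP3_chart open_map_sheet])
  show "embedding_map euclidean (sheet_space Q s) (sheet_chart Q s i)"
  proof (rule injective_open_imp_embedding_map[OF _ op])
    show "continuous_map euclidean (sheet_space Q s) (sheet_chart Q s i)"
      unfolding chart by (rule continuous_map_compose[OF continuous_map_CP3_chart continuous_map_sheet])
    show "inj_on (sheet_chart Q s i) (topspace euclidean)"
      using inj_sheet_chart by simp
  qed
  show "openin (sheet_space Q s) (range (sheet_chart Q s i))"
    using op by (auto simp: open_map_def)
next
  show "topspace (sheet_space Q s) = (\<Union>i. range (sheet_chart Q s i))"
    unfolding topspace_sheet_space topspace_CP3_charts by (auto simp: sheet_chart_def)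
next
  fix i j
  show "smooth_on (transition (sheet_chart Q s) i j) (chart_overlap i j)"
    by (rule smooth_on_transition_sheet)
  show "0 < det (jacobian (transition (sheet_chart Q s) i j) (at x))" if "x \<in> chart_overlap i j" for x
    using det_jacobian_chart_change_pos[OF that] jacobian_transition_sheet[OF that] by simp
qed

section \<open>The complexified tangent bundle over a sheet\<close>

lemma complexified_tangent_CP3:
  assumes "x \<in> chart_overlap i j"
  shows "complexified_tangent CP3_chart i j x = of_real_matrix (jacobian (chart_change i j) (at x))"
  by (simp add: complexified_tangent_def jacobian_transition_CP3[OF assms] vec_eq_iff)

lemma smooth_on_of_real_matrix:
  fixes f :: "'a::euclidean_space \<Rightarrow> real^'n^'m"
  assumes "open S" "\<And>r c. smooth_on (\<lambda>x. f x $ r $ c) S"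
  shows "smooth_on (\<lambda>x. of_real_matrix (f x)) S"
  unfolding of_real_matrix_def
  by (intro smooth_on_vec_lambda assms smooth_on_bounded_linear[OF assms(1) bounded_linear_of_real])

lemma smooth_on_jacobian_chart_change:
  "smooth_on (\<lambda>x. jacobian (chart_change i j) (at x) $ r $ c) (chart_overlap i j)"
  by (rule smooth_on_cong[OF smooth_on_vec_nth[OF open_chart_overlap
          smooth_on_pderiv_at[OF smooth_on_chart_change]] open_chart_overlap])
    (simp add: jacobian_eq_pderiv_at[OF open_chart_overlap _ smooth_on_chart_change])

text \<open>The cocycle identity is the chain rule, and invertibility follows from the positive real
  Jacobian determinant.\<close>

lemma vector_bundle_tangent: "vector_bundle (sheet_space Q s) (sheet_chart Q s) (complexified_tangent CP3_chart)"
  unfolding vector_bundle_def overlap_sheet_chart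
proof (intro conjI allI ballI oriented_atlas_sheet)
  fix i j
  have "smooth_on (\<lambda>x. of_real_matrix (jacobian (chart_change i j) (at x))) (chart_overlap i j)"
    by (rule smooth_on_of_real_matrix[OF open_chart_overlap smooth_on_jacobian_chart_change])
  then show "smooth_on (complexified_tangent CP3_chart i j) (chart_overlap i j)"
    by (rule smooth_on_cong[OF _ open_chart_overlap]) (simp add: complexified_tangent_CP3)
  show "invertible (complexified_tangent CP3_chart i j x)" if "x \<in> chart_overlap i j" for x
    using det_jacobian_chart_change_pos[OF that]
    by (simp add: complexified_tangent_CP3[OF that] invertible_det_nz det_of_real_matrix)
next
  fix i x
  show "complexified_tangent CP3_chart i i x = mat 1"
    by (simp add: complexified_tangent_CP3 jacobian_chart_change_self)
next
  fix i j k x assume x: "x \<in> chart_overlap i j \<inter> chart_overlap i k"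
  then show "complexified_tangent CP3_chart i k x =
      complexified_tangent CP3_chart j k (transition (sheet_chart Q s) i j x) ** complexified_tangent CP3_chart i j x"
    using chart_change_cocycle(1)[of x i j k] jacobian_chart_change_cocycle[of x i j k]
    by (simp add: complexified_tangent_CP3 transition_sheet_chart of_real_matrix_mult)
qed

section \<open>The Fubini--Study connection\<close>

definition herm :: "complex^4 \<Rightarrow> complex^4 \<Rightarrow> complex" where
  "herm u v = (\<Sum>k\<in>UNIV. u $ k * cnj (v $ k))"

lemma herm_simps:
  "herm (u + u') v = herm u v + herm u' v"
  "herm (u - u') v = herm u v - herm u' v"
  "herm (- u) v = - herm u v"
  "herm (c *s u) v = c * herm u v"
  "herm u (v + v') = herm u v + herm u v'"
  "herm u (v - v') = herm u v - herm u v'"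
  "herm u (- v) = - herm u v"
  "herm u (c *s v) = cnj c * herm u v"
  by (simp_all add: herm_def sum.distrib sum_subtractf sum_negf sum_distrib_left algebra_simps)

lemma cnj_herm: "cnj (herm u v) = herm v u"
  by (simp add: herm_def mult.commute)

lemma herm_self: "herm v v = of_real ((norm v)\<^sup>2)"
  by (simp add: herm_def norm_vec_def L2_set_def sum_nonneg complex_norm_square[symmetric] del: of_real_power)

lemma cmod_herm_le: "cmod (herm u v) \<le> norm u * norm v"
proof -
  have "cmod (herm u v) \<le> (\<Sum>k\<in>UNIV. \<bar>norm (u $ k)\<bar> * \<bar>norm (v $ k)\<bar>)"
    unfolding herm_def by (rule order_trans[OF norm_sum]) (simp add: norm_mult)
  also have "\<dots> \<le> norm u * norm v"
    unfolding norm_vec_def by (rule L2_set_mult_ineq)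
  finally show ?thesis .
qed

lemma bounded_linear_herm_left: "bounded_linear (\<lambda>u. herm u v)"
  unfolding linear_conv_bounded_linear[symmetric] linear_iff
  by (simp add: herm_simps) (simp add: herm_def scaleR_sum_right)

lemma bounded_linear_herm_right: "bounded_linear (\<lambda>v. herm u v)"
  unfolding linear_conv_bounded_linear[symmetric] linear_iff
  by (simp add: herm_simps) (simp add: herm_def scaleR_sum_right)

text \<open>The Christoffel symbols of the Fubini--Study metric at the point with homogeneous coordinates
  \<open>Z\<close>; tangent vectors are vectors of \<open>\<complex>\<^sup>4\<close> with vanishing \<open>i\<close>-th entry in the chart \<open>Z\<^sub>i = 1\<close>.\<close>

definition fs_christoffel :: "complex^4 \<Rightarrow> complex^4 \<Rightarrow> complex^4 \<Rightarrow> complex^4" where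
  "fs_christoffel Z u v = - (inverse (herm Z Z) *s (herm u Z *s v + herm v Z *s u))"

text \<open>The second term removes the component along \<open>Z\<close>, so the form depends on
  \<open>u\<close> and \<open>v\<close> only modulo \<open>Z\<close>.\<close>

definition fs_metric :: "complex^4 \<Rightarrow> complex^4 \<Rightarrow> complex^4 \<Rightarrow> complex" where
  "fs_metric Z u v = herm u v * inverse (herm Z Z) - herm u Z * herm Z v * (inverse (herm Z Z))\<^sup>2"

definition fs_matrix :: "4 \<Rightarrow> 6 \<Rightarrow> real^6 \<Rightarrow> real^6^6" where
  "fs_matrix i k x = matrix (\<lambda>v. real_coords i
     (fs_christoffel (affine_coords i x) (hom_dir i (axis k 1)) (hom_dir i v)))"

definition fs_connection :: "4 \<Rightarrow> 6 \<Rightarrow> real^6 \<Rightarrow> complex^6^6" where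
  "fs_connection i k x = of_real_matrix (fs_matrix i k x)"

definition fs_metric_matrix :: "4 \<Rightarrow> real^6 \<Rightarrow> real^6^6" where
  "fs_metric_matrix i x = (\<chi> r c. Re (fs_metric (affine_coords i x) (hom_dir i (axis r 1)) (hom_dir i (axis c 1))))"

lemma smooth_on_herm_affine:
  assumes "open S"
  shows "smooth_on (\<lambda>x. herm u (affine_coords i x)) S" "smooth_on (\<lambda>x. herm (affine_coords i x) v) S"
    "smooth_on (\<lambda>x. inverse (herm (affine_coords i x) (affine_coords i x))) S"
proof -
  note c = smooth_on_vec_nth[OF assms smooth_on_affine_coords[OF assms]]
  show "smooth_on (\<lambda>x. herm u (affine_coords i x)) S" "smooth_on (\<lambda>x. herm (affine_coords i x) v) S"
    unfolding herm_def
    by (intro smooth_on_sum smooth_on_mult smooth_on_const assms c smooth_on_bounded_linear[OF assms bounded_linear_cnj])+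
  have "smooth_on (\<lambda>x. herm (affine_coords i x) (affine_coords i x)) S"
    unfolding herm_def
    by (intro smooth_on_sum smooth_on_mult smooth_on_const assms c smooth_on_bounded_linear[OF assms bounded_linear_cnj])
  then show "smooth_on (\<lambda>x. inverse (herm (affine_coords i x) (affine_coords i x))) S"
    by (rule smooth_on_inverse[OF assms]) (simp add: herm_self)
qed

lemma smooth_on_fs_connection: "smooth_on (fs_connection i k) UNIV"
  unfolding fs_connection_def[abs_def]
proof (rule smooth_on_of_real_matrix[OF open_UNIV])
  fix r c
  have "smooth_on (\<lambda>x. fs_christoffel (affine_coords i x) u v) UNIV" for u v
  proof -
    have "smooth_on (\<lambda>x. \<chi> m. - (inverse (herm (affine_coords i x) (affine_coords i x)) *
        (herm u (affine_coords i x) * v $ m + herm v (affine_coords i x) * u $ m))) UNIV"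
      by (intro smooth_on_vec_lambda smooth_on_minus smooth_on_mult smooth_on_add smooth_on_const
          smooth_on_herm_affine open_UNIV)
    then show ?thesis
      by (rule smooth_on_cong) (simp_all add: fs_christoffel_def vec_eq_iff algebra_simps)
  qed
  then show "smooth_on (\<lambda>x. fs_matrix i k x $ r $ c) UNIV"
    unfolding fs_matrix_def matrix_def
    by (simp add: smooth_on_vec_nth smooth_on_bounded_linear[OF open_UNIV bounded_linear_real_coords])
qed

lemma linear_fs:
  "linear (\<lambda>v. real_coords i (fs_christoffel Z u (hom_dir i v)))"
  "linear (\<lambda>u. real_coords i (fs_christoffel Z (hom_dir i u) v))"
proof -
  have 1: "fs_christoffel Z u (v + w) = fs_christoffel Z u v + fs_christoffel Z u w"
    "fs_christoffel Z (v + w) u = fs_christoffel Z v u + fs_christoffel Z w u" for u v w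
    by (simp_all add: fs_christoffel_def herm_simps vec_eq_iff algebra_simps)
  have 2: "fs_christoffel Z u (c *\<^sub>R v) = c *\<^sub>R fs_christoffel Z u v"
    "fs_christoffel Z (c *\<^sub>R v) u = c *\<^sub>R fs_christoffel Z v u" for u v c
  proof -
    have c: "c *\<^sub>R v = complex_of_real c *s v" for v :: "complex^4"
      by (simp add: vec_eq_iff scaleR_conv_of_real[where 'a=complex])
    show "fs_christoffel Z u (c *\<^sub>R v) = c *\<^sub>R fs_christoffel Z u v"
      "fs_christoffel Z (c *\<^sub>R v) u = c *\<^sub>R fs_christoffel Z v u"
      unfolding c by (simp_all add: fs_christoffel_def herm_simps vec_eq_iff algebra_simps)
  qed
  show "linear (\<lambda>v. real_coords i (fs_christoffel Z u (hom_dir i v)))"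
    "linear (\<lambda>u. real_coords i (fs_christoffel Z (hom_dir i u) v))"
    unfolding linear_iff
    by (simp_all add: linear_simps[OF bounded_linear_hom_dir] linear_simps[OF bounded_linear_real_coords] 1 2)
qed

lemma linear_axis_expansion:
  fixes f :: "real^6 \<Rightarrow> 'b::real_vector"
  assumes "linear f"
  shows "(\<Sum>l\<in>UNIV. w $ l *\<^sub>R f (axis l 1)) = f w"
proof -
  have "f w = f (\<Sum>l\<in>UNIV. w $ l *\<^sub>R axis l 1)"
    by (simp add: basis_expansion scalar_mult_eq_scaleR[symmetric])
  then show ?thesis
    using assms by (simp add: linear_sum linear_scale)
qed

section \<open>Transformation law of the Christoffel symbols\<close>

lemma chart_change_deriv_self [simp]: "x \<in> chart_overlap i j \<Longrightarrow> chart_change_deriv i j x v $ j = 0"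
  by (simp add: chart_change_deriv_def chart_overlap_def power2_eq_square)

lemma hom_dir_chart_change_deriv:
  "x \<in> chart_overlap i j \<Longrightarrow> hom_dir j (real_coords j (chart_change_deriv i j x v)) = chart_change_deriv i j x v"
  by (simp add: hom_dir_real_coords axis_def vec_eq_iff)

text \<open>The second derivative of Z / Z_j as a symmetric bilinear map; it is the inhomogeneous
  term of the transformation law.\<close>

definition chart_change_deriv2 :: "4 \<Rightarrow> 4 \<Rightarrow> real^6 \<Rightarrow> complex^4 \<Rightarrow> complex^4 \<Rightarrow> complex^4" where
  "chart_change_deriv2 i j x u v = (let s = inverse (affine_coords i x $ j) in
     (2 * s ^ 3 * u $ j * v $ j) *s affine_coords i x - s\<^sup>2 *s (u $ j *s v + v $ j *s u))"

lemma chart_change_deriv_has_derivative: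
  assumes "x \<in> chart_overlap i j"
  shows "((\<lambda>x. chart_change_deriv i j x v) has_derivative (\<lambda>u. chart_change_deriv2 i j x (hom_dir i u) v)) (at x)"
proof -
  let ?Z = "affine_coords i x"
  have Z: "((\<lambda>x. affine_coords i x $ k) has_derivative (\<lambda>u. hom_dir i u $ k)) (at x)" for k
    by (rule bounded_linear.has_derivative[OF bounded_linear_vec_nth affine_coords_has_derivative])
  have nz: "?Z $ j \<noteq> 0" using assms by (simp add: chart_overlap_def)
  note s = Deriv.has_derivative_inverse[OF nz Z]
  have "((\<lambda>x. inverse (affine_coords i x $ j) * v $ k - (v $ j * (inverse (affine_coords i x $ j) * inverse (affine_coords i x $ j))) * affine_coords i x $ k)
      has_derivative (\<lambda>u. chart_change_deriv2 i j x (hom_dir i u) v $ k)) (at x)" for k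
    by (rule has_derivative_eq_rhs, (rule has_derivative_diff has_derivative_mult has_derivative_const s Z)+)
      (simp add: chart_change_deriv2_def Let_def fun_eq_iff algebra_simps power2_eq_square power3_eq_cube)
  from has_derivative_vec_lambda[where f' = "\<lambda>k u. chart_change_deriv2 i j x (hom_dir i u) v $ k", OF this] show ?thesis
    by (simp add: chart_change_deriv_def vector_scalar_mult_def power2_eq_square minus_vec_def)
qed

text \<open>The one-form herm w Z / N is the holomorphic derivative of log N. Passing from Z to Z /
  Z_j subtracts the derivative of log Z_j from it, which is fact \<open>r\<close>, and this shift is
  what the second derivative of the chart change compensates.\<close>

lemma fs_christoffel_transform:
  assumes "Z \<noteq> 0" "Z = affine_coords i x" "x \<in> chart_overlap i j"
  shows "fs_christoffel (inverse (Z $ j) *s Z) (chart_change_deriv i j x u) (chart_change_deriv i j x v) +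
    chart_change_deriv2 i j x u v = chart_change_deriv i j x (fs_christoffel Z u v)"
proof -
  define N s where "N = herm Z Z" and "s = inverse (Z $ j)"
  have nz: "N \<noteq> 0" "s \<noteq> 0"
    using assms by (auto simp: N_def s_def herm_self chart_overlap_def)
  have h: "herm (chart_change_deriv i j x w) (s *s Z) = s * cnj s * (herm w Z - w $ j * s * N)" for w
    unfolding chart_change_deriv_def assms(2)[symmetric] s_def[symmetric]
    by (simp add: herm_simps N_def[symmetric] power2_eq_square algebra_simps)
  have r: "inverse (herm (s *s Z) (s *s Z)) * herm (chart_change_deriv i j x w) (s *s Z) = herm w Z / N - w $ j * s" for w
    unfolding h using nz by (simp add: herm_simps N_def[symmetric] field_simps)
  have l: "fs_christoffel (s *s Z) (chart_change_deriv i j x u) (chart_change_deriv i j x v) =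
      - ((herm u Z / N - u $ j * s) *s chart_change_deriv i j x v + (herm v Z / N - v $ j * s) *s chart_change_deriv i j x u)"
    unfolding fs_christoffel_def r[symmetric] by (simp add: vec_eq_iff algebra_simps)
  show ?thesis
    unfolding s_def[symmetric] l
    unfolding chart_change_deriv_def chart_change_deriv2_def fs_christoffel_def
      assms(2)[symmetric] Let_def N_def[symmetric]
    unfolding s_def[symmetric]
    using nz by (simp add: vec_eq_iff divide_inverse algebra_simps power2_eq_square power3_eq_cube)
qed

lemma fs_matrix_works:
  "fs_matrix i k x *v v = real_coords i (fs_christoffel (affine_coords i x) (hom_dir i (axis k 1)) (hom_dir i v))"
  unfolding fs_matrix_def by (rule matrix_works[OF linear_fs(1)[of i, unfolded linear_matrix_vector_mul_eq[symmetric]]])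

lemma sum_scaleR_matrix_vector_mult:
  fixes M :: "'i \<Rightarrow> real^'n^'m"
  shows "(\<Sum>l\<in>I. c l *\<^sub>R M l) *v w = (\<Sum>l\<in>I. c l *\<^sub>R (M l *v w))"
  by (induction I rule: infinite_finite_induct)
    (simp_all add: matrix_vector_mult_add_rdistrib scaleR_matrix_vector_assoc)

text \<open>Evaluated on basis vectors, the three matrix terms become the three terms of
  \<open>fs_christoffel_transform\<close>.\<close>

lemma fs_connection_real:
  assumes x: "x \<in> chart_overlap i j"
  defines "J \<equiv> \<lambda>x. jacobian (chart_change i j) (at x)"
  shows "(\<Sum>l\<in>UNIV. J x $ l $ k *\<^sub>R fs_matrix j l (chart_change i j x)) ** J x +
    (\<chi> r c. pderiv_at k (\<lambda>x. J x $ r $ c) x) = J x ** fs_matrix i k x"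
proof -
  let ?D = "\<lambda>x u. real_coords j (chart_change_deriv i j x (hom_dir i u))"
  let ?Z = "affine_coords i x" and ?y = "chart_change i j x"
  have linD: "linear (?D y)" if "y \<in> chart_overlap i j" for y
    by (rule has_derivative_linear[OF chart_change_has_derivative[OF that]])
  have J: "J y *v u = ?D y u" if "y \<in> chart_overlap i j" for y u
    unfolding J_def jacobian_chart_change[OF that] by (rule matrix_works[OF linD[OF that, unfolded linear_matrix_vector_mul_eq[symmetric]]])
  have Jnth: "J y $ r $ c = ?D y (axis c 1) $ r" if "y \<in> chart_overlap i j" for y r c
    unfolding J_def jacobian_chart_change[OF that] by (simp add: matrix_def)
  have col: "(\<Sum>l\<in>UNIV. J x $ l $ k *\<^sub>R fs_matrix j l ?y) *v w =
      real_coords j (fs_christoffel (affine_coords j ?y) (chart_change_deriv i j x (hom_dir i (axis k 1))) (hom_dir j w))" for w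
  proof -
    have "(\<Sum>l\<in>UNIV. J x $ l $ k *\<^sub>R fs_matrix j l ?y) *v w =
        (\<Sum>l\<in>UNIV. ?D x (axis k 1) $ l *\<^sub>R (fs_matrix j l ?y *v w))"
      unfolding sum_scaleR_matrix_vector_mult by (simp add: Jnth[OF x])
    also have "\<dots> = real_coords j (fs_christoffel (affine_coords j ?y) (hom_dir j (?D x (axis k 1))) (hom_dir j w))"
      unfolding fs_matrix_works by (rule linear_axis_expansion[OF linear_fs(2)])
    finally show ?thesis by (simp add: hom_dir_chart_change_deriv[OF x])
  qed
  have dJ: "(\<chi> r c. pderiv_at k (\<lambda>x. J x $ r $ c) x) *v axis c 1 =
      real_coords j (chart_change_deriv2 i j x (hom_dir i (axis k 1)) (hom_dir i (axis c 1)))" for c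
  proof -
    have "pderiv_at k (\<lambda>x. J x $ r $ c) x =
        real_coords j (chart_change_deriv2 i j x (hom_dir i (axis k 1)) (hom_dir i (axis c 1))) $ r" for r
    proof (rule pderiv_at_eq[of _ "\<lambda>u. real_coords j (chart_change_deriv2 i j x (hom_dir i u) (hom_dir i (axis c 1))) $ r"])
      have "((\<lambda>y. ?D y (axis c 1) $ r) has_derivative (\<lambda>u. real_coords j (chart_change_deriv2 i j x (hom_dir i u) (hom_dir i (axis c 1))) $ r)) (at x)"
        by (intro bounded_linear.has_derivative[OF bounded_linear_vec_nth]
            bounded_linear.has_derivative[OF bounded_linear_real_coords] chart_change_deriv_has_derivative x)
      then show "((\<lambda>x. J x $ r $ c) has_derivative (\<lambda>u. real_coords j (chart_change_deriv2 i j x (hom_dir i u) (hom_dir i (axis c 1))) $ r)) (at x)"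
        by (rule has_derivative_transform_within_open[OF _ open_chart_overlap x]) (simp add: Jnth)
    qed
    then show ?thesis
      by (simp add: vec_eq_iff matrix_vector_mult_basis column_def)
  qed
  have "((\<Sum>l\<in>UNIV. J x $ l $ k *\<^sub>R fs_matrix j l ?y) ** J x + (\<chi> r c. pderiv_at k (\<lambda>x. J x $ r $ c) x)) *v axis c 1 =
      (J x ** fs_matrix i k x) *v axis c 1" for c
  proof -
    let ?E = "hom_dir i (axis k 1)" and ?C = "hom_dir i (axis c 1)"
    \<comment> \<open>Both directions have vanishing \<open>i\<close>-th entry, hence so has the
      Christoffel vector, and real coordinates lose nothing of it.\<close>
    have i0: "hom_dir i (real_coords i (fs_christoffel ?Z ?E ?C)) = fs_christoffel ?Z ?E ?C"
      by (simp add: hom_dir_real_coords fs_christoffel_def axis_def vec_eq_iff)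
    have "((\<Sum>l\<in>UNIV. J x $ l $ k *\<^sub>R fs_matrix j l ?y) ** J x + (\<chi> r c. pderiv_at k (\<lambda>x. J x $ r $ c) x)) *v axis c 1 =
        real_coords j (fs_christoffel (affine_coords j ?y) (chart_change_deriv i j x ?E) (chart_change_deriv i j x ?C) +
          chart_change_deriv2 i j x ?E ?C)"
      by (simp add: matrix_vector_mult_add_rdistrib matrix_vector_mul_assoc[symmetric] J[OF x] col dJ
          hom_dir_chart_change_deriv[OF x] linear_simps[OF bounded_linear_real_coords])
    also have "\<dots> = real_coords j (chart_change_deriv i j x (fs_christoffel ?Z ?E ?C))"
      unfolding affine_coords_chart_change[OF x]
      by (simp only: fs_christoffel_transform[OF affine_coords_nonzero refl x])
    also have "\<dots> = (J x ** fs_matrix i k x) *v axis c 1"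
      by (simp add: matrix_vector_mul_assoc[symmetric] fs_matrix_works J[OF x] i0)
    finally show ?thesis .
  qed
  then show ?thesis
    by (simp add: matrix_vector_mult_basis vec_eq_iff column_def)
qed

text \<open>Besides being the reference point of the transgression, this is the existence half of
  the description in \<open>ch3_integral\<close>.\<close>

lemma connection_fs: "connection (sheet_space Q s) (sheet_chart Q s) (complexified_tangent CP3_chart) fs_connection"
  unfolding connection_def overlap_sheet_chart
proof (intro conjI allI ballI vector_bundle_tangent smooth_on_fs_connection)
  fix i j k x assume x: "x \<in> chart_overlap i j"
  let ?J = "\<lambda>x. jacobian (chart_change i j) (at x)"
  note sJ = smooth_on_jacobian_chart_change[of i j]
  have sJ': "smooth_on (\<lambda>x. of_real_matrix (?J x)) (chart_overlap i j)"
    by (rule smooth_on_of_real_matrix[OF open_chart_overlap sJ])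
  have "pderiv_at k (complexified_tangent CP3_chart i j) x = pderiv_at k (\<lambda>x. of_real_matrix (?J x)) x"
    by (rule pderiv_at_cong[OF sJ' open_chart_overlap x, symmetric]) (simp add: complexified_tangent_CP3)
  also have "\<dots> = of_real_matrix (\<chi> r c. pderiv_at k (\<lambda>x. ?J x $ r $ c) x)"
  proof -
    have bl: "bounded_linear (\<lambda>M :: complex^6^6. M $ r $ c)" for r c
      using bounded_linear_compose[OF bounded_linear_vec_nth bounded_linear_vec_nth] .
    have "pderiv_at k (\<lambda>x. of_real_matrix (?J x)) x $ r $ c = complex_of_real (pderiv_at k (\<lambda>x. ?J x $ r $ c) x)" for r c
      using pderiv_at_bounded_linear[OF open_chart_overlap x bl sJ', of k r c]
        pderiv_at_bounded_linear[OF open_chart_overlap x bounded_linear_of_real[where 'a=complex] sJ, of k r c]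
      by simp
    then show ?thesis by (simp add: vec_eq_iff)
  qed
  finally have dg: "pderiv_at k (complexified_tangent CP3_chart i j) x = of_real_matrix (\<chi> r c. pderiv_at k (\<lambda>x. ?J x $ r $ c) x)" .
  have sum: "(\<Sum>l\<in>UNIV. ?J x $ l $ k *\<^sub>R fs_connection j l y) = of_real_matrix (\<Sum>l\<in>UNIV. ?J x $ l $ k *\<^sub>R fs_matrix j l y)" for y
    by (simp add: fs_connection_def vec_eq_iff scaleR_conv_of_real[where 'a=complex])
  show "(\<Sum>l\<in>UNIV. jacobian (transition (sheet_chart Q s) i j) (at x) $ l $ k *\<^sub>R
      fs_connection j l (transition (sheet_chart Q s) i j x)) ** complexified_tangent CP3_chart i j x +
      pderiv_at k (complexified_tangent CP3_chart i j) x =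
      complexified_tangent CP3_chart i j x ** fs_connection i k x"
    unfolding jacobian_transition_sheet[OF x] transition_sheet_chart[OF x] sum dg complexified_tangent_CP3[OF x]
      fs_connection_def[of i] of_real_matrix_mult[symmetric] of_real_matrix_add[symmetric] fs_connection_real[OF x] ..
qed

section \<open>Metric compatibility and skewness of the curvature\<close>

text \<open>The integrability condition of a parallel form: the two mixed second derivatives of
  \<open>H\<close> agree, their terms with \<open>H\<close> between two connection matrices are
  symmetric and cancel, and the rest is the claim. \<open>transpose\<close> appears rather than the
  adjoint because \<open>H\<close> acts as a complex bilinear form.\<close>

lemma curvature_skew_of_parallel:
  fixes A :: "6 \<Rightarrow> real^6 \<Rightarrow> complex^'n^'n"
  assumes A: "\<And>k. smooth_on (A k) UNIV" and H: "smooth_on H UNIV"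
    and parallel: "\<And>k x. pderiv_at k H x = H x ** A k x + transpose (A k x) ** H x"
  shows "H x ** curvature A k l x = - (transpose (curvature A k l x) ** H x)"
proof -
  have bl: "bounded_linear (transpose :: complex^'n^'n \<Rightarrow> complex^'n^'n)"
    unfolding linear_conv_bounded_linear[symmetric] linear_iff by (simp add: transpose_def vec_eq_iff)
  have tA: "smooth_on (\<lambda>x. transpose (A k x)) UNIV" for k
    by (rule smooth_on_bounded_linear[OF open_UNIV bl A])
  note HA = smooth_on_matrix_mult[OF open_UNIV H A] and AH = smooth_on_matrix_mult[OF open_UNIV tA H]
  have "pderiv_at k H = (\<lambda>x. H x ** A k x + transpose (A k x) ** H x)" for k
    using parallel by auto
  then have d: "pderiv_at k (pderiv_at l H) x = H x ** pderiv_at k (A l) x + (H x ** A k x + transpose (A k x) ** H x) ** A l x +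
      (transpose (A l x) ** (H x ** A k x + transpose (A k x) ** H x) + transpose (pderiv_at k (A l) x) ** H x)" for k l
    by (simp add: pderiv_at_add[OF open_UNIV UNIV_I HA AH] pderiv_at_matrix_mult[OF open_UNIV UNIV_I H A]
        pderiv_at_matrix_mult[OF open_UNIV UNIV_I tA H] pderiv_at_bounded_linear[OF open_UNIV UNIV_I bl A])
  have "pderiv_at k (pderiv_at l H) x = pderiv_at l (pderiv_at k H) x"
    by (rule pderiv_at_commute[OF H open_UNIV UNIV_I])
  then show ?thesis
    unfolding d curvature_def
    by (simp add: matrix_bilinear_simps matrix_mul_assoc linear_simps[OF bl] matrix_transpose_mul algebra_simps)
qed

lemma fs_metric_simps:
  "fs_metric Z (u + u') v = fs_metric Z u v + fs_metric Z u' v"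
  "fs_metric Z (c *s u) v = c * fs_metric Z u v"
  "fs_metric Z (- u) v = - fs_metric Z u v"
  "fs_metric Z u (v + v') = fs_metric Z u v + fs_metric Z u v'"
  "fs_metric Z u (c *s v) = cnj c * fs_metric Z u v"
  "fs_metric Z u (- v) = - fs_metric Z u v"
  by (simp_all add: fs_metric_def herm_simps algebra_simps)

text \<open>Metric compatibility. After expansion both sides are the same polynomial in the values
  of \<open>herm\<close> and in \<open>m\<close>, which is real and therefore passes through
  conjugation.\<close>

lemma fs_metric_has_derivative:
  "((\<lambda>x. fs_metric (affine_coords i x) u v) has_derivative
    (\<lambda>e. fs_metric (affine_coords i x) (fs_christoffel (affine_coords i x) (hom_dir i e) u) v +
      fs_metric (affine_coords i x) u (fs_christoffel (affine_coords i x) (hom_dir i e) v))) (at x)"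
proof -
  let ?Z = "affine_coords i x"
  have l: "((\<lambda>x. herm (affine_coords i x) w) has_derivative (\<lambda>e. herm (hom_dir i e) w)) (at x)"
    and r: "((\<lambda>x. herm w (affine_coords i x)) has_derivative (\<lambda>e. herm w (hom_dir i e))) (at x)" for w
    by (rule bounded_linear.has_derivative[OF bounded_linear_herm_left affine_coords_has_derivative],
        rule bounded_linear.has_derivative[OF bounded_linear_herm_right affine_coords_has_derivative])
  have bb: "bounded_bilinear herm"
    unfolding bilinear_conv_bounded_bilinear[symmetric] bilinear_def
    using bounded_linear_herm_left bounded_linear_herm_right by (simp add: linear_conv_bounded_linear)
  have N: "((\<lambda>x. herm (affine_coords i x) (affine_coords i x)) has_derivative
      (\<lambda>e. herm ?Z (hom_dir i e) + herm (hom_dir i e) ?Z)) (at x)"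
    by (rule bounded_bilinear.FDERIV[OF bb affine_coords_has_derivative affine_coords_has_derivative])
  have nz: "herm ?Z ?Z \<noteq> 0" by (simp add: herm_self)
  note n = Deriv.has_derivative_inverse[OF nz N]
  define m where "m = inverse (herm ?Z ?Z)"
  have m: "cnj m = m" by (simp add: m_def cnj_herm)
  show ?thesis
    unfolding fs_metric_def[of "affine_coords i _"] power2_eq_square
    by (rule has_derivative_eq_rhs, (rule has_derivative_diff has_derivative_mult has_derivative_const n l r)+)
      (simp add: fs_metric_simps fs_christoffel_def fun_eq_iff m_def[symmetric] m cnj_herm,
       simp add: fs_metric_def m_def[symmetric] herm_simps m cnj_herm algebra_simps power2_eq_square)
qed

lemma linear_fs_metric:
  "linear (\<lambda>v. Re (fs_metric Z u (hom_dir i v)))" "linear (\<lambda>u. Re (fs_metric Z (hom_dir i u) v))"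
proof -
  have c: "c *\<^sub>R v = complex_of_real c *s v" for v :: "complex^4" and c
    by (simp add: vec_eq_iff scaleR_conv_of_real[where 'a=complex])
  show "linear (\<lambda>v. Re (fs_metric Z u (hom_dir i v)))" "linear (\<lambda>u. Re (fs_metric Z (hom_dir i u) v))"
    unfolding linear_iff
    by (simp_all add: linear_simps[OF bounded_linear_hom_dir] fs_metric_simps c del: scalar_mult_eq_scaleR)
qed

text \<open>By linearity, contracting the metric with a column of \<open>fs_matrix\<close> evaluates
  it on a Christoffel vector; this turns metric compatibility into matrix form.\<close>

lemma fs_parallel:
  "pderiv_at k (\<lambda>x. fs_metric_matrix i x $ r $ c) x =
    (fs_metric_matrix i x ** fs_matrix i k x + transpose (fs_matrix i k x) ** fs_metric_matrix i x) $ r $ c"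
proof -
  let ?Z = "affine_coords i x"
  let ?e = "\<lambda>m. hom_dir i (axis m 1)"
  have i0: "hom_dir i (real_coords i (fs_christoffel ?Z (?e k) (?e m))) = fs_christoffel ?Z (?e k) (?e m)" for m
    by (simp add: hom_dir_real_coords fs_christoffel_def axis_def vec_eq_iff)
  have a: "fs_matrix i k x $ m $ c = real_coords i (fs_christoffel ?Z (?e k) (?e c)) $ m" for m c
    by (simp add: fs_matrix_def matrix_def)
  have 1: "(fs_metric_matrix i x ** fs_matrix i k x) $ r $ c = Re (fs_metric ?Z (?e r) (fs_christoffel ?Z (?e k) (?e c)))"
    using linear_axis_expansion[OF linear_fs_metric(1)[of ?Z "?e r" i], of "real_coords i (fs_christoffel ?Z (?e k) (?e c))"]
    by (simp add: matrix_matrix_mult_def a fs_metric_matrix_def i0 mult.commute)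
  have 2: "(transpose (fs_matrix i k x) ** fs_metric_matrix i x) $ r $ c = Re (fs_metric ?Z (fs_christoffel ?Z (?e k) (?e r)) (?e c))"
    using linear_axis_expansion[OF linear_fs_metric(2)[of ?Z i "?e c"], of "real_coords i (fs_christoffel ?Z (?e k) (?e r))"]
    by (simp add: matrix_matrix_mult_def transpose_def a fs_metric_matrix_def i0 mult.commute)
  have "pderiv_at k (\<lambda>x. fs_metric_matrix i x $ r $ c) x =
      Re (fs_metric ?Z (fs_christoffel ?Z (?e k) (?e r)) (?e c) + fs_metric ?Z (?e r) (fs_christoffel ?Z (?e k) (?e c)))"
    unfolding fs_metric_matrix_def
    by (simp only: vec_lambda_beta)
      (rule pderiv_at_eq[OF bounded_linear.has_derivative[OF bounded_linear_Re fs_metric_has_derivative]])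
  then show ?thesis by (simp add: 1 2)
qed

lemma smooth_on_fs_metric_matrix: "smooth_on (\<lambda>x. fs_metric_matrix i x $ r $ c) UNIV"
  unfolding fs_metric_matrix_def fs_metric_def power2_eq_square
  by (simp only: vec_lambda_beta, intro smooth_on_bounded_linear[OF open_UNIV bounded_linear_Re] smooth_on_diff smooth_on_mult
      smooth_on_const smooth_on_herm_affine open_UNIV)

text \<open>Positive definiteness from Cauchy--Schwarz: Z is the axis vector plus w, and a tangent
  vector U is orthogonal to the axis. A null vector would satisfy |U|^2 (1 + |w|^2) \<le> |U|^2
  |w|^2.\<close>

lemma invertible_fs_metric_matrix: "invertible (fs_metric_matrix i x)"
proof -
  let ?Z = "affine_coords i x" and ?H = "fs_metric_matrix i x"
  have "u = 0" if u: "?H *v u = 0" for u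
  proof (rule ccontr)
    assume "u \<noteq> 0"
    define U where "U = hom_dir i u"
    have "U \<noteq> 0"
      unfolding U_def using \<open>u \<noteq> 0\<close> real_coords_hom_dir[of i u] linear_simps(3)[OF bounded_linear_real_coords] by metis
    have "(?H *v u) $ r = Re (fs_metric ?Z (hom_dir i (axis r 1)) U)" for r
      using linear_axis_expansion[OF linear_fs_metric(1)[of ?Z "hom_dir i (axis r 1)" i], of u]
      by (simp add: matrix_vector_mult_def fs_metric_matrix_def U_def mult.commute)
    then have "u \<bullet> (?H *v u) = Re (fs_metric ?Z U U)"
      using linear_axis_expansion[OF linear_fs_metric(2)[of ?Z i U], of u]
      by (simp add: inner_vec_def U_def)
    then have 0: "Re (fs_metric ?Z U U) = 0" using u by simp
    let ?w = "hom_dir i x"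
    have ha: "herm U (axis i 1) = 0"
      by (simp add: herm_def axis_def U_def if_distrib[of cnj] if_distrib[of "\<lambda>z. _ * z"] cong: if_cong)
    have hb: "herm ?w (axis i 1) = 0"
      by (simp add: herm_def axis_def if_distrib[of cnj] if_distrib[of "\<lambda>z. _ * z"] cong: if_cong)
    have hUZ: "herm U ?Z = herm U ?w"
      by (simp add: affine_coords_conv herm_simps ha)
    have hbb: "herm (axis i 1) ?w = 0" using hb cnj_herm[of ?w "axis i 1"] by simp
    have h1: "herm (axis i 1) (axis i 1) = 1"
      unfolding herm_self by (simp add: norm_axis)
    have hZZ: "herm ?Z ?Z = of_real (1 + (norm ?w)\<^sup>2)"
      unfolding affine_coords_conv herm_simps hb hbb h1 herm_self[of ?w] by simp
    define N where "N = 1 + (norm ?w)\<^sup>2"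
    have N: "N > 0" by (simp add: N_def add_pos_nonneg)
    have "fs_metric ?Z U U = of_real ((norm U)\<^sup>2 / N - (cmod (herm U ?w))\<^sup>2 / N\<^sup>2)"
    proof -
      have "herm U ?Z * herm ?Z U = of_real ((cmod (herm U ?w))\<^sup>2)"
        unfolding complex_norm_square hUZ[symmetric] cnj_herm ..
      then show ?thesis
        unfolding fs_metric_def hZZ N_def[symmetric] herm_self[of U] by (simp add: divide_inverse power_inverse)
    qed
    then have "(norm U)\<^sup>2 / N - (cmod (herm U ?w))\<^sup>2 / N\<^sup>2 = 0" using 0 by simp
    then have "(norm U)\<^sup>2 * N = (cmod (herm U ?w))\<^sup>2"
      using N by (simp add: field_simps power2_eq_square)
    also have "\<dots> \<le> (norm U * norm ?w)\<^sup>2"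
      by (intro power_mono cmod_herm_le) simp
    finally have "(norm U)\<^sup>2 \<le> 0" by (simp add: N_def algebra_simps power_mult_distrib)
    then show False using \<open>U \<noteq> 0\<close> by simp
  qed
  then have "inj ((*v) ?H)"
    by (simp add: matrix_left_invertible_injective[symmetric] matrix_left_invertible_ker)
  then show ?thesis
    by (metis invertible_left_inverse matrix_left_invertible_injective)
qed

lemma ch3_form_fs_connection: "ch3_form (fs_connection i) x = 0"
proof -
  define H where "H x = of_real_matrix (fs_metric_matrix i x)" for x
  have H: "smooth_on H UNIV"
    unfolding H_def by (rule smooth_on_of_real_matrix[OF open_UNIV smooth_on_fs_metric_matrix])
  have "pderiv_at k H x = H x ** fs_connection i k x + transpose (fs_connection i k x) ** H x" for k x
  proof -
    have bl: "bounded_linear (\<lambda>M :: complex^6^6. M $ r $ c)" for r c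
      using bounded_linear_compose[OF bounded_linear_vec_nth bounded_linear_vec_nth] .
    have "pderiv_at k H x $ r $ c = complex_of_real (pderiv_at k (\<lambda>x. fs_metric_matrix i x $ r $ c) x)" for r c
      using pderiv_at_bounded_linear[OF open_UNIV UNIV_I bl H, of k r c]
        pderiv_at_bounded_linear[OF open_UNIV UNIV_I bounded_linear_of_real[where 'a=complex] smooth_on_fs_metric_matrix, of k i r c]
      by (simp add: H_def)
    then have "pderiv_at k H x = of_real_matrix (fs_metric_matrix i x ** fs_matrix i k x + transpose (fs_matrix i k x) ** fs_metric_matrix i x)"
      by (simp add: vec_eq_iff fs_parallel)
    also have "\<dots> = H x ** fs_connection i k x + of_real_matrix (transpose (fs_matrix i k x)) ** H x"
      unfolding H_def fs_connection_def of_real_matrix_add of_real_matrix_mult ..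
    also have "of_real_matrix (transpose (fs_matrix i k x)) = transpose (fs_connection i k x)"
      by (simp add: fs_connection_def transpose_def vec_eq_iff)
    finally show ?thesis .
  qed
  from curvature_skew_of_parallel[OF smooth_on_fs_connection H this]
  have skew: "H x ** curvature (fs_connection i) k l x = - (transpose (curvature (fs_connection i) k l x) ** H x)" for k l .
  have "invertible (H x)"
    using invertible_fs_metric_matrix[of i x] unfolding H_def by (simp add: invertible_det_nz det_of_real_matrix)
  from altsum_trace_skew[OF this skew] show ?thesis
    unfolding ch3_form_altsum by simp
qed

section \<open>Decay of the transgression form at infinity\<close>

text \<open>The transformation law of a global one-form with values in the endomorphisms of the
  bundle.\<close>

definition pullback_law :: "(4 \<Rightarrow> 6 \<Rightarrow> real^6 \<Rightarrow> complex^6^6) \<Rightarrow> bool" where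
  "pullback_law \<theta> \<longleftrightarrow> (\<forall>i j k. \<forall>x\<in>chart_overlap i j.
     (\<Sum>l\<in>UNIV. jacobian (chart_change i j) (at x) $ l $ k *\<^sub>R \<theta> j l (chart_change i j x)) **
       complexified_tangent CP3_chart i j x = complexified_tangent CP3_chart i j x ** \<theta> i k x)"

text \<open>The gluing clause of \<open>connection\<close> in explicit chart changes. It mentions no
  sheet, so what follows serves both.\<close>

definition connection_law :: "(4 \<Rightarrow> 6 \<Rightarrow> real^6 \<Rightarrow> complex^6^6) \<Rightarrow> bool" where
  "connection_law A \<longleftrightarrow> (\<forall>i j k. \<forall>x\<in>chart_overlap i j.
     (\<Sum>l\<in>UNIV. jacobian (chart_change i j) (at x) $ l $ k *\<^sub>R A j l (chart_change i j x)) **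
       complexified_tangent CP3_chart i j x + pderiv_at k (complexified_tangent CP3_chart i j) x =
     complexified_tangent CP3_chart i j x ** A i k x)"

lemma connection_sheetD:
  assumes "connection (sheet_space Q s) (sheet_chart Q s) (complexified_tangent CP3_chart) A"
  shows "smooth_on (A i k) UNIV" "connection_law A"
  using assms unfolding connection_def connection_law_def overlap_sheet_chart
  by (auto simp: jacobian_transition_sheet transition_sheet_chart)

text \<open>The inhomogeneous terms, the derivatives of the transition matrix, cancel in the
  difference.\<close>

lemma pullback_law_diff:
  assumes "connection_law A" "connection_law A'"
  shows "pullback_law (\<lambda>i k x. A' i k x - A i k x)"
  unfolding pullback_law_def
proof (intro allI ballI)
  fix i j k x assume x: "x \<in> chart_overlap i j"
  let ?g = "complexified_tangent CP3_chart i j x" and ?d = "pderiv_at k (complexified_tangent CP3_chart i j) x"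
  let ?S = "\<lambda>A. (\<Sum>l\<in>UNIV. jacobian (chart_change i j) (at x) $ l $ k *\<^sub>R A j l (chart_change i j x))"
  have "?S A ** ?g + ?d = ?g ** A i k x" "?S A' ** ?g + ?d = ?g ** A' i k x"
    using assms x unfolding connection_law_def by blast+
  then have 1: "?S A ** ?g = ?g ** A i k x - ?d" "?S A' ** ?g = ?g ** A' i k x - ?d"
    by (simp_all only: eq_diff_eq)
  have "?S (\<lambda>i k x. A' i k x - A i k x) ** ?g = ?S A' ** ?g - ?S A ** ?g"
    by (simp only: scaleR_diff_right sum_subtractf matrix_bilinear_simps)
  also have "\<dots> = ?g ** (A' i k x - A i k x)"
    unfolding 1 by (simp add: matrix_bilinear_simps)
  finally show "?S (\<lambda>i k x. A' i k x - A i k x) ** ?g = ?g ** (A' i k x - A i k x)" .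
qed

lemma connection_law_add:
  assumes "connection_law A" "pullback_law \<theta>"
  shows "connection_law (\<lambda>i k x. A i k x + t *\<^sub>R \<theta> i k x)"
  unfolding connection_law_def
proof (intro allI ballI)
  fix i j k x assume x: "x \<in> chart_overlap i j"
  let ?g = "complexified_tangent CP3_chart i j x" and ?d = "pderiv_at k (complexified_tangent CP3_chart i j) x"
  let ?S = "\<lambda>A. (\<Sum>l\<in>UNIV. jacobian (chart_change i j) (at x) $ l $ k *\<^sub>R A j l (chart_change i j x))"
  have 1: "?S A ** ?g + ?d = ?g ** A i k x" "?S \<theta> ** ?g = ?g ** \<theta> i k x"
    using assms x unfolding connection_law_def pullback_law_def by blast+
  have "?S (\<lambda>i k x. A i k x + t *\<^sub>R \<theta> i k x) = ?S A + t *\<^sub>R ?S \<theta>"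
    by (simp add: scaleR_add_right sum.distrib scaleR_sum_right mult.commute)
  then have "?S (\<lambda>i k x. A i k x + t *\<^sub>R \<theta> i k x) ** ?g + ?d = (?S A ** ?g + ?d) + t *\<^sub>R (?S \<theta> ** ?g)"
    by (simp add: matrix_bilinear_simps(1,7))
  also have "\<dots> = ?g ** (A i k x + t *\<^sub>R \<theta> i k x)"
    unfolding 1 by (simp add: matrix_bilinear_simps)
  finally show "?S (\<lambda>i k x. A i k x + t *\<^sub>R \<theta> i k x) ** ?g + ?d = ?g ** (A i k x + t *\<^sub>R \<theta> i k x)" .
qed

lemma trace_conjugate:
  fixes g X Y :: "complex^'n^'n"
  assumes "invertible g" "g ** X = Y ** g"
  shows "trace X = trace Y"
proof -
  obtain k where k: "g ** k = mat 1" "k ** g = mat 1"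
    using assms(1) unfolding invertible_def by blast
  have "X = k ** (Y ** g)"
    unfolding assms(2)[symmetric] by (simp add: matrix_mul_assoc k)
  then have "trace X = trace (Y ** g ** k)"
    by (simp add: trace_mul_sym[of k])
  then show ?thesis by (simp add: matrix_mul_assoc[symmetric] k)
qed

text \<open>Components, not yet antisymmetrised, of the transgression 5-form at one point of the
  path of connections.\<close>

definition trace_form :: "(6 \<Rightarrow> real^6 \<Rightarrow> complex^'n^'n) \<Rightarrow> (6 \<Rightarrow> real^6 \<Rightarrow> complex^'n^'n) \<Rightarrow>
    6 \<Rightarrow> 6 \<Rightarrow> 6 \<Rightarrow> 6 \<Rightarrow> 6 \<Rightarrow> real^6 \<Rightarrow> complex" where
  "trace_form \<theta> B b c d e f x = trace (\<theta> b x ** curvature B c d x ** curvature B e f x)"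

lemma smooth_on_trace_form:
  assumes "\<And>k. smooth_on (\<theta> k) UNIV" "\<And>k. smooth_on (B k) UNIV"
  shows "smooth_on (trace_form \<theta> B b c d e f) UNIV"
  unfolding trace_form_def[abs_def]
  by (intro smooth_on_bounded_linear[OF open_UNIV bounded_linear_trace] smooth_on_matrix_mult
      smooth_on_curvature open_UNIV assms)

lemma bounded_linear_sum_scaleR:
  fixes f :: "'a::real_normed_vector \<Rightarrow> complex"
  assumes "bounded_linear f"
  shows "f (\<Sum>l\<in>I. c l *\<^sub>R X l) = (\<Sum>l\<in>I. of_real (c l) * f (X l))"
  using assms by (simp add: linear_sum[OF bounded_linear.linear] linear_simps(5) scaleR_conv_of_real)

lemma bounded_linear_trace_triple:
  fixes X Y Z :: "complex^'n^'n"
  shows "bounded_linear (\<lambda>X. trace (X ** Y ** Z))" "bounded_linear (\<lambda>Y. trace (X ** Y ** Z))"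
    "bounded_linear (\<lambda>Z. trace (X ** Y ** Z))"
proof -
  note b = bounded_bilinear_matrix_matrix_mult
  show "bounded_linear (\<lambda>X. trace (X ** Y ** Z))"
    by (intro bounded_linear_compose[OF bounded_linear_trace]
        bounded_linear_compose[OF bounded_bilinear.bounded_linear_left[OF b]] bounded_bilinear.bounded_linear_left[OF b])
  show "bounded_linear (\<lambda>Y. trace (X ** Y ** Z))"
    by (intro bounded_linear_compose[OF bounded_linear_trace]
        bounded_linear_compose[OF bounded_bilinear.bounded_linear_left[OF b]] bounded_bilinear.bounded_linear_right[OF b])
  show "bounded_linear (\<lambda>Z. trace (X ** Y ** Z))"
    by (intro bounded_linear_compose[OF bounded_linear_trace] bounded_bilinear.bounded_linear_right[OF b])
qed

text \<open>The transition matrix conjugates all three factors simultaneously and drops out of the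
  trace, which leaves one Jacobian factor for each of the five indices.\<close>

lemma trace_form_transform:
  assumes \<theta>: "pullback_law \<theta>" and B: "\<And>i k. smooth_on (B i k) UNIV" "connection_law B"
    and x: "x \<in> chart_overlap i j"
  defines "J \<equiv> \<lambda>l k. jacobian (chart_change i j) (at x) $ l $ k" and "y \<equiv> chart_change i j x"
  shows "trace_form (\<theta> i) (B i) b c d e f x =
    (\<Sum>l2\<in>UNIV. \<Sum>l3\<in>UNIV. \<Sum>l4\<in>UNIV. \<Sum>l5\<in>UNIV. \<Sum>l6\<in>UNIV.
      of_real (J l2 b * J l3 c * J l4 d * J l5 e * J l6 f) * trace_form (\<theta> j) (B j) l2 l3 l4 l5 l6 y)"
proof -
  let ?g = "complexified_tangent CP3_chart i j"
  define \<Theta> where "\<Theta> = (\<Sum>l\<in>UNIV. J l b *\<^sub>R \<theta> j l y)"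
  define \<Phi> where "\<Phi> c d = (\<Sum>l\<in>UNIV. \<Sum>m\<in>UNIV. (J l c * J m d) *\<^sub>R curvature (B j) l m y)" for c d
  have inv: "invertible (?g x)"
    using vector_bundle_tangent x unfolding vector_bundle_def overlap_sheet_chart by blast
  have sg: "smooth_on ?g (chart_overlap i j)"
    using vector_bundle_tangent unfolding vector_bundle_def overlap_sheet_chart by blast
  have "\<Theta> ** ?g x = ?g x ** \<theta> i b x"
    using \<theta> x unfolding pullback_law_def \<Theta>_def J_def y_def by blast
  then have g\<theta>: "?g x ** \<theta> i b x = \<Theta> ** ?g x" ..
  have gF: "?g x ** curvature (B i) c d x = \<Phi> c d ** ?g x" for c d
    unfolding \<Phi>_def J_def y_def
    by (rule curvature_gauge_transform[OF open_chart_overlap smooth_on_chart_change sg B(1) B(1) _ x])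
      (use B(2) in \<open>auto simp: connection_law_def\<close>)
  have "?g x ** (\<theta> i b x ** curvature (B i) c d x ** curvature (B i) e f x) = \<Theta> ** \<Phi> c d ** \<Phi> e f ** ?g x"
  proof -
    have "?g x ** (\<theta> i b x ** curvature (B i) c d x ** curvature (B i) e f x) =
        (?g x ** \<theta> i b x) ** curvature (B i) c d x ** curvature (B i) e f x"
      by (simp add: matrix_mul_assoc)
    also have "\<dots> = \<Theta> ** (?g x ** curvature (B i) c d x) ** curvature (B i) e f x"
      unfolding g\<theta> by (simp add: matrix_mul_assoc)
    also have "\<dots> = \<Theta> ** \<Phi> c d ** (?g x ** curvature (B i) e f x)"
      unfolding gF[of c d] by (simp add: matrix_mul_assoc)
    also have "\<dots> = \<Theta> ** \<Phi> c d ** \<Phi> e f ** ?g x"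
      unfolding gF[of e f] by (simp add: matrix_mul_assoc)
    finally show ?thesis .
  qed
  from trace_conjugate[OF inv this]
  have "trace_form (\<theta> i) (B i) b c d e f x = trace (\<Theta> ** \<Phi> c d ** \<Phi> e f)"
    by (simp add: trace_form_def)
  also have "\<dots> = (\<Sum>l2\<in>UNIV. of_real (J l2 b) * trace (\<theta> j l2 y ** \<Phi> c d ** \<Phi> e f))"
    unfolding \<Theta>_def by (rule bounded_linear_sum_scaleR[OF bounded_linear_trace_triple(1)])
  also have "\<dots> = (\<Sum>l2\<in>UNIV. of_real (J l2 b) * (\<Sum>l3\<in>UNIV. \<Sum>l4\<in>UNIV. of_real (J l3 c * J l4 d) *
      (\<Sum>l5\<in>UNIV. \<Sum>l6\<in>UNIV. of_real (J l5 e * J l6 f) * trace_form (\<theta> j) (B j) l2 l3 l4 l5 l6 y)))"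
  proof -
    have s: "F (\<Phi> c d) = (\<Sum>l3\<in>UNIV. \<Sum>l4\<in>UNIV. of_real (J l3 c * J l4 d) * F (curvature (B j) l3 l4 y))"
      if F: "bounded_linear F" for F :: "complex^6^6 \<Rightarrow> complex" and c d
      unfolding \<Phi>_def linear_sum[OF bounded_linear.linear[OF F]]
      by (simp only: linear_sum[OF bounded_linear.linear[OF F]] linear_simps(5)[OF F] scaleR_conv_of_real[where 'a=complex])
    show ?thesis
      unfolding s[OF bounded_linear_trace_triple(2)]
      unfolding s[OF bounded_linear_trace_triple(3)] trace_form_def ..
  qed
  also have "\<dots> = (\<Sum>l2\<in>UNIV. \<Sum>l3\<in>UNIV. \<Sum>l4\<in>UNIV. \<Sum>l5\<in>UNIV. \<Sum>l6\<in>UNIV.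
      of_real (J l2 b * J l3 c * J l4 d * J l5 e * J l6 f) * trace_form (\<theta> j) (B j) l2 l3 l4 l5 l6 y)"
    by (simp add: sum_distrib_left mult.assoc)
  finally show ?thesis .
qed

section \<open>Determinant estimates for the chart changes\<close>

lemma altsum_sum: "altsum (\<lambda>a b c d e f. \<Sum>i\<in>I. h i a b c d e f) = (\<Sum>i\<in>I. altsum (h i))"
  unfolding altsum_def sum_distrib_left by (rule sum.swap)

text \<open>The wedge product of six one-forms is their determinant; row \<open>r\<close> holds the
  components of the \<open>r\<close>-th form.\<close>

lemma altsum_prod_eq_det:
  fixes u :: "6 \<Rightarrow> 6 \<Rightarrow> real"
  shows "altsum (\<lambda>a b c d e f. complex_of_real (u 1 a * u 2 b * u 3 c * u 4 d * u 5 e * u 6 f)) =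
    of_real (det (\<chi> r c. u r c))"
proof -
  have "(\<Prod>r\<in>UNIV. u r (p r)) = u 1 (p 1) * u 2 (p 2) * u 3 (p 3) * u 4 (p 4) * u 5 (p 5) * u 6 (p 6)" for p
    unfolding UNIV_6 by (simp add: mult.assoc)
  then show ?thesis
    by (simp add: altsum_def det_def)
qed

text \<open>The Leibniz formula has 720 = 6! terms, each bounded row by row.\<close>

lemma abs_det_le:
  fixes u :: "6 \<Rightarrow> 6 \<Rightarrow> real"
  assumes "\<And>r c. \<bar>u r c\<bar> \<le> \<beta> r"
  shows "\<bar>det (\<chi> r c. u r c)\<bar> \<le> 720 * (\<Prod>r\<in>UNIV. \<beta> r)"
proof -
  have "\<bar>det (\<chi> r c. u r c)\<bar> \<le> (\<Sum>p | p permutes (UNIV :: 6 set). \<bar>of_int (sign p) * (\<Prod>r\<in>UNIV. u r (p r))\<bar>)"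
    unfolding det_def by (simp add: sum_abs)
  also have "\<dots> \<le> (\<Sum>p | p permutes (UNIV :: 6 set). \<Prod>r\<in>UNIV. \<beta> r)"
  proof (rule sum_mono)
    fix p :: "6 \<Rightarrow> 6"
    have "\<bar>of_int (sign p) * (\<Prod>r\<in>UNIV. u r (p r))\<bar> = (\<Prod>r\<in>UNIV. \<bar>u r (p r)\<bar>)"
      by (simp add: abs_mult abs_prod sign_def)
    also have "\<dots> \<le> (\<Prod>r\<in>UNIV. \<beta> r)"
      by (rule prod_mono) (use assms in auto)
    finally show "\<bar>of_int (sign p) * (\<Prod>r\<in>UNIV. u r (p r))\<bar> \<le> (\<Prod>r\<in>UNIV. \<beta> r)" .
  qed
  also have "\<dots> = 720 * (\<Prod>r\<in>UNIV. \<beta> r)"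
    using card_permutations[of "UNIV :: 6 set" 6] by (simp add: fact_numeral)
  finally show ?thesis .
qed

text \<open>The homogeneous coordinate to which the real coordinate \<open>l\<close> of chart
  \<open>j\<close> belongs.\<close>

definition place :: "4 \<Rightarrow> 6 \<Rightarrow> 4" where
  "place j l = (if l = 1 \<or> l = 2 then j + 1 else if l = 3 \<or> l = 4 then j + 2 else j + 3)"

lemma abs_real_coords_le: "\<bar>real_coords j v $ l\<bar> \<le> cmod (v $ place j l)"
  using exhaust_6[of l] abs_Re_le_cmod abs_Im_le_cmod by (auto simp: place_def)

lemma cmod_hom_dir_axis_le: "cmod (hom_dir i (axis k 1) $ m) \<le> 1"
proof -
  have "cmod (Complex a b) \<le> 1" if "a = 0 \<and> b = 0 \<or> a = 1 \<and> b = 0 \<or> a = 0 \<and> b = 1" for a b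
    using that by (auto simp: cmod_def)
  then show ?thesis
    using exhaust_4_offset[of m i] by (auto simp: axis_def)
qed

text \<open>Differentiating Z_m / Z_j gives two terms, each at most 1/\<rho> since Z_j is the
  largest entry. For m = i the numerator is the constant 1, and the derivative of 1/Z_j gains
  another 1/\<rho>.\<close>

lemma abs_jacobian_chart_change_le:
  assumes x: "x \<in> chart_overlap i j" and max: "\<And>m. cmod (affine_coords i x $ m) \<le> cmod (affine_coords i x $ j)"
  defines "\<rho> \<equiv> cmod (affine_coords i x $ j)"
  shows "\<bar>jacobian (chart_change i j) (at x) $ l $ k\<bar> \<le> 2 / \<rho> * (if place j l = i then 1 / \<rho> else 1)"
proof -
  let ?Z = "affine_coords i x" and ?v = "hom_dir i (axis k 1)" and ?m = "place j l"
  have \<rho>: "\<rho> > 0" using x by (simp add: \<rho>_def chart_overlap_def)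
  have "\<bar>jacobian (chart_change i j) (at x) $ l $ k\<bar> \<le> cmod (chart_change_deriv i j x ?v $ ?m)"
    unfolding jacobian_chart_change[OF x] by (simp add: matrix_def abs_real_coords_le)
  also have "chart_change_deriv i j x ?v $ ?m =
      inverse (?Z $ j) * ?v $ ?m - ?v $ j * (inverse (?Z $ j))\<^sup>2 * ?Z $ ?m"
    by (simp add: chart_change_deriv_def)
  also have "cmod \<dots> \<le> cmod (inverse (?Z $ j) * ?v $ ?m) + cmod (?v $ j * (inverse (?Z $ j))\<^sup>2 * ?Z $ ?m)"
    by (rule norm_triangle_ineq4)
  also have "\<dots> = cmod (?v $ ?m) / \<rho> + cmod (?v $ j) * cmod (?Z $ ?m) / \<rho>\<^sup>2"
    unfolding norm_mult norm_power norm_inverse \<rho>_def divide_inverse power_inverse by (simp add: mult_ac)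
  finally have *: "\<bar>jacobian (chart_change i j) (at x) $ l $ k\<bar> \<le> cmod (?v $ ?m) / \<rho> + cmod (?v $ j) * cmod (?Z $ ?m) / \<rho>\<^sup>2" .
  show ?thesis
  proof (cases "?m = i")
    case True
    have "cmod (?v $ j) * 1 / \<rho>\<^sup>2 \<le> 1 / \<rho>\<^sup>2"
      using cmod_hom_dir_axis_le[of i k j] by (intro divide_right_mono) auto
    also have "\<dots> \<le> 2 / \<rho>\<^sup>2" by (simp add: divide_right_mono)
    finally show ?thesis
      using * True by (simp add: power2_eq_square)
  next
    case False
    have "cmod (?v $ ?m) / \<rho> \<le> 1 / \<rho>"
      using cmod_hom_dir_axis_le[of i k ?m] \<rho> by (intro divide_right_mono) auto
    moreover have "cmod (?v $ j) * cmod (?Z $ ?m) / \<rho>\<^sup>2 \<le> 1 * \<rho> / \<rho>\<^sup>2"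
      using cmod_hom_dir_axis_le[of i k j] max[of ?m] by (intro divide_right_mono mult_mono) (auto simp: \<rho>_def)
    ultimately show ?thesis
      using * False \<rho> by (simp add: power2_eq_square)
  qed
qed

lemma norm_le_affine_coords:
  assumes max: "\<And>m. cmod (affine_coords i x $ m) \<le> \<rho>"
  shows "(norm x)\<^sup>2 \<le> 3 * \<rho>\<^sup>2"
proof -
  have c: "(x $ a)\<^sup>2 + (x $ b)\<^sup>2 \<le> \<rho>\<^sup>2" if "affine_coords i x $ m = Complex (x $ a) (x $ b)" for m a b
    using power_mono[OF max[of m], of 2] that by (simp add: cmod_power2)
  have "(norm x)\<^sup>2 = (\<Sum>r\<in>UNIV. (x $ r)\<^sup>2)"
    by (simp add: norm_vec_def L2_set_def sum_nonneg)
  also have "\<dots> = ((x $ 1)\<^sup>2 + (x $ 2)\<^sup>2) + ((x $ 3)\<^sup>2 + (x $ 4)\<^sup>2) + ((x $ 5)\<^sup>2 + (x $ 6)\<^sup>2)"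
    unfolding UNIV_6 by simp
  also have "\<dots> \<le> \<rho>\<^sup>2 + \<rho>\<^sup>2 + \<rho>\<^sup>2"
    by (intro add_mono c[of "i + 1"] c[of "i + 2"] c[of "i + 3"]) (simp_all add: affine_coords_def)
  finally show ?thesis by simp
qed

text \<open>Five of the six rows of the Jacobian cannot avoid both rows belonging to the inverse coordinate
  \<open>1 / Z\<^sub>j\<close>, whose derivatives carry the additional factor \<open>1 / \<rho>\<close>.\<close>

lemma abs_det_jacobian_rows_le:
  fixes l :: "6 \<Rightarrow> 6"
  assumes x: "x \<in> chart_overlap i j" and max: "\<And>m. cmod (affine_coords i x $ m) \<le> cmod (affine_coords i x $ j)"
    and ij: "j \<noteq> i" and w: "\<And>c. \<bar>w c\<bar> \<le> W"
  defines "\<rho> \<equiv> cmod (affine_coords i x $ j)"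
  shows "\<bar>det (\<chi> r c. if r = 1 then w c else jacobian (chart_change i j) (at x) $ l r $ c)\<bar> \<le> 720 * (W * 32 / \<rho> ^ 6)"
proof (cases "inj_on l (- {1})")
  case False
  then obtain r r' where r: "r \<noteq> 1" "r' \<noteq> 1" "r \<noteq> r'" "l r = l r'"
    by (auto simp: inj_on_def)
  \<comment> \<open>A repeated index among the five repeats a row, so only injective choices
    matter.\<close>
  have "det (\<chi> r c. if r = 1 then w c else jacobian (chart_change i j) (at x) $ l r $ c) = 0"
    by (rule det_identical_rows[OF r(3)]) (use r in \<open>simp add: row_def vec_eq_iff\<close>)
  moreover have "0 \<le> W" using w[of 1] by simp
  ultimately show ?thesis by (simp add: \<rho>_def)
next
  case True
  have \<rho>: "\<rho> \<ge> 1" using max[of i] by (simp add: \<rho>_def)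
  have W: "0 \<le> W" using w[of 1] by simp
  define e where "e r = (if place j (l r) = i then 1 / \<rho> else 1)" for r
  define \<beta> where "\<beta> r = (if r = 1 then W else 2 / \<rho> * e r)" for r
  have card6: "card (UNIV :: 6 set) = 6" by simp
  have "\<exists>r. r \<noteq> 1 \<and> place j (l r) = i"
  proof (rule ccontr)
    assume "\<not> ?thesis"
    then have "l ` (- {1}) \<inter> {l. place j l = i} = {}" by auto
    then have "card (l ` (- {1}) \<union> {l. place j l = i}) = card (l ` (- {1})) + card {l. place j l = i}"
      by (intro card_Un_disjoint) auto
    moreover have "card (l ` (- {1})) = 5"
      using card_image[OF True] by (simp add: Compl_eq_Diff_UNIV card_Diff_singleton)
    moreover have "card {l. place j l = i} \<ge> 2"
    proof -
      have "i = j + 1 \<or> i = j + 2 \<or> i = j + 3"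
        using exhaust_4_offset[of i j] ij by auto
      then have "\<exists>a b. a \<noteq> b \<and> {a, b} \<subseteq> {l. place j l = i}"
      proof (elim disjE)
        show ?thesis if "i = j + 1" using that by (intro exI[of _ 1] exI[of _ 2]) (simp add: place_def)
        show ?thesis if "i = j + 2" using that by (intro exI[of _ 3] exI[of _ 4]) (simp add: place_def)
        show ?thesis if "i = j + 3" using that by (intro exI[of _ 5] exI[of _ 6]) (simp add: place_def)
      qed
      then obtain a b where "a \<noteq> b" "{a, b} \<subseteq> {l. place j l = i}" by blast
      then show ?thesis using card_mono[of "{l. place j l = i}" "{a, b}"] by simp
    qed
    moreover have "card (l ` (- {1}) \<union> {l. place j l = i}) \<le> 6"
      using card_mono[of "UNIV :: 6 set"] card6 by (metis finite subset_UNIV)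
    ultimately show False by linarith
  qed
  then obtain r0 where r0: "r0 \<noteq> 1" "place j (l r0) = i" by blast
  have e01: "0 \<le> e r" "e r \<le> 1" for r using \<rho> by (auto simp: e_def)
  have "(\<Prod>r\<in>- {1}. e r) = e r0 * (\<Prod>r\<in>- {1} - {r0}. e r)"
    by (rule prod.remove) (use r0 in auto)
  also have "\<dots> \<le> e r0 * 1"
    by (intro mult_left_mono prod_le_1) (use e01 in auto)
  finally have pe: "(\<Prod>r\<in>- {1}. e r) \<le> 1 / \<rho>" using r0 by (simp add: e_def)
  have "(\<Prod>r\<in>UNIV. \<beta> r) = \<beta> 1 * (\<Prod>r\<in>- {1}. \<beta> r)"
    using prod.remove[of UNIV 1 \<beta>] by (simp add: Compl_eq_Diff_UNIV)
  also have "(\<Prod>r\<in>- {1}. \<beta> r) = (\<Prod>r\<in>- {1}. 2 / \<rho> * e r)"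
    by (rule prod.cong) (auto simp: \<beta>_def)
  also have "\<dots> = (2 / \<rho>) ^ 5 * (\<Prod>r\<in>- {1}. e r)"
    unfolding prod.distrib prod_constant by (simp add: Compl_eq_Diff_UNIV card_Diff_singleton)
  \<comment> \<open>Five rows contribute 2/\<rho> each, whence 32 = 2^5, and \<open>r0\<close>
    contributes the additional 1/\<rho>.\<close>
  also have "\<beta> 1 * ((2 / \<rho>) ^ 5 * (\<Prod>r\<in>- {1}. e r)) \<le> W * ((2 / \<rho>) ^ 5 * (1 / \<rho>))"
    unfolding \<beta>_def using W \<rho> by (simp del: times_divide_eq_right, intro mult_left_mono pe) auto
  also have "\<dots> = W * 32 / \<rho> ^ 6"
    by (simp add: power_divide eval_nat_numeral)
  finally have "(\<Prod>r\<in>UNIV. \<beta> r) \<le> W * 32 / \<rho> ^ 6" .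
  moreover have "\<bar>det (\<chi> r c. if r = 1 then w c else jacobian (chart_change i j) (at x) $ l r $ c)\<bar> \<le> 720 * (\<Prod>r\<in>UNIV. \<beta> r)"
  proof (rule abs_det_le)
    show "\<bar>if r = 1 then w c else jacobian (chart_change i j) (at x) $ l r $ c\<bar> \<le> \<beta> r" for r c
      using w[of c] abs_jacobian_chart_change_le[OF x max, of "l r" c]
      by (cases "r = 1") (simp_all only: \<beta>_def e_def \<rho>_def if_True if_False simp_thms)
  qed
  ultimately show ?thesis by linarith
qed

text \<open>A point far out in chart \<open>i\<close> is viewed in the chart \<open>j\<close> of its
  largest homogeneous coordinate. There it lies in the fixed compact set \<open>K\<close>, on which
  the form is bounded, and all the decay comes from the determinant of the cut-off gradient with
  five Jacobian rows.\<close>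

lemma trace_form_decay:
  assumes \<theta>: "\<And>i k. smooth_on (\<theta> i k) UNIV" "pullback_law \<theta>"
    and B: "\<And>i k. smooth_on (B i k) UNIV" "connection_law B"
  shows "\<exists>C\<ge>0. \<forall>R\<ge>2. \<forall>x. norm x \<ge> R \<longrightarrow>
    cmod (altsum (\<lambda>a b c d e f. of_real (cutoff_deriv R x (axis a 1)) * trace_form (\<theta> i) (B i) b c d e f x)) \<le> C / R ^ 7"
proof -
  \<comment> \<open>Dividing by the largest entry leaves entries of modulus at most 1.\<close>
  define K where "K = {y :: real^6. \<forall>r. \<bar>y $ r\<bar> \<le> 1}"
  have "K = cbox (\<chi> r. -1) (\<chi> r. 1)"
    by (auto simp: K_def mem_box_cart abs_le_iff minus_le_iff)
  then have "compact K" by simp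
  \<comment> \<open>One continuous majorant of all components in all charts, so that a single bound
    \<open>M\<close> results.\<close>
  define G where "G y = (\<Sum>j\<in>UNIV. \<Sum>b\<in>UNIV. \<Sum>c\<in>UNIV. \<Sum>d\<in>UNIV. \<Sum>e\<in>UNIV. \<Sum>f\<in>UNIV.
      cmod (trace_form (\<theta> j) (B j) b c d e f y))" for y
  have "continuous_on K (trace_form (\<theta> j) (B j) b c d e f)" for j b c d e f
    by (rule continuous_on_subset[OF smooth_on_continuous_on[OF smooth_on_trace_form[OF \<theta>(1) B(1)]] subset_UNIV])
  then have "continuous_on K G"
    unfolding G_def by (intro continuous_intros)
  then have "bounded (G ` K)"
    using \<open>compact K\<close> compact_continuous_image compact_imp_bounded by blast
  then obtain M where "\<forall>y\<in>K. norm (G y) \<le> M"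
    by (auto simp: bounded_iff)
  have mem: "f k \<le> (\<Sum>k\<in>UNIV. f k)" if "\<And>k. 0 \<le> f k" for f :: "'k::finite \<Rightarrow> real" and k
    by (rule member_le_sum) (use that in auto)
  have hM: "cmod (trace_form (\<theta> j) (B j) b c d e f y) \<le> M" if "y \<in> K" for j b c d e f y
  proof -
    have "cmod (trace_form (\<theta> j) (B j) b c d e f y) \<le> G y"
      unfolding G_def
      by (rule order_trans[OF _ mem[of _ j]], rule order_trans[OF _ mem[of _ b]], rule order_trans[OF _ mem[of _ c]],
          rule order_trans[OF _ mem[of _ d]], rule order_trans[OF _ mem[of _ e]], rule order_trans[OF _ mem[of _ f]])
        (auto intro!: sum_nonneg)
    also have "\<dots> \<le> M" using \<open>\<forall>y\<in>K. norm (G y) \<le> M\<close> that by force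
    finally show ?thesis .
  qed
  have "0 \<in> K" by (simp add: K_def)
  then have M: "0 \<le> M" using order_trans[OF norm_ge_zero hM] by blast
  \<comment> \<open>6^5 index tuples, 720 permutations, 16 from the cut-off, 32 = 2^5 from the
    Jacobian rows, and 64 = 2^6 from replacing \<rho> by R/2.\<close>
  define C where "C = 6 ^ 5 * (M * (720 * (16 * 32 * 64)))"
  have "cmod (altsum (\<lambda>a b c d e f. of_real (cutoff_deriv R x (axis a 1)) * trace_form (\<theta> i) (B i) b c d e f x)) \<le> C / R ^ 7"
    if R: "R \<ge> 2" "norm x \<ge> R" for R x
  proof -
    let ?Z = "affine_coords i x"
    obtain j where max: "\<And>m. cmod (?Z $ m) \<le> cmod (?Z $ j)"
    proof -
      have "Max (range (\<lambda>m. cmod (?Z $ m))) \<in> range (\<lambda>m. cmod (?Z $ m))"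
        by (rule Max_in) auto
      then obtain j where j: "Max (range (\<lambda>m. cmod (?Z $ m))) = cmod (?Z $ j)" by blast
      have "cmod (?Z $ m) \<le> cmod (?Z $ j)" for m
        unfolding j[symmetric] by (rule Max_ge) auto
      then show ?thesis using that by blast
    qed
    define \<rho> where "\<rho> = cmod (?Z $ j)"
    have "R\<^sup>2 \<le> (norm x)\<^sup>2" using R by (intro power_mono) auto
    also have "\<dots> \<le> 3 * \<rho>\<^sup>2" unfolding \<rho>_def by (rule norm_le_affine_coords[OF max])
    finally have R3: "R\<^sup>2 \<le> 3 * \<rho>\<^sup>2" .
    have "\<rho> \<ge> 1" using max[of i] by (simp add: \<rho>_def)
    have "R\<^sup>2 \<le> (2 * \<rho>)\<^sup>2"
      using order_trans[OF R3, of "4 * \<rho>\<^sup>2"] by (simp add: power_mult_distrib)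
    then have \<rho>R: "R / 2 \<le> \<rho>" using \<open>\<rho> \<ge> 1\<close> power2_le_imp_le[of R "2 * \<rho>"] by simp
    \<comment> \<open>This is where R \<ge> 2 is used: j = i would give \<rho> = 1 and R^2 \<le>
      3.\<close>
    have "j \<noteq> i"
    proof
      assume "j = i"
      then have "\<rho> = 1" by (simp add: \<rho>_def)
      moreover have "4 \<le> R\<^sup>2" using power_mono[OF R(1), of 2] by simp
      ultimately show False using R3 by simp
    qed
    have x: "x \<in> chart_overlap i j" using \<open>\<rho> \<ge> 1\<close> by (auto simp: \<rho>_def chart_overlap_def)
    define y where "y = chart_change i j x"
    have "y \<in> K"
    proof -
      have "\<bar>y $ r\<bar> \<le> 1" for r
      proof -
        have "\<bar>y $ r\<bar> \<le> cmod (inverse (?Z $ j) * ?Z $ place j r)"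
          unfolding y_def chart_change_def by (rule order_trans[OF abs_real_coords_le]) simp
        also have "\<dots> \<le> 1"
          unfolding norm_mult norm_inverse \<rho>_def[symmetric]
          using max[of "place j r"] \<open>\<rho> \<ge> 1\<close> by (simp add: \<rho>_def[symmetric] field_simps)
        finally show ?thesis .
      qed
      then show ?thesis by (simp add: K_def)
    qed
    let ?J = "\<lambda>l k. jacobian (chart_change i j) (at x) $ l $ k"
    let ?w = "\<lambda>a. cutoff_deriv R x (axis a 1)"
    let ?T = "trace_form (\<theta> j) (B j)"
    have w: "\<bar>?w c\<bar> \<le> 16 / R" for c
      by (rule cutoff_deriv_bound) (use R in auto)
    \<comment> \<open>The antisymmetrised product of the cut-off gradient with five rows of the
      Jacobian, which is a determinant.\<close>
    define V where "V l2 l3 l4 l5 l6 = altsum (\<lambda>a b c d e f. complex_of_real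
        (?w a * ?J l2 b * ?J l3 c * ?J l4 d * ?J l5 e * ?J l6 f))" for l2 l3 l4 l5 l6
    have V: "cmod (V l2 l3 l4 l5 l6) \<le> 720 * (16 / R * 32 / \<rho> ^ 6)" for l2 l3 l4 l5 l6
    proof -
      define l where "l r = (if r = 2 then l2 else if r = 3 then l3 else if r = 4 then l4 else if r = 5 then l5 else l6)" for r :: 6
      have "V l2 l3 l4 l5 l6 = of_real (det (\<chi> r c. if r = 1 then ?w c else ?J (l r) c))"
        unfolding V_def altsum_prod_eq_det[symmetric] by (simp add: l_def)
      then show ?thesis
        using abs_det_jacobian_rows_le[OF x max \<open>j \<noteq> i\<close> w, where l = l] by (simp add: \<rho>_def)
    qed
    have TV: "cmod (?T l2 l3 l4 l5 l6 y * V l2 l3 l4 l5 l6) \<le> M * (720 * (16 / R * 32 / \<rho> ^ 6))" for l2 l3 l4 l5 l6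
      unfolding norm_mult by (intro mult_mono hM[OF \<open>y \<in> K\<close>] V M norm_ge_zero)
    have "altsum (\<lambda>a b c d e f. of_real (?w a) * trace_form (\<theta> i) (B i) b c d e f x) =
        (\<Sum>l2\<in>UNIV. \<Sum>l3\<in>UNIV. \<Sum>l4\<in>UNIV. \<Sum>l5\<in>UNIV. \<Sum>l6\<in>UNIV. ?T l2 l3 l4 l5 l6 y * V l2 l3 l4 l5 l6)"
      unfolding trace_form_transform[OF \<theta>(2) B x] V_def altsum_cmult[symmetric] altsum_sum[symmetric] y_def[symmetric]
      by (simp add: sum_distrib_left mult_ac)
    also have "cmod \<dots> \<le> (\<Sum>l2\<in>(UNIV::6 set). \<Sum>l3\<in>(UNIV::6 set). \<Sum>l4\<in>(UNIV::6 set). \<Sum>l5\<in>(UNIV::6 set). \<Sum>l6\<in>(UNIV::6 set).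
        M * (720 * (16 / R * 32 / \<rho> ^ 6)))"
      by (intro sum_norm_le TV)
    also have "\<dots> = 6 ^ 5 * (M * (720 * (16 / R * 32 / \<rho> ^ 6)))"
      by simp
    also have "\<dots> \<le> 6 ^ 5 * (M * (720 * (16 / R * 32 / (R / 2) ^ 6)))"
      using R M \<rho>R by (intro mult_left_mono divide_left_mono power_mono mult_pos_pos) auto
    also have "\<dots> = C / R ^ 7"
      by (simp add: C_def power_divide eval_nat_numeral)
    finally show ?thesis .
  qed
  moreover have "0 \<le> C" using M by (simp add: C_def)
  ultimately show ?thesis by blast
qed

section \<open>Independence of the connection\<close>

lemma continuous_on_altsum:
  fixes h :: "6 \<Rightarrow> 6 \<Rightarrow> 6 \<Rightarrow> 6 \<Rightarrow> 6 \<Rightarrow> 6 \<Rightarrow> real^6 \<Rightarrow> complex"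
  assumes "\<And>a b c d e f. continuous_on S (h a b c d e f)"
  shows "continuous_on S (\<lambda>x. altsum (\<lambda>a b c d e f. h a b c d e f x))"
  unfolding altsum_def by (intro continuous_intros assms)

lemma norm_boole_le: "norm (boole f) \<le> norm (f 0) + norm (f (1/4)) + norm (f (1/2)) + norm (f (3/4)) + norm (f 1)"
proof -
  have "norm (7 * f 0 + 32 * f (1/4) + 12 * f (1/2) + 32 * f (3/4) + 7 * f 1) \<le>
      norm (7 * f 0) + norm (32 * f (1/4)) + norm (12 * f (1/2)) + norm (32 * f (3/4)) + norm (7 * f 1)"
    by (intro norm_triangle_le add_right_mono order_refl)
  then have "norm (boole f) \<le> (7 * norm (f 0) + 32 * norm (f (1/4)) + 12 * norm (f (1/2)) + 32 * norm (f (3/4)) + 7 * norm (f 1)) / 90"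
    by (simp add: boole_def norm_divide norm_mult)
  also have "\<dots> \<le> norm (f 0) + norm (f (1/4)) + norm (f (1/2)) + norm (f (3/4)) + norm (f 1)"
    by (simp add: field_simps)
  finally show ?thesis .
qed

lemma integral_boole:
  assumes "\<And>t. integrable M (g t)"
  shows "(LINT x|M. boole (\<lambda>t. g t x)) = boole (\<lambda>t. LINT x|M. g t x)"
  unfolding boole_def using assms by simp

lemma altsum_zero [simp]: "altsum (\<lambda>a b c d e f. 0) = 0"
  by (simp add: altsum_def)

text \<open>The Fubini--Study end of the path contributes 0, so the trace form of \<open>A\<close>
  is itself a quadrature sum of exact forms.\<close>

lemma integral_ch3_form_eq_0:
  assumes A: "\<And>i k. smooth_on (A i k) UNIV" "connection_law A"
  shows "(LINT x|lborel. ch3_form (A i) x) = 0"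
proof -
  have fs: "\<And>i k. smooth_on (fs_connection i k) UNIV" "connection_law fs_connection"
    using connection_sheetD[OF connection_fs] by blast+
  define \<theta> where "\<theta> i k x = A i k x - fs_connection i k x" for i k x
  have \<theta>: "smooth_on (\<theta> i k) UNIV" for i k
    unfolding \<theta>_def by (intro smooth_on_diff open_UNIV A(1) fs(1))
  have \<theta>l: "pullback_law \<theta>"
    unfolding \<theta>_def[abs_def] by (rule pullback_law_diff[OF fs(2) A(2)])
  define B where "B t i k x = fs_connection i k x + t *\<^sub>R \<theta> i k x" for t i k x
  have B: "smooth_on (B t i k) UNIV" for t i k
    unfolding B_def
    by (intro smooth_on_add open_UNIV fs(1) smooth_on_bounded_linear[OF open_UNIV bounded_linear_scaleR_right \<theta>])
  have Bl: "connection_law (B t)" for t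
    unfolding B_def[abs_def] by (rule connection_law_add[OF fs(2) \<theta>l])
  note h = smooth_on_trace_form[OF \<theta> B]
  define T where "T x = altsum (\<lambda>a b c d e f. trace (curvature (A i) a b x ** curvature (A i) c d x ** curvature (A i) e f x))" for x
  define D where "D t x = altsum (\<lambda>a b c d e f. pderiv_at a (trace_form (\<theta> i) (B t i) b c d e f) x)" for t x
  have T_eq: "T x = 6 * boole (\<lambda>t. D t x)" for x
  proof -
    have "altsum (\<lambda>a b c d e f. trace (curvature (fs_connection i) a b x ** curvature (fs_connection i) c d x **
        curvature (fs_connection i) e f x)) = 0"
      using ch3_form_fs_connection[of i x] unfolding ch3_form_altsum by simp
    then show ?thesis
      using transgression[of "fs_connection i" "A i" x, OF fs(1) A(1)]
      unfolding T_def D_def trace_form_def[abs_def] B_def[abs_def] \<theta>_def by simp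
  qed
  have cD: "continuous_on UNIV (D t)" for t
    unfolding D_def[abs_def]
    by (intro continuous_on_altsum smooth_on_continuous_on smooth_on_pderiv_at h)
  have cT: "continuous_on UNIV T"
    unfolding T_eq[abs_def] boole_def by (intro continuous_intros cD) auto
  have "\<exists>C\<ge>0. \<forall>R\<ge>2. norm (LINT x|lborel. cutoff R x *\<^sub>R D t x) \<le> C / R" for t
  proof -
    obtain C where C: "C \<ge> 0" and decay: "\<And>R x. R \<ge> 2 \<Longrightarrow> norm x \<ge> R \<Longrightarrow>
        cmod (altsum (\<lambda>a b c d e f. of_real (cutoff_deriv R x (axis a 1)) * trace_form (\<theta> i) (B t i) b c d e f x)) \<le> C / R ^ 7"
      using trace_form_decay[OF \<theta> \<theta>l B Bl] by metis
    have "norm (LINT x|lborel. cutoff R x *\<^sub>R D t x) \<le> (64 * unit_ball_vol 6 * C) / R" if R: "R \<ge> 2" for R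
    proof -
      have R0: "R > 0" using R by simp
      show ?thesis
        unfolding D_def integral_cutoff_altsum_pderiv[OF h R0] norm_minus_cancel
      proof (rule integral_annulus_bound[OF R0 C])
        fix x :: "real^6"
        assume "norm x < R \<or> norm x > 2 * R"
        then have "cutoff_deriv R x v = 0" for v
          using cutoff_deriv_support_inner[OF R0, of x] cutoff_support(2)[OF R0, of x] by blast
        then show "altsum (\<lambda>a b c d e f. of_real (cutoff_deriv R x (axis a 1)) * trace_form (\<theta> i) (B t i) b c d e f x) = 0"
          by simp
      qed (rule decay[OF R])
    qed
    moreover have "64 * unit_ball_vol 6 * C \<ge> 0" using C by simp
    ultimately show ?thesis by blast
  qed
  then obtain C where C: "\<And>t R. R \<ge> 2 \<Longrightarrow> norm (LINT x|lborel. cutoff R x *\<^sub>R D t x) \<le> C t / R"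
    by metis
  have "(LINT x|lborel. T x) = 0"
  \<comment> \<open>The bound depends on \<open>t\<close>; the quadrature rule uses five nodes only,
    so five constants are added.\<close>
  proof (rule integral_eq_0_cutoff[OF cT, where C = "6 * (C 0 + C (1/4) + C (1/2) + C (3/4) + C 1)"])
    fix R :: real assume R: "R \<ge> 2"
    have int: "integrable lborel (\<lambda>x. cutoff R x *\<^sub>R D t x)" for t
      by (rule integrable_continuous_compact_support[where r = "2 * R"])
        (use R in \<open>auto intro!: continuous_intros continuous_on_cutoff cD simp: cutoff_support\<close>)
    have "(LINT x|lborel. cutoff R x *\<^sub>R T x) = (LINT x|lborel. 6 * boole (\<lambda>t. cutoff R x *\<^sub>R D t x))"
      by (simp add: T_eq boole_def scaleR_conv_of_real algebra_simps)
    also have "\<dots> = 6 * boole (\<lambda>t. LINT x|lborel. cutoff R x *\<^sub>R D t x)"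
      using integral_boole[OF int] by simp
    finally have "norm (LINT x|lborel. cutoff R x *\<^sub>R T x) = 6 * norm (boole (\<lambda>t. LINT x|lborel. cutoff R x *\<^sub>R D t x))"
      by (simp add: norm_mult)
    also have "\<dots> \<le> 6 * (C 0 / R + C (1/4) / R + C (1/2) / R + C (3/4) / R + C 1 / R)"
      by (intro mult_left_mono order_trans[OF norm_boole_le] add_mono C R) simp
    finally show "norm (LINT x|lborel. cutoff R x *\<^sub>R T x) \<le> 6 * (C 0 + C (1/4) + C (1/2) + C (3/4) + C 1) / R"
      by (simp add: add_divide_distrib algebra_simps)
  qed
  then show ?thesis
    unfolding ch3_form_altsum T_def by simp
qed

section \<open>Reduction of the integral to one chart\<close>

text \<open>Where a complex coordinate vanishes so does its real part, and this confines the point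
  to a real coordinate hyperplane.\<close>

lemma AE_affine_coords_nonzero:
  assumes "i \<noteq> j"
  shows "AE x in lborel. affine_coords i x $ j \<noteq> 0"
proof -
  have hyp: "AE x in lborel. (x :: real^6) $ r \<noteq> 0" for r
  proof -
    have "{x :: real^6. x $ r = 0} \<in> null_sets lebesgue"
      using negligible_standard_hyperplane_cart by (simp add: negligible_iff_null_sets)
    moreover have "closed {x :: real^6. x $ r = 0}"
      by (intro closed_Collect_eq continuous_intros)
    ultimately have "{x :: real^6. x $ r = 0} \<in> null_sets lborel"
      by (simp add: null_sets_completion_iff)
    then show ?thesis using AE_not_in by fastforce
  qed
  have "j = i + 1 \<or> j = i + 2 \<or> j = i + 3" using exhaust_4_offset[of j i] assms by auto
  then consider "\<And>x. affine_coords i x $ j = Complex (x $ 1) (x $ 2)" | "\<And>x. affine_coords i x $ j = Complex (x $ 3) (x $ 4)" |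
    "\<And>x. affine_coords i x $ j = Complex (x $ 5) (x $ 6)"
    by (auto simp: affine_coords_def)
  then show ?thesis
  proof cases
    case 1
    show ?thesis using hyp[of 1] by eventually_elim (simp add: 1 complex_eq_iff)
  next
    case 2
    show ?thesis using hyp[of 3] by eventually_elim (simp add: 2 complex_eq_iff)
  next
    case 3
    show ?thesis using hyp[of 5] by eventually_elim (simp add: 3 complex_eq_iff)
  qed
qed

text \<open>The first chart is dense with null complement: its own piece is everything, and the
  piece of any later chart avoids it and is null.\<close>

lemma form_integral_sheet:
  "form_integral (sheet_chart Q s) \<omega> = (LINT x|lborel. \<omega> (Min UNIV) x)"
proof -
  define m where "m = Min (UNIV :: 4 set)"
  have m: "m \<le> i" for i unfolding m_def by simp
  let ?P = "\<lambda>i. {x. \<forall>j<i. sheet_chart Q s i x \<notin> range (sheet_chart Q s j)}"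
  have "(LINT x : ?P i | lborel. \<omega> i x) = 0" if "i \<noteq> m" for i
  proof -
    have "m < i" using m[of i] that by simp
    then have sub: "x \<notin> ?P i" if "affine_coords i x $ m \<noteq> 0" for x
    proof -
      have "x \<in> overlap (sheet_chart Q s) i m"
        using that by (simp add: overlap_sheet_chart chart_overlap_def)
      then show ?thesis using \<open>m < i\<close> by (auto simp: overlap_def)
    qed
    show ?thesis
      unfolding set_lebesgue_integral_def
    proof (rule integral_eq_zero_AE)
      show "AE x in lborel. indicat_real (?P i) x *\<^sub>R \<omega> i x = 0"
        using AE_affine_coords_nonzero[OF that]
      proof eventually_elim
        case (elim x)
        from sub[OF elim] have "indicat_real (?P i) x = 0" by (rule indicator_simps(2))
        then show ?case by (simp only: scaleR_zero_left)
      qed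
    qed
  qed
  then have "form_integral (sheet_chart Q s) \<omega> = (LINT x : ?P m | lborel. \<omega> m x)"
    unfolding form_integral_def using sum.remove[of UNIV m "\<lambda>i. LINT x : ?P i | lborel. \<omega> i x"] by simp
  also have "?P m = UNIV" using m by (auto simp: not_less[symmetric])
  finally show ?thesis by (simp add: set_lebesgue_integral_def m_def)
qed

lemma ch3_integral_tangent: "ch3_integral (sheet_space Q s) (sheet_chart Q s) (complexified_tangent CP3_chart) = 0"
  unfolding ch3_integral_def
proof (rule the_equality)
  have zero: "form_integral (sheet_chart Q s) (\<lambda>i. ch3_form (A i)) = 0"
    if "connection (sheet_space Q s) (sheet_chart Q s) (complexified_tangent CP3_chart) A" for A
    unfolding form_integral_sheet using integral_ch3_form_eq_0 connection_sheetD[OF that] by blast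
  show "\<exists>A. connection (sheet_space Q s) (sheet_chart Q s) (complexified_tangent CP3_chart) A \<and>
      0 = form_integral (sheet_chart Q s) (\<lambda>i. ch3_form (A i))"
    using connection_fs zero by metis
  show "v = 0" if "\<exists>A. connection (sheet_space Q s) (sheet_chart Q s) (complexified_tangent CP3_chart) A \<and>
      v = form_integral (sheet_chart Q s) (\<lambda>i. ch3_form (A i))" for v
    using that zero by auto
qed

theorem theorem6p2:
  fixes Q :: "(complex^4) set set" and a b :: complex
  assumes "smooth_quadric Q"
  shows "Z_strict Q a b = 0"
  unfolding Z_strict_def fundamental_cyclic_class_def tangent_class_def
  by (simp add: ch3_integral_tangent)

end
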